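(* For every $n\ge 1$, the regular representation $\mathbb{C}[S_n]$ decomposes into irreducible left $S_n$-modules as $$\mathbb{C}[S_n]=\bigoplus_{T:\ |T|=n}V_T,$$ where the sum is over all standard tableaux $T$ with $n$ boxes (of all shapes) and $V_T$ is the submodule obtained by following the induction path specified by $T$.
   Context: $S_k\subseteq S_n$ is the subgroup fixing $k+1,\ldots,n$. $X_k=(1\ k)+\cdots+(k-1\ k)\in\mathbb{C}[S_n]$, $X_1=0$. The content of a box of a Young diagram is (column index) $-$ (row index). A standard tableau of shape $\lambda\vdash n$ is a filling of the boxes of $\lambda$ by $1,\ldots,n$, each used once, increasing along rows and down columns. $b(T,i)$ is the box of $T$ containing $i$, $T^{(i)}$ the subtableau formed by $1,\ldots,i$. For a partition $\lambda$ of $k$, $V_\lambda$ denotes the irreducible complex $S_k$-module (Young's seminormal form) having a basis $\{v_T\}$ indexed by standard tableaux $T$ of shape $\lambda$ with $X_i\cdot v_T=\mathrm{cont}(b(T,i))\,v_T$ for all $i$. Given a standard tableau $T$ with $n$ boxes, let $V_{T^{(1)}}=\mathbb{C}[S_1]$ and for $2\le k\le n$ let $V_{T^{(k)}}\subseteq\mathbb{C}[S_k]$ be the unique irreducible left $S_k$-submodule of $\mathrm{Ind}_{S_{k-1}}^{S_k}V_{T^{(k-1)}}=\mathbb{C}[S_k]\cdot V_{T^{(k-1)}}\subseteq\mathbb{C}[S_k]$ isomorphic to $V_{\mathrm{shape}(T^{(k)})}$ (by the branching rule the induced module is multiplicity-free, its constituents being the $V_\lambda$ with $\lambda$ obtained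 from $\mathrm{shape}(T^{(k-1)})$ by adding one box). Then $V_T:=V_{T^{(n)}}$. *)

theory Defs
  imports Complex_Main "HOL-Library.Function_Algebras" "HOL-Algebra.Sym_Groups"
begin

section \<open>Complex vector spaces of functions\<close>

text \<open>
  All vector spaces below are subspaces of spaces of complex-valued functions, with the pointwise
  addition of \<^theory>\<open>HOL-Library.Function_Algebras\<close> and pointwise scaling. The pointwise product
  of that theory is never used; the product of the group algebra is \<open>gmult\<close> below.
\<close>

definition cscale :: "complex \<Rightarrow> ('a \<Rightarrow> complex) \<Rightarrow> 'a \<Rightarrow> complex"
  where "cscale c f = (\<lambda>x. c * f x)"

interpretation cfun: vector_space "cscale :: complex \<Rightarrow> ('a \<Rightarrow> complex) \<Rightarrow> 'a \<Rightarrow> complex"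
  by standard (auto simp: cscale_def fun_eq_iff algebra_simps)

definition supported_on :: "'a set \<Rightarrow> ('a \<Rightarrow> complex) set"
  where "supported_on S = {f. \<forall>x. x \<notin> S \<longrightarrow> f x = 0}"

definition delta :: "'a \<Rightarrow> 'a \<Rightarrow> complex"
  where "delta x = (\<lambda>y. if y = x then 1 else 0)"

text \<open>
  Internal direct sum of a finite family of subspaces: every element of \<open>W\<close> is, in exactly one way,
  a sum of elements \<open>x i \<in> V i\<close>, and all such sums lie in \<open>W\<close>.
\<close>

definition is_direct_sum :: "('a \<Rightarrow> complex) set \<Rightarrow> 'i set \<Rightarrow> ('i \<Rightarrow> ('a \<Rightarrow> complex) set) \<Rightarrow> bool"
  where "is_direct_sum W I V \<longleftrightarrow>
    finite I \<and> (\<forall>i\<in>I. cfun.subspace (V i)) \<and>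
    bij_betw (\<lambda>x. \<Sum>i\<in>I. x i) (\<Pi>\<^sub>E i\<in>I. V i) W"


section \<open>Modules over symmetric groups\<close>

text \<open>
  An \<open>S\<^sub>n\<close>-module is a subspace \<open>W\<close> together with an action \<open>\<rho>\<close>. The operators \<open>\<rho> \<sigma>\<close> are taken to be
  linear on the ambient function space; only their restrictions to \<open>W\<close> matter, and any
  linear map on a subspace extends. The same remark applies to \<open>\<phi>\<close> in \<open>module_iso\<close>.
  The product of \<open>sym_group n\<close> is composition of functions.
\<close>

definition sn_module ::
    "nat \<Rightarrow> ('a \<Rightarrow> complex) set \<Rightarrow> ((nat \<Rightarrow> nat) \<Rightarrow> ('a \<Rightarrow> complex) \<Rightarrow> ('a \<Rightarrow> complex)) \<Rightarrow> bool"
  where "sn_module n W \<rho> \<longleftrightarrow>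
    cfun.subspace W \<and>
    (\<forall>\<sigma>\<in>carrier (sym_group n). Vector_Spaces.linear cscale cscale (\<rho> \<sigma>) \<and> \<rho> \<sigma> ` W \<subseteq> W) \<and>
    (\<forall>w\<in>W. \<rho> id w = w) \<and>
    (\<forall>\<sigma>\<in>carrier (sym_group n). \<forall>\<tau>\<in>carrier (sym_group n). \<forall>w\<in>W. \<rho> (\<sigma> \<circ> \<tau>) w = \<rho> \<sigma> (\<rho> \<tau> w))"

definition irreducible_module ::
    "nat \<Rightarrow> ('a \<Rightarrow> complex) set \<Rightarrow> ((nat \<Rightarrow> nat) \<Rightarrow> ('a \<Rightarrow> complex) \<Rightarrow> ('a \<Rightarrow> complex)) \<Rightarrow> bool"
  where "irreducible_module n W \<rho> \<longleftrightarrow>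
    sn_module n W \<rho> \<and> W \<noteq> {0} \<and>
    (\<forall>U. U \<subseteq> W \<and> sn_module n U \<rho> \<longrightarrow> U = {0} \<or> U = W)"

definition module_iso ::
    "nat \<Rightarrow> ('a \<Rightarrow> complex) set \<Rightarrow> ((nat \<Rightarrow> nat) \<Rightarrow> ('a \<Rightarrow> complex) \<Rightarrow> ('a \<Rightarrow> complex)) \<Rightarrow>
      ('b \<Rightarrow> complex) set \<Rightarrow> ((nat \<Rightarrow> nat) \<Rightarrow> ('b \<Rightarrow> complex) \<Rightarrow> ('b \<Rightarrow> complex)) \<Rightarrow> bool"
  where "module_iso n W \<rho> W' \<rho>' \<longleftrightarrow>
    (\<exists>\<phi>. Vector_Spaces.linear cscale cscale \<phi> \<and> bij_betw \<phi> W W' \<and>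
      (\<forall>\<sigma>\<in>carrier (sym_group n). \<forall>w\<in>W. \<phi> (\<rho> \<sigma> w) = \<rho>' \<sigma> (\<phi> w)))"


section \<open>The group algebra\<close>

text \<open>
  A permutation of \<open>{1..k}\<close> in the sense of \<^const>\<open>permutes\<close> is a function on all of
  \<^typ>\<open>nat\<close> fixing every point outside \<open>{1..k}\<close>. So \<open>S\<^sub>k \<subseteq> S\<^sub>n\<close>, and
  \<open>group_algebra k \<subseteq> group_algebra n\<close>, hold literally for \<open>k \<le> n\<close>.
\<close>

definition group_algebra :: "nat \<Rightarrow> ((nat \<Rightarrow> nat) \<Rightarrow> complex) set"
  where "group_algebra n = supported_on (carrier (sym_group n))"

definition translate ::
    "(nat \<Rightarrow> nat) \<Rightarrow> ((nat \<Rightarrow> nat) \<Rightarrow> complex) \<Rightarrow> (nat \<Rightarrow> nat) \<Rightarrow> complex"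
  where "translate \<sigma> f = (\<lambda>\<pi>. f (inv_into UNIV \<sigma> \<circ> \<pi>))"

text \<open>
  The action of a group algebra element, extending an action of permutations linearly. The index
  set is finite whenever \<open>f\<close> lies in some \<open>group_algebra n\<close>.
\<close>

definition algebra_act ::
    "((nat \<Rightarrow> nat) \<Rightarrow> ('a \<Rightarrow> complex) \<Rightarrow> ('a \<Rightarrow> complex)) \<Rightarrow>
      ((nat \<Rightarrow> nat) \<Rightarrow> complex) \<Rightarrow> ('a \<Rightarrow> complex) \<Rightarrow> ('a \<Rightarrow> complex)"
  where "algebra_act \<rho> f w = (\<Sum>\<sigma> | f \<sigma> \<noteq> 0. cscale (f \<sigma>) (\<rho> \<sigma> w))"

definition gmult ::
    "((nat \<Rightarrow> nat) \<Rightarrow> complex) \<Rightarrow> ((nat \<Rightarrow> nat) \<Rightarrow> complex) \<Rightarrow> (nat \<Rightarrow> nat) \<Rightarrow> complex"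
  where "gmult f g = algebra_act translate f g"

definition jucys_murphy :: "nat \<Rightarrow> (nat \<Rightarrow> nat) \<Rightarrow> complex"
  where "jucys_murphy k = (\<Sum>j\<in>{1..<k}. delta (transpose j k))"


section \<open>Partitions and standard tableaux\<close>

definition is_partition :: "nat list \<Rightarrow> bool"
  where "is_partition \<mu> \<longleftrightarrow> sorted_wrt (\<ge>) \<mu> \<and> 0 \<notin> set \<mu>"

text \<open>A tableau is the list of its rows, from top to bottom; rows and columns are counted from 0.\<close>

type_synonym tableau = "nat list list"

definition tableau_shape :: "tableau \<Rightarrow> nat list"
  where "tableau_shape T = map length T"

definition standard_tableau :: "nat \<Rightarrow> tableau \<Rightarrow> bool"
  where "standard_tableau n T \<longleftrightarrow>
    is_partition (tableau_shape T) \<and>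
    distinct (concat T) \<and> set (concat T) = {1..n} \<and>
    (\<forall>row\<in>set T. sorted_wrt (<) row) \<and>
    (\<forall>r c. Suc r < length T \<and> c < length (T ! Suc r) \<longrightarrow> T ! r ! c < T ! Suc r ! c)"

definition standard_tableaux :: "nat \<Rightarrow> tableau set"
  where "standard_tableaux n = {T. standard_tableau n T}"

definition standard_tableaux_of_shape :: "nat list \<Rightarrow> tableau set"
  where "standard_tableaux_of_shape \<mu> = {T \<in> standard_tableaux (sum_list \<mu>). tableau_shape T = \<mu>}"

definition box_of :: "tableau \<Rightarrow> nat \<Rightarrow> nat \<times> nat"
  where "box_of T i = (THE (r, c). r < length T \<and> c < length (T ! r) \<and> T ! r ! c = i)"

definition content :: "nat \<times> nat \<Rightarrow> int"
  where "content = (\<lambda>(r, c). int c - int r)"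

definition subtableau :: "tableau \<Rightarrow> nat \<Rightarrow> tableau"
  where "subtableau T i = filter (\<lambda>row. row \<noteq> []) (map (filter (\<lambda>x. x \<le> i)) T)"


section \<open>The modules \<open>V\<^sub>\<mu>\<close>\<close>

text \<open>
  The module \<open>V\<^sub>\<mu>\<close> is realised on the coordinate space with basis \<open>v\<^sub>T = delta T\<close>, where \<open>T\<close> runs over
  the standard tableaux of shape \<open>\<mu>\<close>. It is an irreducible module in which the Jucys-Murphy elements
  act diagonally, by contents. These properties determine the action up to isomorphism (in
  fact up to rescaling the \<open>v\<^sub>T\<close>), and \<open>specht_action\<close> is a choice of such an action.
\<close>

definition specht_space :: "nat list \<Rightarrow> (tableau \<Rightarrow> complex) set"
  where "specht_space \<mu> = supported_on (standard_tableaux_of_shape \<mu>)"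

definition is_specht_action ::
    "nat list \<Rightarrow> ((nat \<Rightarrow> nat) \<Rightarrow> (tableau \<Rightarrow> complex) \<Rightarrow> (tableau \<Rightarrow> complex)) \<Rightarrow> bool"
  where "is_specht_action \<mu> \<rho> \<longleftrightarrow>
    irreducible_module (sum_list \<mu>) (specht_space \<mu>) \<rho> \<and>
    (\<forall>T\<in>standard_tableaux_of_shape \<mu>. \<forall>i\<in>{1..sum_list \<mu>}.
      algebra_act \<rho> (jucys_murphy i) (delta T) = cscale (of_int (content (box_of T i))) (delta T))"

definition specht_action ::
    "nat list \<Rightarrow> (nat \<Rightarrow> nat) \<Rightarrow> (tableau \<Rightarrow> complex) \<Rightarrow> (tableau \<Rightarrow> complex)"
  where "specht_action \<mu> = (SOME \<rho>. is_specht_action \<mu> \<rho>)"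


section \<open>The modules \<open>V\<^sub>T\<close>\<close>

definition induced :: "nat \<Rightarrow> ((nat \<Rightarrow> nat) \<Rightarrow> complex) set \<Rightarrow> ((nat \<Rightarrow> nat) \<Rightarrow> complex) set"
  where "induced k V = cfun.span {gmult f v | f v. f \<in> group_algebra k \<and> v \<in> V}"

text \<open>
  The module attached to \<open>subtableau T k\<close>. The value at \<open>k = 0\<close> is a dummy; the path
  starts at \<open>k = 1\<close>.
\<close>

fun path_module :: "tableau \<Rightarrow> nat \<Rightarrow> ((nat \<Rightarrow> nat) \<Rightarrow> complex) set"
  where
    "path_module T 0 = {0}"
  | "path_module T (Suc 0) = group_algebra 1"
  | "path_module T (Suc (Suc k)) =
      (THE U. U \<subseteq> induced (Suc (Suc k)) (path_module T (Suc k)) \<and>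
        irreducible_module (Suc (Suc k)) U translate \<and>
        module_iso (Suc (Suc k))
          U translate
          (specht_space (tableau_shape (subtableau T (Suc (Suc k)))))
          (specht_action (tableau_shape (subtableau T (Suc (Suc k))))))"

definition tableau_module :: "tableau \<Rightarrow> ((nat \<Rightarrow> nat) \<Rightarrow> complex) set"
  where "tableau_module T = path_module T (length (concat T))"

end

theory Submission
  imports Defs
begin

text \<open>
  Let the Jucys-Murphy elements act on the group algebra from the right. They commute with the left
  action and are self-adjoint, so their joint eigenspaces are pairwise orthogonal left submodules.
  We show that \<open>V\<^sub>T\<close> is the joint eigenspace for the contents of \<open>T\<close>. The matrix coefficients
  \<open>\<pi> \<mapsto> (\<pi>\<^sup>-\<^sup>1 w)\<^sub>T\<close> with \<open>w \<in> V\<^sub>\<mu>\<close> embed \<open>V\<^sub>\<mu>\<close> in the eigenspace of \<open>T\<close>, and since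
  \<open>\<Sum>\<^sub>\<mu> (f\<^sup>\<mu>)\<^sup>2 = n!\<close> these images fill the group algebra; hence they are the eigenspaces. Inside the module
  induced from the eigenspace of \<open>T\<^bsup>(k-1)\<^esup>\<close>, any submodule isomorphic to \<open>V\<^sub>\<mu>\<close> has its last right eigenvalue
  forced by the central sum of all transpositions, which makes it the eigenspace of \<open>T\<^bsup>(k)\<^esup>\<close>.
  The modules \<open>V\<^sub>\<mu>\<close> themselves are constructed in Young's orthogonal form.
\<close>


section \<open>Lattice words\<close>

text \<open>The modules enter the definition of V_T through a choice operator, so nothing is known
  about \<open>specht_action\<close> until some action with the required properties exists; proving
  this is the longest part. Lists of rows are awkward to modify, so the combinatorics is done on
  words: \<open>w i\<close> is the row of \<open>i\<close>, exchanging entries is precomposition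
  with a transposition, and adding the largest entry is appending a letter. The orthogonal form is
  convenient because its off-diagonal coefficient depends only on the absolute value of the axial
  distance: both tableaux of an exchange play the same role, and the coefficient vanishes exactly
  when the exchange leaves the standard tableaux. Distinct content vectors make the coefficient maps
  independent; the count of pairs turns this independence into surjectivity. The definite
  description in \<open>path_module\<close> is resolved by containment: every candidate is a nonzero
  submodule of one irreducible eigenspace, hence equal to it.\<close>

definition row_count :: "(nat \<Rightarrow> nat) \<Rightarrow> nat \<Rightarrow> nat \<Rightarrow> nat"
  where "row_count w k r = card {i \<in> {1..k}. w i = r}"

text \<open>The Yamanouchi condition: the row lengths of every prefix form a partition, so each
  prefix describes a standard tableau.\<close>

definition lattice_word :: "nat \<Rightarrow> (nat \<Rightarrow> nat) \<Rightarrow> bool"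
  where "lattice_word n w \<longleftrightarrow> (\<forall>k\<le>n. \<forall>r. row_count w k (Suc r) \<le> row_count w k r)"

text \<open>Letter \<open>i\<close> is appended to row \<open>w i\<close>, so its column, counted
  from 0, is the length of that row just before.\<close>

definition word_content :: "(nat \<Rightarrow> nat) \<Rightarrow> nat \<Rightarrow> int"
  where "word_content w i = int (row_count w (i - 1) (w i)) - int (w i)"

lemma row_count_0 [simp]: "row_count w 0 r = 0"
  by (simp add: row_count_def)

lemma row_count_Suc: "row_count w (Suc k) r = row_count w k r + (if w (Suc k) = r then 1 else 0)"
proof -
  have "{i \<in> {1..Suc k}. w i = r} =
      (if w (Suc k) = r then insert (Suc k) {i \<in> {1..k}. w i = r} else {i \<in> {1..k}. w i = r})"
    by (auto simp: le_Suc_eq)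
  then show ?thesis
    by (simp add: row_count_def)
qed

lemma row_count_cong: "(\<And>i. i \<in> {1..k} \<Longrightarrow> w i = w' i) \<Longrightarrow> row_count w k r = row_count w' k r"
  unfolding row_count_def by (rule arg_cong[where f = card]) auto

lemma word_content_cong:
  "(\<And>j. j \<in> {1..i} \<Longrightarrow> w j = w' j) \<Longrightarrow> i \<ge> 1 \<Longrightarrow> word_content w i = word_content w' i"
proof -
  assume *: "\<And>j. j \<in> {1..i} \<Longrightarrow> w j = w' j" "i \<ge> 1"
  have "row_count w (i - 1) r = row_count w' (i - 1) r" for r
    by (rule row_count_cong) (use * in auto)
  with * show ?thesis
    by (simp add: word_content_def)
qed

lemma lattice_word_cong:
  assumes "\<And>i. i \<in> {1..n} \<Longrightarrow> w i = w' i"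
  shows "lattice_word n w = lattice_word n w'"
proof -
  have "row_count w k r = row_count w' k r" if "k \<le> n" for k r
    by (rule row_count_cong) (use assms that in auto)
  then show ?thesis
    by (auto simp: lattice_word_def)
qed

lemma lattice_word_mono: "lattice_word n w \<Longrightarrow> k \<le> n \<Longrightarrow> lattice_word k w"
  by (auto simp: lattice_word_def)

lemma lattice_wordD: "lattice_word n w \<Longrightarrow> k \<le> n \<Longrightarrow> row_count w k (Suc r) \<le> row_count w k r"
  by (auto simp: lattice_word_def)

lemma lattice_word_Suc:
  "lattice_word (Suc n) w \<longleftrightarrow>
    lattice_word n w \<and> (\<forall>r. row_count w (Suc n) (Suc r) \<le> row_count w (Suc n) r)"
  by (auto simp: lattice_word_def le_Suc_eq)

section \<open>Contents as coordinates of a lattice word\<close>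

lemma lattice_word_antimono:
  assumes "lattice_word n w" "k \<le> n" "r \<le> s"
  shows "row_count w k s \<le> row_count w k r"
  using lift_Suc_antimono_le[of "row_count w k" r s] lattice_wordD[OF assms(1,2)] assms(3) by blast

text \<open>Row lengths weakly decrease, so the contents \<open>row_count w k r - r\<close> of the
  boxes just past the row ends strictly decrease. A box added to a shape is therefore determined by
  its content.\<close>

lemma shifted_row_inj:
  assumes "lattice_word n w" "k \<le> n" "int (row_count w k r) - int r = int (row_count w k s) - int s"
  shows "r = s"
  using lattice_word_antimono[OF assms(1,2), of r s] lattice_word_antimono[OF assms(1,2), of s r] assms(3)
  by linarith

text \<open>Once the first \<open>n\<close> letters agree, both words have the same shape there, and
  the last content singles out the row of the last letter.\<close>

lemma word_content_inj:
  assumes "lattice_word n w" "lattice_word n w'"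
    and "\<And>i. i \<in> {1..n} \<Longrightarrow> word_content w i = word_content w' i"
  shows "\<forall>i\<in>{1..n}. w i = w' i"
  using assms
proof (induction n)
  case (Suc n)
  then have IH: "\<forall>i\<in>{1..n}. w i = w' i"
    by (auto simp: lattice_word_Suc)
  have "row_count w n r = row_count w' n r" for r
    by (rule row_count_cong) (use IH in auto)
  then have "w (Suc n) = w' (Suc n)"
    using Suc.prems(3)[of "Suc n"] shifted_row_inj[OF Suc.prems(1), of n "w (Suc n)" "w' (Suc n)"]
    by (simp add: word_content_def)
  with IH show ?case
    by (auto simp: le_Suc_eq)
qed auto

lemma word_content_1: "lattice_word n w \<Longrightarrow> 1 \<le> n \<Longrightarrow> word_content w 1 = 0"
proof -
  assume "lattice_word n w" "1 \<le> n"
  then have *: "row_count w 1 (Suc r) \<le> row_count w 1 r" for r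
    by (simp add: lattice_word_def)
  have "w 1 = 0"
  proof (rule ccontr)
    assume "w 1 \<noteq> 0"
    then obtain r where "w 1 = Suc r" by (cases "w 1") auto
    with *[of r] show False by (simp add: row_count_Suc)
  qed
  then show ?thesis by (simp add: word_content_def)
qed

text \<open>In one row the second content is larger by 1; in different rows both boxes lie just past
  row ends of the same shape, where contents are distinct.\<close>

lemma word_content_Suc_neq:
  assumes "lattice_word n w" "1 \<le> i" "i < n"
  shows "word_content w i \<noteq> word_content w (Suc i)"
proof -
  obtain m where i: "i = Suc m" using assms(2) by (cases i) auto
  show ?thesis
    using shifted_row_inj[OF assms(1), of m "w (Suc m)" "w (Suc (Suc m))"] assms i
    by (auto simp: word_content_def row_count_Suc)
qed

text \<open>Two consecutive boxes of a diagonal are filled only with the box to the right of the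
  first and the box below it filled in between, and one letter cannot fill both. This keeps the sum
  of two adjacent axial distances nonzero in \<open>orth_braid\<close>.\<close>

lemma word_content_Suc_Suc_neq:
  assumes "lattice_word n w" "1 \<le> i" "Suc i < n"
  shows "word_content w i \<noteq> word_content w (Suc (Suc i))"
proof
  obtain m where i: "i = Suc m" using assms(2) by (cases i) auto
  define a b c where "a = w (Suc m)" and "b = w (Suc (Suc m))" and "c = w (Suc (Suc (Suc m)))"
  note abc = a_def[symmetric] b_def[symmetric] c_def[symmetric]
  let ?l = "row_count w m"
  assume "word_content w i = word_content w (Suc (Suc i))"
  then have eq: "int (?l a) - int a = int (?l c) + (if a = c then 1 else 0) + (if b = c then 1 else 0) - int c"
    by (simp add: word_content_def row_count_Suc i abc split: if_splits)
  then have ac: "a \<noteq> c" by (auto split: if_splits)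
  have "b = c"
    using shifted_row_inj[OF assms(1), of m a c] assms(3) eq ac by (auto simp: i split: if_splits)
  with eq ac have eq': "int (?l a) - int a = int (?l c) + 1 - int c" by simp
  have m: "m \<le> n" "Suc (Suc (Suc m)) \<le> n" using assms i by auto
  have "a < c"
    using lattice_word_antimono[OF assms(1) m(1), of c a] eq' ac by linarith
  moreover from this have "c \<le> Suc a"
    using lattice_word_antimono[OF assms(1) m(1), of a c] eq' by linarith
  ultimately have "c = Suc a" by simp
  \<comment> \<open>Rows \<open>a\<close> and \<open>c = Suc a\<close> start with equal lengths; row
    \<open>c\<close> then gains two boxes and row \<open>a\<close> only one.\<close>
  with lattice_wordD[OF assms(1) m(2), of a] eq' \<open>b = c\<close> show False
    by (simp add: row_count_Suc abc)
qed

section \<open>Exchanging adjacent letters\<close>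

lemma row_count_swap:
  assumes "1 \<le> i" "k \<noteq> i"
  shows "row_count (w \<circ> transpose i (Suc i)) k r = row_count w k r"
proof (cases "k < i")
  case True
  then show ?thesis
    by (intro row_count_cong) (auto simp: transpose_def)
next
  case False
  obtain m where i: "i = Suc m" using assms(1) by (cases i) auto
  have "row_count (w \<circ> transpose i (Suc i)) m r = row_count w m r" for r
    by (rule row_count_cong) (auto simp: transpose_def i)
  then have swapped: "row_count (w \<circ> transpose i (Suc i)) (Suc i) r = row_count w (Suc i) r"
    by (simp add: row_count_Suc i)
  have "Suc i \<le> k" using False assms by simp
  then show ?thesis
  proof (induction k rule: dec_induct)
    case base
    show ?case by (rule swapped)
  next
    case (step k)
    then show ?case
      by (simp add: row_count_Suc[of _ k] transpose_def)
  qed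
qed

lemma row_count_swap_same:
  "row_count (w \<circ> transpose (Suc m) (Suc (Suc m))) (Suc m) r =
    row_count w m r + (if w (Suc (Suc m)) = r then 1 else 0)"
  using row_count_swap[of "Suc m" m w r] by (simp add: row_count_Suc)

text \<open>Only the prefix of length \<open>i\<close> contains exactly one of the exchanged
  letters. There the condition can fail only if the box of \<open>Suc i\<close> lies directly below
  that of \<open>i\<close>, and then the contents differ by 1.\<close>

lemma lattice_word_swap:
  assumes w: "lattice_word n w" and i: "1 \<le> i" "i < n"
    and d: "\<bar>word_content w (Suc i) - word_content w i\<bar> \<noteq> 1"
  shows "lattice_word n (w \<circ> transpose i (Suc i))"
  unfolding lattice_word_def
proof (intro allI impI)
  fix k r assume k: "k \<le> n"
  obtain m where m: "i = Suc m" using i by (cases i) auto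
  let ?a = "w (Suc m)" and ?b = "w (Suc (Suc m))"
  have ab: "?a \<noteq> ?b"
    using d by (auto simp: word_content_def row_count_Suc m)
  show "row_count (w \<circ> transpose i (Suc i)) k (Suc r) \<le> row_count (w \<circ> transpose i (Suc i)) k r"
  proof (cases "k = i")
    case True
    have 1: "row_count w m (Suc r) \<le> row_count w m r"
      using lattice_wordD[OF w, of m] i m by simp
    have 2: "row_count w (Suc (Suc m)) (Suc r) \<le> row_count w (Suc (Suc m)) r"
      using lattice_wordD[OF w, of "Suc (Suc m)"] i m by simp
    have "\<not> (?a = r \<and> ?b = Suc r \<and> row_count w m (Suc r) = row_count w m r)"
      using d ab by (auto simp: word_content_def row_count_Suc m)
    with 1 2 ab show ?thesis
      unfolding True m row_count_swap_same
      by (auto simp: row_count_Suc split: if_splits)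
  next
    case False
    then show ?thesis
      using lattice_wordD[OF w k] i by (simp add: row_count_swap)
  qed
qed

text \<open>In different rows neither letter affects the column of the other, so the two boxes stay
  and only their labels are exchanged.\<close>

lemma word_content_swap:
  assumes i: "1 \<le> i" and ne: "w i \<noteq> w (Suc i)" and j: "1 \<le> j"
  shows "word_content (w \<circ> transpose i (Suc i)) j = word_content w (transpose i (Suc i) j)"
proof -
  obtain m where m: "i = Suc m" using i by (cases i) auto
  consider "j = i" | "j = Suc i" | "j \<noteq> i" "j \<noteq> Suc i" by blast
  then show ?thesis
  proof cases
    case 1
    then show ?thesis
      using row_count_swap[of i m w] i ne by (simp add: word_content_def m row_count_Suc)
  next
    case 2
    then show ?thesis
      using ne row_count_swap_same[of w m] by (auto simp: word_content_def m)
  next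
    case 3
    then have "j - 1 \<noteq> i" using j by auto
    with 3 show ?thesis
      using row_count_swap[of i "j - 1" w] i by (simp add: word_content_def transpose_def)
  qed
qed

lemma row_neq_of_content:
  assumes "1 \<le> i" "\<bar>word_content w (Suc i) - word_content w i\<bar> \<noteq> 1"
  shows "w i \<noteq> w (Suc i)"
proof -
  obtain m where "i = Suc m" using assms by (cases i) auto
  with assms show ?thesis by (auto simp: word_content_def row_count_Suc)
qed

section \<open>Words of prescribed shape and the paths between them\<close>

lemma lattice_word_snoc:
  assumes "lattice_word n v" "\<And>r. row_count v n (Suc r) + (if a = Suc r then 1 else 0) \<le> row_count v n r + (if a = r then 1 else 0)"
  shows "lattice_word (Suc n) (v(Suc n := a))"
proof -
  have eq: "row_count (v(Suc n := a)) n r = row_count v n r" for r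
    by (rule row_count_cong) auto
  have "lattice_word n (v(Suc n := a))"
    using assms(1) lattice_word_cong[of n "v(Suc n := a)" v] by auto
  then show ?thesis
    using assms(2) by (simp add: lattice_word_Suc row_count_Suc eq)
qed

lemma row_count_snoc:
  "row_count (v(Suc n := a)) (Suc n) r = row_count v n r + (if a = r then 1 else 0)"
  "row_count (v(Suc n := a)) n r = row_count v n r"
proof -
  show "row_count (v(Suc n := a)) n r = row_count v n r"
    by (rule row_count_cong) auto
  then show "row_count (v(Suc n := a)) (Suc n) r = row_count v n r + (if a = r then 1 else 0)"
    by (simp add: row_count_Suc)
qed

lemma sum_row_count:
  assumes "\<And>i. i \<in> {1..n} \<Longrightarrow> w i < N"
  shows "(\<Sum>r<N. row_count w n r) = n"
  using assms
proof (induction n)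
  case (Suc n)
  then show ?case
    by (simp add: row_count_Suc sum.distrib)
qed simp

lemma row_count_eq_0: "row_count w n r = 0 \<longleftrightarrow> (\<forall>i\<in>{1..n}. w i \<noteq> r)"
  by (auto simp: row_count_def)

lemma lattice_word_exists:
  assumes "\<And>r. f (Suc r) \<le> f r" "\<And>r. N \<le> r \<Longrightarrow> f r = 0" "(\<Sum>r<N. f r) = n"
  shows "\<exists>w. lattice_word n w \<and> row_count w n = f"
  using assms
proof (induction n arbitrary: f)
  case 0
  then have "f r = 0" for r
    by (cases "r < N") auto
  then show ?case
    by (auto simp: lattice_word_def fun_eq_iff)
next
  case (Suc n)
  \<comment> \<open>\<open>r\<close> is the last nonempty row, which always ends in a removable
    box.\<close>
  define r where "r = (LEAST r. f (Suc r) = 0)"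
  have "f (Suc N) = 0" using Suc.prems(2) by simp
  then have fr: "f (Suc r) = 0"
    unfolding r_def by (rule LeastI)
  have anti: "s \<le> t \<Longrightarrow> f t \<le> f s" for s t
    using lift_Suc_antimono_le[of f s t] Suc.prems(1) by blast
  have "f 0 \<noteq> 0"
  proof
    assume "f 0 = 0"
    then have "f s = 0" for s using anti[of 0 s] by simp
    then show False using Suc.prems(3) by simp
  qed
  have pos: "f r > 0"
  proof (cases r)
    case 0
    then show ?thesis using \<open>f 0 \<noteq> 0\<close> by simp
  next
    case (Suc s)
    then have "f (Suc s) \<noteq> 0"
      using not_less_Least[of s "\<lambda>r. f (Suc r) = 0"] by (simp add: r_def)
    with Suc show ?thesis by simp
  qed
  define f' where "f' = f(r := f r - 1)"
  have rN: "r < N"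
    using pos Suc.prems(2)[of r] by (cases "r < N") auto
  have "(\<Sum>s<N. f s) = f r + (\<Sum>s\<in>{..<N} - {r}. f s)"
    using rN by (simp add: sum.remove)
  moreover have "(\<Sum>s<N. f' s) = f r - 1 + (\<Sum>s\<in>{..<N} - {r}. f s)"
    using rN by (simp add: sum.remove[of _ r] f'_def)
  ultimately have "(\<Sum>s<N. f' s) = n"
    using Suc.prems(3) pos by simp
  moreover have "f' (Suc s) \<le> f' s" for s
    using Suc.prems(1)[of s] fr by (auto simp: f'_def)
  moreover have "N \<le> s \<Longrightarrow> f' s = 0" for s
    using Suc.prems(2) by (auto simp: f'_def)
  ultimately obtain v where v: "lattice_word n v" "row_count v n = f'"
    using Suc.IH[of f'] by blast
  have f: "f s = f' s + (if r = s then 1 else 0)" for s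
    using pos by (auto simp: f'_def)
  have "lattice_word (Suc n) (v(Suc n := r))"
    by (rule lattice_word_snoc[OF v(1)]) (use Suc.prems(1) f v(2) in metis)
  moreover have "row_count (v(Suc n := r)) (Suc n) = f"
    by (simp add: fun_eq_iff row_count_snoc v(2) f)
  ultimately show ?case by blast
qed

text \<open>Meant for words whose last letters differ: it supplies a word of the same shape ending
  with \<open>b\<close> and then \<open>a\<close>, so that one admissible exchange turns the last
  letter from \<open>a\<close> into \<open>b\<close>. Both corners can be removed from the common
  shape, and \<open>lattice_word_exists\<close> fills the rest.\<close>

lemma lattice_word_two_corners:
  assumes w: "lattice_word (Suc (Suc m)) w" "lattice_word (Suc (Suc m)) w'"
    and eq: "row_count w (Suc (Suc m)) = row_count w' (Suc (Suc m))"
    and ab: "w (Suc (Suc m)) = a" "w' (Suc (Suc m)) = b" "a \<noteq> b"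
  obtains v where "lattice_word (Suc (Suc m)) v" "row_count v (Suc (Suc m)) = row_count w (Suc (Suc m))"
    "v (Suc m) = b" "v (Suc (Suc m)) = a"
    "\<bar>word_content v (Suc (Suc m)) - word_content v (Suc m)\<bar> \<noteq> 1"
proof -
  define f where "f = row_count w (Suc (Suc m))"
  \<comment> \<open>The shape without both corners; \<open>wg\<close> and \<open>wg'\<close> show
    that it can be extended by either corner alone.\<close>
  define g where "g r = f r - (if a = r then 1 else 0) - (if b = r then 1 else 0)" for r
  have fw: "f r = row_count w (Suc m) r + (if a = r then 1 else 0)" for r
    using ab by (simp add: f_def row_count_Suc[of _ "Suc m"])
  have fw': "f r = row_count w' (Suc m) r + (if b = r then 1 else 0)" for r
    using ab eq by (simp add: f_def row_count_Suc[of _ "Suc m"])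
  have fg: "f r = g r + (if a = r then 1 else 0) + (if b = r then 1 else 0)" for r
    using fw[of r] fw'[of r] ab(3) by (auto simp: g_def)
  have wg: "row_count w (Suc m) r = g r + (if b = r then 1 else 0)" for r
    using fw[of r] fg[of r] by auto
  have wg': "row_count w' (Suc m) r = g r + (if a = r then 1 else 0)" for r
    using fw'[of r] fg[of r] by auto
  have f_anti: "f (Suc r) \<le> f r" for r
    using lattice_wordD[OF w(1), of "Suc (Suc m)" r] by (simp add: f_def)
  have gb_anti: "g (Suc r) + (if b = Suc r then 1 else 0) \<le> g r + (if b = r then 1 else 0)" for r
    using lattice_wordD[OF w(1), of "Suc m" r] by (simp add: wg)
  have ga_anti: "g (Suc r) + (if a = Suc r then 1 else 0) \<le> g r + (if a = r then 1 else 0)" for r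
    using lattice_wordD[OF w(2), of "Suc m" r] by (simp add: wg')
  have g_anti: "g (Suc r) \<le> g r" for r
    using ga_anti[of r] gb_anti[of r] ab(3) by (auto split: if_splits)
  define N where "N = Suc (\<Sum>i\<in>{1..Suc (Suc m)}. w i)"
  have N: "w i < N" if "i \<in> {1..Suc (Suc m)}" for i
    using member_le_sum[of i "{1..Suc (Suc m)}" w] that by (simp add: N_def)
  have fN: "f r = 0" if "N \<le> r" for r
    unfolding f_def row_count_eq_0 using N that by (metis not_less)
  have less: "a < N" "b < N"
    using fN[of a] fN[of b] fg[of a] fg[of b] by (force simp: not_less[symmetric])+
  have "(\<Sum>r<N. f r) = Suc (Suc m)"
    unfolding f_def by (rule sum_row_count) (use N in auto)
  then have "(\<Sum>r<N. g r) = m"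
    using less by (simp add: fg sum.distrib)
  moreover have "N \<le> r \<Longrightarrow> g r = 0" for r
    using fN[of r] fg[of r] by simp
  ultimately obtain v where v: "lattice_word m v" "row_count v m = g"
    using lattice_word_exists[of g N m] g_anti by blast
  define u where "u = v(Suc m := b)"
  have u: "lattice_word (Suc m) u" "row_count u (Suc m) r = g r + (if b = r then 1 else 0)" for r
    using lattice_word_snoc[OF v(1), of b] gb_anti by (simp_all add: u_def row_count_snoc v(2))
  define x where "x = u(Suc (Suc m) := a)"
  have x: "lattice_word (Suc (Suc m)) x"
    unfolding x_def by (rule lattice_word_snoc[OF u(1)]) (use f_anti in \<open>simp add: u fg add_ac\<close>)
  have xf: "row_count x (Suc (Suc m)) = f"
    by (simp add: x_def row_count_snoc u fg fun_eq_iff add_ac)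
  have vals: "x (Suc m) = b" "x (Suc (Suc m)) = a"
    by (simp_all add: x_def u_def)
  have xm: "row_count x m r = g r" for r
    using row_count_cong[of m x v r] by (simp add: x_def u_def v(2))
  have cont: "word_content x (Suc m) = int (g b) - int b"
      "word_content x (Suc (Suc m)) = int (g a) - int a"
    using ab(3) by (simp_all add: word_content_def vals xm row_count_Suc)
  have anti: "s \<le> t \<Longrightarrow> g t \<le> g s" for s t
    using lift_Suc_antimono_le[of g s t] g_anti by blast
  \<comment> \<open>Contents differing by 1 would put the corners in consecutive rows of equal
    length in \<open>g\<close>; but then the lower row could not be extended first, contrary to
    \<open>ga_anti\<close> or \<open>gb_anti\<close>.\<close>
  have "\<bar>word_content x (Suc (Suc m)) - word_content x (Suc m)\<bar> \<noteq> 1"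
  proof
    assume d: "\<bar>word_content x (Suc (Suc m)) - word_content x (Suc m)\<bar> = 1"
    show False
    proof (cases "a < b")
      case True
      with d anti[of a b] have "b = Suc a" "g b = g a"
        unfolding cont by linarith+
      then show False using gb_anti[of a] by simp
    next
      case False
      with ab(3) d anti[of b a] have "a = Suc b" "g b = g a"
        unfolding cont by linarith+
      then show False using ga_anti[of b] by simp
    qed
  qed
  with that x xf vals show thesis
    by (simp add: f_def)
qed

text \<open>Any two standard fillings of a shape are joined by admissible exchanges. If the last
  letters agree, the induction hypothesis is applied with that letter frozen; otherwise the path
  runs through the word of \<open>lattice_word_two_corners\<close>. The last hypothesis is there
  because words are total functions and only their values on \<open>{1..n}\<close> carry
  meaning.\<close>

lemma lattice_word_connected:
  assumes "lattice_word n w" "lattice_word n w'" "row_count w n = row_count w' n" "Q w"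
    and "\<And>v i. lattice_word n v \<Longrightarrow> Q v \<Longrightarrow> 1 \<le> i \<Longrightarrow> i < n \<Longrightarrow>
      \<bar>word_content v (Suc i) - word_content v i\<bar> \<noteq> 1 \<Longrightarrow> Q (v \<circ> transpose i (Suc i))"
    and "\<And>v v'. Q v \<Longrightarrow> (\<And>i. i \<in> {1..n} \<Longrightarrow> v i = v' i) \<Longrightarrow> Q v'"
  shows "Q w'"
  using assms
proof (induction n arbitrary: w w' Q)
  case 0
  then show ?case by auto
next
  case (Suc n)
  note step = Suc.prems(5) and cong = Suc.prems(6)
  have same: "Q v'" if v: "lattice_word (Suc n) v" "lattice_word (Suc n) v'"
      "row_count v (Suc n) = row_count v' (Suc n)" "v (Suc n) = v' (Suc n)" "Q v" for v v'
  proof -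
    define a where "a = v (Suc n)"
    \<comment> \<open>The shape is part of \<open>Q'\<close> because it guarantees that appending
      \<open>a\<close> gives a lattice word again.\<close>
    define Q' where "Q' u \<longleftrightarrow> Q (u(Suc n := a)) \<and> row_count u n = row_count v n" for u
    have "row_count v (Suc n) r = row_count v' (Suc n) r" for r
      using v(3) by simp
    then have eq: "row_count v n = row_count v' n"
      using v(4) by (simp add: row_count_Suc fun_eq_iff)
    have "Q' v'"
    proof (rule Suc.IH[of v v' Q'])
      show "Q' v" using v(5) by (simp add: Q'_def a_def)
    next
      fix u i
      assume u: "lattice_word n u" "Q' u" "1 \<le> i" "i < n"
        "\<bar>word_content u (Suc i) - word_content u i\<bar> \<noteq> 1"
      let ?u = "u(Suc n := a)"
      have rc: "row_count u n = row_count v n" using u(2) by (simp add: Q'_def)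
      have "lattice_word (Suc n) ?u"
        using lattice_wordD[OF v(1), of "Suc n"] by (intro lattice_word_snoc u) (simp add: rc row_count_Suc a_def)
      moreover have "word_content ?u j = word_content u j" if "1 \<le> j" "j \<le> n" for j
        by (rule word_content_cong) (use that in auto)
      ultimately have "Q (?u \<circ> transpose i (Suc i))"
        using u by (intro step) (simp_all add: Q'_def del: fun_upd_apply)
      then have "Q ((u \<circ> transpose i (Suc i))(Suc n := a))"
        by (rule cong) (use u in \<open>auto simp: transpose_def\<close>)
      then show "Q' (u \<circ> transpose i (Suc i))"
        using u(3,4) by (simp add: Q'_def row_count_swap rc fun_eq_iff)
    next
      fix u u' assume u: "Q' u" "\<And>i. i \<in> {1..n} \<Longrightarrow> u i = u' i"
      have "Q (u'(Suc n := a))"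
        by (rule cong[of "u(Suc n := a)"]) (use u in \<open>auto simp: Q'_def simp del: fun_upd_apply\<close>, auto)
      moreover have "row_count u' n r = row_count u n r" for r
        by (rule row_count_cong) (use u in auto)
      ultimately show "Q' u'"
        using u(1) by (simp add: Q'_def fun_eq_iff)
    qed (use v eq in \<open>auto simp: lattice_word_Suc\<close>)
    then show ?thesis
      using v(4) by (simp add: Q'_def a_def)
  qed
  show ?case
  proof (cases "w (Suc n) = w' (Suc n)")
    case True
    then show ?thesis using same[of w w'] Suc.prems(1-4) by blast
  next
    case False
    have "n \<noteq> 0"
    proof
      assume "n = 0"
      with Suc.prems(1,2) have "\<forall>i\<in>{1..Suc 0}. w i = w' i"
        using word_content_1[of "Suc 0"] by (intro word_content_inj) auto
      with False \<open>n = 0\<close> show False by simp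
    qed
    then obtain m where m: "n = Suc m" by (cases n) auto
    obtain v where v: "lattice_word (Suc n) v" "row_count v (Suc n) = row_count w (Suc n)"
      "v n = w' (Suc n)" "v (Suc n) = w (Suc n)"
      "\<bar>word_content v (Suc n) - word_content v n\<bar> \<noteq> 1"
      using lattice_word_two_corners[of m w w' "w (Suc n)" "w' (Suc n)"] Suc.prems(1-3) False
      unfolding m by metis
    have "Q v" using same[of w v] v Suc.prems(1-4) by auto
    with v m have "Q (v \<circ> transpose n (Suc n))"
      by (intro step) auto
    moreover have "lattice_word (Suc n) (v \<circ> transpose n (Suc n))"
      using v m by (intro lattice_word_swap) auto
    moreover have "row_count (v \<circ> transpose n (Suc n)) (Suc n) = row_count w' (Suc n)"
      using v(2) Suc.prems(3) m by (simp add: row_count_swap fun_eq_iff)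
    moreover have "(v \<circ> transpose n (Suc n)) (Suc n) = w' (Suc n)"
      using v(3) by simp
    ultimately show ?thesis
      using same[of "v \<circ> transpose n (Suc n)" w'] Suc.prems(2) by blast
  qed
qed


section \<open>Counting pairs of words\<close>

text \<open>Restricting to extensional functions leaves exactly one word per standard tableau, so
  that cardinalities count tableaux.\<close>

definition lattice_words :: "nat \<Rightarrow> (nat \<Rightarrow> nat) set"
  where "lattice_words n = {w \<in> {1..n} \<rightarrow>\<^sub>E UNIV. lattice_word n w}"

definition num_words :: "nat \<Rightarrow> (nat \<Rightarrow> nat) \<Rightarrow> nat"
  where "num_words n f = card {w \<in> lattice_words n. row_count w n = f}"

definition addable :: "(nat \<Rightarrow> nat) \<Rightarrow> nat set"
  where "addable f = {a. a = 0 \<or> f a < f (a - 1)}"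

definition removable :: "(nat \<Rightarrow> nat) \<Rightarrow> nat set"
  where "removable f = {a. f (Suc a) < f a}"

lemma addable_eq: "addable f = insert 0 (Suc ` removable f)"
proof (rule Set.set_eqI)
  show "a \<in> addable f \<longleftrightarrow> a \<in> insert 0 (Suc ` removable f)" for a
    by (cases a) (auto simp: addable_def removable_def)
qed

text \<open>Rows are opened from the top one at a time, so \<open>n\<close> letters reach only rows
  of index less than \<open>n\<close>. This makes the set of words finite.\<close>

lemma row_count_bound: "lattice_word n w \<Longrightarrow> n \<le> r \<Longrightarrow> row_count w n r = 0"
proof (induction n arbitrary: r)
  case (Suc n)
  then obtain s where s: "r = Suc s" "n \<le> s" by (cases r) auto
  have "row_count w n (Suc s) = 0" "row_count w n s = 0"
    using Suc s by (simp_all add: lattice_word_Suc)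
  then show ?case
    using lattice_wordD[OF Suc.prems(1), of "Suc n" s] by (auto simp: s row_count_Suc split: if_splits)
qed simp

lemma lattice_word_less: "lattice_word n w \<Longrightarrow> i \<in> {1..n} \<Longrightarrow> w i < n"
  using row_count_bound[of n w "w i"] row_count_eq_0[of w n "w i"] by (metis not_less)

lemma finite_lattice_words: "finite (lattice_words n)"
proof (rule finite_subset)
  show "lattice_words n \<subseteq> {1..n} \<rightarrow>\<^sub>E {..<n}"
  proof
    fix w assume "w \<in> lattice_words n"
    then show "w \<in> {1..n} \<rightarrow>\<^sub>E {..<n}"
      using lattice_word_less[of n w] by (auto simp: lattice_words_def PiE_iff)
  qed
qed (simp add: finite_PiE)

lemma finite_removable: "finite {r. f r \<noteq> 0} \<Longrightarrow> finite (removable f)"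
  by (erule rev_finite_subset) (auto simp: removable_def)

lemma finite_support_row_count: "finite {r. row_count w n r \<noteq> 0}"
proof (rule finite_subset)
  show "{r. row_count w n r \<noteq> 0} \<subseteq> w ` {1..n}"
    by (auto simp: row_count_eq_0)
qed simp

lemma card_addable: "finite (removable f) \<Longrightarrow> card (addable f) = Suc (card (removable f))"
  by (simp add: addable_eq card_image image_iff)

lemma lattice_words_Suc_bij:
  "bij_betw (\<lambda>(v, a). v(Suc n := a)) (SIGMA v:lattice_words n. addable (row_count v n)) (lattice_words (Suc n))"
  (is "bij_betw ?h ?A ?B")
proof (rule bij_betw_byWitness[where f' = "\<lambda>w. (restrict w {1..n}, w (Suc n))"])
  show "\<forall>x\<in>?A. (restrict (?h x) {1..n}, ?h x (Suc n)) = x"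
    by (auto simp: lattice_words_def fun_eq_iff PiE_def extensional_def)
  show "\<forall>w\<in>?B. ?h (restrict w {1..n}, w (Suc n)) = w"
    by (auto simp: lattice_words_def fun_eq_iff PiE_def extensional_def)
  show "?h ` ?A \<subseteq> ?B"
  proof clarsimp
    fix v a assume v: "v \<in> lattice_words n" and a: "a \<in> addable (row_count v n)"
    have "lattice_word n v" using v by (simp add: lattice_words_def)
    moreover from this have "row_count v n (Suc r) + (if a = Suc r then 1 else 0)
        \<le> row_count v n r + (if a = r then 1 else 0)" for r
      using a lattice_wordD[of n v n r] by (auto simp: addable_def)
    ultimately have "lattice_word (Suc n) (v(Suc n := a))"
      by (rule lattice_word_snoc)
    with v show "v(Suc n := a) \<in> lattice_words (Suc n)"
      by (auto simp: lattice_words_def PiE_def extensional_def)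
  qed
  show "(\<lambda>w. (restrict w {1..n}, w (Suc n))) ` ?B \<subseteq> ?A"
  proof clarsimp
    fix w assume w: "w \<in> lattice_words (Suc n)"
    then have lw: "lattice_word (Suc n) w" by (simp add: lattice_words_def)
    have rc: "row_count (restrict w {1..n}) n = row_count w n"
      by (rule ext, rule row_count_cong) auto
    have "lattice_word n (restrict w {1..n})"
      using lattice_word_cong[of n "restrict w {1..n}" w] lw by (simp add: lattice_word_Suc)
    moreover have "w (Suc n) \<in> addable (row_count w n)"
    proof (cases "w (Suc n)")
      case (Suc r)
      then show ?thesis
        using lattice_wordD[OF lw, of "Suc n" r] by (simp add: addable_def row_count_Suc)
    qed (simp add: addable_def)
    ultimately show "restrict w {Suc 0..n} \<in> lattice_words n \<and>
        w (Suc n) \<in> addable (row_count (restrict w {Suc 0..n}) n)"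
      using rc by (simp add: lattice_words_def)
  qed
qed

text \<open>The largest entry occupies a removable corner; deleting it is the downward recursion for
  the number of standard tableaux of a shape.\<close>

lemma num_words_Suc:
  assumes anti: "\<And>r. g (Suc r) \<le> g r" and fin: "finite {r. g r \<noteq> 0}"
  shows "num_words (Suc n) g = (\<Sum>a\<in>removable g. num_words n (g(a := g a - 1)))"
proof -
  let ?S = "SIGMA a:removable g. {v \<in> lattice_words n. row_count v n = g(a := g a - 1)}"
  have iff: "row_count (v(Suc n := a)) (Suc n) = g \<longleftrightarrow> a \<in> removable g \<and> row_count v n = g(a := g a - 1)"
    if "lattice_word n v" "a \<in> addable (row_count v n)" for v a
  proof
    assume eq: "row_count (v(Suc n := a)) (Suc n) = g"
    then have g: "g r = row_count v n r + (if a = r then 1 else 0)" for r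
      by (simp add: row_count_snoc flip: eq)
    show "a \<in> removable g \<and> row_count v n = g(a := g a - 1)"
      using g lattice_wordD[OF that(1), of n a] by (auto simp: removable_def fun_eq_iff)
  next
    assume "a \<in> removable g \<and> row_count v n = g(a := g a - 1)"
    then show "row_count (v(Suc n := a)) (Suc n) = g"
      by (auto simp: fun_eq_iff row_count_snoc removable_def)
  qed
  have add: "a \<in> addable (row_count v n)" if "a \<in> removable g" "row_count v n = g(a := g a - 1)" for v a
  proof (cases a)
    case (Suc r)
    then show ?thesis
      using that anti[of r] by (auto simp: removable_def addable_def)
  qed (simp add: addable_def)
  have "bij_betw (\<lambda>(a, v). v(Suc n := a)) ?S {w \<in> lattice_words (Suc n). row_count w (Suc n) = g}"
  proof (rule bij_betw_imageI)
    show "inj_on (\<lambda>(a, v). v(Suc n := a)) ?S"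
    proof (rule inj_onI, clarify)
      fix a v a' v'
      assume *: "a \<in> removable g" "v \<in> lattice_words n" "row_count v n = g(a := g a - 1)"
        "a' \<in> removable g" "v' \<in> lattice_words n" "row_count v' n = g(a' := g a' - 1)"
        and eq: "v(Suc n := a) = v'(Suc n := a')"
      have "(v, a) = (v', a')"
        by (rule inj_onD[OF bij_betw_imp_inj_on[OF lattice_words_Suc_bij[of n]]])
          (use * eq add in auto)
      then show "a = a' \<and> v = v'" by simp
    qed
  next
    show "(\<lambda>(a, v). v(Suc n := a)) ` ?S = {w \<in> lattice_words (Suc n). row_count w (Suc n) = g}"
    proof safe
      fix a v assume a: "a \<in> removable g" and v: "v \<in> lattice_words n" "row_count v n = g(a := g a - 1)"
      have "(v, a) \<in> (SIGMA v:lattice_words n. addable (row_count v n))"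
        using v add[OF a v(2)] by simp
      then show "v(Suc n := a) \<in> lattice_words (Suc n)"
        using bij_betwE[OF lattice_words_Suc_bij[of n]] by force
      show "row_count (v(Suc n := a)) (Suc n) = g"
        using iff[of v a] v a add[OF a v(2)] by (simp add: lattice_words_def)
    next
      fix w assume w: "w \<in> lattice_words (Suc n)" "g = row_count w (Suc n)"
      then obtain v a where "v \<in> lattice_words n" "a \<in> addable (row_count v n)" "w = v(Suc n := a)"
        using bij_betw_imp_surj_on[OF lattice_words_Suc_bij[of n]] by force
      with w(2) show "w \<in> (\<lambda>(a, v). v(Suc n := a)) `
          (SIGMA a:removable (row_count w (Suc n)). {v \<in> lattice_words n.
            row_count v n = (row_count w (Suc n))(a := row_count w (Suc n) a - 1)})"
        using iff[of v a] by (intro image_eqI[of _ _ "(a, v)"]) (auto simp: lattice_words_def)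
    qed
  qed
  then have "num_words (Suc n) g = card ?S"
    by (simp add: num_words_def bij_betw_same_card)
  also have "\<dots> = (\<Sum>a\<in>removable g. num_words n (g(a := g a - 1)))"
    unfolding num_words_def using finite_lattice_words finite_removable[OF fin]
    by (intro card_SigmaI) auto
  finally show ?thesis .
qed

lemma num_words_0: "num_words 0 f = (if f = (\<lambda>_. 0) then 1 else 0)"
proof -
  have "{w \<in> lattice_words 0. row_count w 0 = f} = (if f = (\<lambda>_. 0) then {\<lambda>_. undefined} else {})"
    by (auto simp: lattice_words_def lattice_word_def fun_eq_iff)
  then show ?thesis by (simp add: num_words_def)
qed

text \<open>
  Adding a box in row \<open>a\<close> and removing one from another row \<open>b\<close> commute; the extra \<open>G f\<close> comes from
  there being one more addable than removable row.
\<close>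

lemma sum_addable_removable_commute:
  fixes G :: "(nat \<Rightarrow> nat) \<Rightarrow> nat"
  assumes anti: "\<And>r. f (Suc r) \<le> f r" and fin: "finite {r. f r \<noteq> 0}"
  shows "(\<Sum>a\<in>addable f. \<Sum>b\<in>removable (f(a := Suc (f a))). G ((f(a := Suc (f a)))(b := (f(a := Suc (f a))) b - 1))) =
    G f + (\<Sum>b\<in>removable f. \<Sum>a\<in>addable (f(b := f b - 1)). G ((f(b := f b - 1))(a := Suc ((f(b := f b - 1)) a))))"
proof -
  let ?u = "\<lambda>a. f(a := Suc (f a))" and ?d = "\<lambda>b. f(b := f b - 1)"
  \<comment> \<open>Pairs of moves in different rows; for these the order of adding and removing
    does not matter, which is what \<open>P\<close> below states.\<close>
  let ?P = "{(a, b). a \<noteq> b \<and> a \<in> addable f \<and> b \<in> removable (?u a)}"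
  let ?G = "\<lambda>(a, b). G (f(a := Suc (f a), b := f b - 1))"
  have finr: "finite (removable f)" "finite (addable f)"
    using finite_removable[OF fin] by (simp_all add: addable_eq)
  have fin_u: "finite (removable (?u a))" for a
    by (rule finite_removable, rule finite_subset[of _ "insert a {r. f r \<noteq> 0}"]) (use fin in auto)
  have fin_d: "finite (addable (?d b))" for b
    unfolding addable_eq
    by (intro finite.insertI finite_imageI finite_removable, rule finite_subset[OF _ fin]) auto
  have P: "?P = {(a, b). a \<noteq> b \<and> b \<in> removable f \<and> a \<in> addable (?d b)}"
  proof -
    have "a \<in> addable f \<and> b \<in> removable (?u a) \<longleftrightarrow> b \<in> removable f \<and> a \<in> addable (?d b)"
      if "a \<noteq> b" for a b
    proof (cases a)
      case 0
      then show ?thesis using that by (auto simp: addable_def removable_def)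
    next
      case (Suc r)
      then show ?thesis using that anti[of r] anti[of b]
        by (cases "b = r") (auto simp: addable_def removable_def)
    qed
    then show ?thesis by auto
  qed
  \<comment> \<open>Removing the box just added returns \<open>f\<close>, once for each addable
    row.\<close>
  have "(\<Sum>a\<in>addable f. \<Sum>b\<in>removable (?u a). G ((?u a)(b := ?u a b - 1))) =
      (\<Sum>a\<in>addable f. G f + (\<Sum>b\<in>removable (?u a) - {a}. ?G (a, b)))"
  proof (rule sum.cong[OF refl])
    fix a assume "a \<in> addable f"
    then have "a \<in> removable (?u a)"
      using anti[of a] by (auto simp: removable_def)
    then show "(\<Sum>b\<in>removable (?u a). G ((?u a)(b := ?u a b - 1))) =
        G f + (\<Sum>b\<in>removable (?u a) - {a}. ?G (a, b))"
      using fin_u by (simp add: sum.remove[of _ a])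
  qed
  also have "\<dots> = card (addable f) * G f + sum ?G (SIGMA a:addable f. removable (?u a) - {a})"
    using finr fin_u by (simp add: sum.distrib sum.Sigma)
  also have "(SIGMA a:addable f. removable (?u a) - {a}) = ?P"
    by auto
  finally have up: "(\<Sum>a\<in>addable f. \<Sum>b\<in>removable (?u a). G ((?u a)(b := ?u a b - 1))) =
      card (addable f) * G f + sum ?G ?P" .
  have "(\<Sum>b\<in>removable f. \<Sum>a\<in>addable (?d b). G ((?d b)(a := Suc (?d b a)))) =
      (\<Sum>b\<in>removable f. G f + (\<Sum>a\<in>addable (?d b) - {b}. ?G (a, b)))"
  proof (rule sum.cong[OF refl])
    fix b assume b: "b \<in> removable f"
    then have "b \<in> addable (?d b)"
      using anti[of "b - 1"] by (cases b) (auto simp: removable_def addable_def)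
    moreover have "(?d b)(b := Suc (?d b b)) = f"
      using b by (auto simp: removable_def)
    moreover have "G ((?d b)(a := Suc (?d b a))) = ?G (a, b)" if "a \<noteq> b" for a
      using that by (simp add: fun_upd_twist)
    ultimately show "(\<Sum>a\<in>addable (?d b). G ((?d b)(a := Suc (?d b a)))) =
        G f + (\<Sum>a\<in>addable (?d b) - {b}. ?G (a, b))"
      using fin_d[of b] by (simp add: sum.remove[of _ b] del: fun_upd_apply)
  qed
  also have "\<dots> = card (removable f) * G f + (\<Sum>b\<in>removable f. \<Sum>a\<in>addable (?d b) - {b}. ?G (a, b))"
    by (simp add: sum.distrib)
  also have "(\<Sum>b\<in>removable f. \<Sum>a\<in>addable (?d b) - {b}. ?G (a, b)) =
      (\<Sum>x\<in>(SIGMA b:removable f. addable (?d b) - {b}). ?G (prod.swap x))"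
    using finr fin_d by (subst sum.Sigma) (auto simp: case_prod_beta)
  also have "\<dots> = sum ?G ?P"
    by (rule sum.reindex_bij_witness[of _ prod.swap prod.swap]) (auto simp: P)
  finally have down: "(\<Sum>b\<in>removable f. \<Sum>a\<in>addable (?d b). G ((?d b)(a := Suc (?d b a)))) =
      card (removable f) * G f + sum ?G ?P" .
  show ?thesis
    unfolding up down card_addable[OF finr(1)] by simp
qed

text \<open>The upward recursion in Young's lattice. Every term is expanded downward by
  \<open>num_words_Suc\<close>; exchanging the two moves leaves one copy of
  \<open>num_words n f\<close> and, by induction, \<open>n\<close> times the downward expansion of
  \<open>num_words n f\<close>.\<close>

lemma sum_num_words_addable:
  assumes "\<And>r. f (Suc r) \<le> f r" "finite {r. f r \<noteq> 0}"
  shows "(\<Sum>a\<in>addable f. num_words (Suc n) (f(a := Suc (f a)))) = Suc n * num_words n f"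
  using assms
proof (induction n arbitrary: f)
  have expand: "(\<Sum>a\<in>addable f. num_words (Suc n) (f(a := Suc (f a)))) = num_words n f +
      (\<Sum>b\<in>removable f. \<Sum>a\<in>addable (f(b := f b - 1)).
        num_words n ((f(b := f b - 1))(a := Suc ((f(b := f b - 1)) a))))"
    if anti: "\<And>r. f (Suc r) \<le> f r" and fin: "finite {r. f r \<noteq> 0}" for f n
  proof -
    have "num_words (Suc n) (f(a := Suc (f a))) = (\<Sum>b\<in>removable (f(a := Suc (f a))).
        num_words n ((f(a := Suc (f a)))(b := (f(a := Suc (f a))) b - 1)))"
      if "a \<in> addable f" for a
    proof (rule num_words_Suc)
      show "(f(a := Suc (f a))) (Suc r) \<le> (f(a := Suc (f a))) r" for r
        using that anti[of r] by (auto simp: addable_def)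
      show "finite {r. (f(a := Suc (f a))) r \<noteq> 0}"
        by (rule finite_subset[of _ "insert a {r. f r \<noteq> 0}"]) (use fin in auto)
    qed
    then show ?thesis
      using sum_addable_removable_commute[OF anti fin] by simp
  qed
  {
    case (0 f)
    have "g(a := Suc (g a)) \<noteq> (\<lambda>_. 0)" for g :: "nat \<Rightarrow> nat" and a
      by (metis fun_upd_same nat.distinct(1))
    then show ?case
      using expand[OF 0, of 0] by (simp add: num_words_0 del: fun_upd_apply)
  next
    case (Suc n f)
    have "(\<Sum>a\<in>addable (f(b := f b - 1)).
        num_words (Suc n) ((f(b := f b - 1))(a := Suc ((f(b := f b - 1)) a)))) =
        Suc n * num_words n (f(b := f b - 1))" if "b \<in> removable f" for b
    proof (rule Suc.IH)
      show "(f(b := f b - 1)) (Suc r) \<le> (f(b := f b - 1)) r" for r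
        using that Suc.prems(1)[of r] by (auto simp: removable_def)
      show "finite {r. (f(b := f b - 1)) r \<noteq> 0}"
        by (rule finite_subset[OF _ Suc.prems(2)]) auto
    qed
    then show ?case
      using expand[OF Suc.prems, of "Suc n"] num_words_Suc[OF Suc.prems, of n]
      by (simp del: fun_upd_apply add: sum.distrib sum_distrib_left[symmetric])
  }
qed

text \<open>The sum of the squared numbers of standard tableaux, phrased as a count of pairs so that
  no set of shapes has to be indexed. Appending a letter in all possible ways multiplies the sum by
  \<open>Suc n\<close>, by the upward recursion.\<close>

lemma card_lattice_word_pairs:
  "card {(w, w'). w \<in> lattice_words n \<and> w' \<in> lattice_words n \<and> row_count w n = row_count w' n} = fact n"
proof -
  have card_eq: "card {(w, w'). w \<in> lattice_words n \<and> w' \<in> lattice_words n \<and> row_count w n = row_count w' n} =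
      (\<Sum>w\<in>lattice_words n. num_words n (row_count w n))" for n
  proof -
    have "{(w, w'). w \<in> lattice_words n \<and> w' \<in> lattice_words n \<and> row_count w n = row_count w' n} =
        (SIGMA w:lattice_words n. {w' \<in> lattice_words n. row_count w' n = row_count w n})"
      by auto
    then show ?thesis
      using finite_lattice_words by (simp add: num_words_def card_SigmaI)
  qed
  have "(\<Sum>w\<in>lattice_words n. num_words n (row_count w n)) = fact n"
  proof (induction n)
    case 0
    have "lattice_words 0 = {\<lambda>_. undefined}"
      by (auto simp: lattice_words_def lattice_word_def fun_eq_iff)
    then show ?case by (simp add: num_words_0 fun_eq_iff)
  next
    case (Suc n)
    have "(\<Sum>w\<in>lattice_words (Suc n). num_words (Suc n) (row_count w (Suc n))) =
      (\<Sum>(v, a)\<in>(SIGMA v:lattice_words n. addable (row_count v n)).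
        num_words (Suc n) (row_count (v(Suc n := a)) (Suc n)))"
      by (subst sum.reindex_bij_betw[OF lattice_words_Suc_bij, symmetric]) (simp add: case_prod_beta)
    also have "\<dots> = (\<Sum>v\<in>lattice_words n. \<Sum>a\<in>addable (row_count v n).
        num_words (Suc n) (row_count (v(Suc n := a)) (Suc n)))"
      using finite_lattice_words finite_removable[OF finite_support_row_count]
      by (subst sum.Sigma) (auto simp: addable_eq)
    also have "\<dots> = (\<Sum>v\<in>lattice_words n. Suc n * num_words n (row_count v n))"
    proof (rule sum.cong[OF refl])
      fix v assume "v \<in> lattice_words n"
      then have v: "lattice_word n v" by (simp add: lattice_words_def)
      have "row_count (v(Suc n := a)) (Suc n) = (row_count v n)(a := Suc (row_count v n a))" for a
        by (auto simp: row_count_snoc)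
      then show "(\<Sum>a\<in>addable (row_count v n). num_words (Suc n) (row_count (v(Suc n := a)) (Suc n))) =
          Suc n * num_words n (row_count v n)"
        using sum_num_words_addable[of "row_count v n" n] lattice_wordD[OF v, of n]
          finite_support_row_count by simp
    qed
    finally show ?case
      using Suc.IH by (simp only: sum_distrib_left[symmetric] fact_Suc of_nat_id)
  qed
  with card_eq show ?thesis by simp
qed


section \<open>Representations from Coxeter relations\<close>

definition simple_transp :: "nat \<Rightarrow> nat \<Rightarrow> nat"
  where "simple_transp i = transpose i (Suc i)"

text \<open>The product of \<open>A k\<close>, ..., \<open>A (m - 1)\<close>. For simple
  transpositions it is the cycle sending \<open>m\<close> to \<open>k\<close> and shifting
  \<open>k\<close>, ..., \<open>m - 1\<close> up by one, a coset representative of S_(m-1) in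
  S_m.\<close>

definition chain :: "(nat \<Rightarrow> 'b \<Rightarrow> 'b) \<Rightarrow> nat \<Rightarrow> nat \<Rightarrow> 'b \<Rightarrow> 'b"
  where "chain A k m = foldr (\<lambda>i g. A i \<circ> g) [k..<m] id"

lemma chain_same [simp]: "chain A k k = id"
  by (simp add: chain_def)

lemma chain_Cons: "k < m \<Longrightarrow> chain A k m = A k \<circ> chain A (Suc k) m"
  by (simp add: chain_def upt_conv_Cons)

lemma chain_snoc: "k \<le> m \<Longrightarrow> chain A k (Suc m) = chain A k m \<circ> A m"
proof (induction "m - k" arbitrary: k)
  case 0
  then show ?case by (simp add: chain_Cons)
next
  case (Suc x)
  then have "chain A (Suc k) (Suc m) = chain A (Suc k) m \<circ> A m" by simp
  with Suc show ?case by (simp add: chain_Cons comp_assoc)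
qed

text \<open>The Coxeter presentation of S_n as equations between maps. It is instantiated by the
  simple transpositions and by the operators \<open>orth\<close>, so every manipulation of chains is
  available on both sides of the representation.\<close>

locale coxeter_relations =
  fixes A :: "nat \<Rightarrow> 'b \<Rightarrow> 'b" and n :: nat
  assumes involution: "\<lbrakk>1 \<le> i; i < n\<rbrakk> \<Longrightarrow> A i \<circ> A i = id"
    and commute: "\<lbrakk>1 \<le> i; Suc i < j; j < n\<rbrakk> \<Longrightarrow> A i \<circ> A j = A j \<circ> A i"
    and braid: "\<lbrakk>1 \<le> i; Suc i < n\<rbrakk> \<Longrightarrow> A i \<circ> A (Suc i) \<circ> A i = A (Suc i) \<circ> A i \<circ> A (Suc i)"
begin

lemma chain_commute_less:
  assumes "1 \<le> i" "Suc i < k" "k \<le> m" "m \<le> n"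
  shows "A i \<circ> chain A k m = chain A k m \<circ> A i"
  using assms(3,4)
proof (induction m rule: dec_induct)
  case (step m)
  have IH: "A i \<circ> chain A k m = chain A k m \<circ> A i"
    by (rule step.IH) (use step.prems in linarith)
  have "A i \<circ> chain A k m \<circ> A m = chain A k m \<circ> (A i \<circ> A m)"
    by (subst IH) (simp add: comp_assoc)
  also have "A i \<circ> A m = A m \<circ> A i"
    using assms step by (intro commute) auto
  finally show ?case
    unfolding chain_snoc[OF step.hyps(1)] by (simp only: comp_assoc)
qed simp

lemma chain_commute_greater:
  assumes "1 \<le> k" "k \<le> m" "m < i" "i < n"
  shows "A i \<circ> chain A k m = chain A k m \<circ> A i"
  using assms(2,3)
proof (induction m rule: dec_induct)
  case (step m)
  have IH: "A i \<circ> chain A k m = chain A k m \<circ> A i"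
    by (rule step.IH) (use step.prems in linarith)
  have "A i \<circ> chain A k m \<circ> A m = chain A k m \<circ> (A i \<circ> A m)"
    by (subst IH) (simp add: comp_assoc)
  also have "A i \<circ> A m = A m \<circ> A i"
    using assms step by (intro commute[symmetric]) auto
  finally show ?case
    unfolding chain_snoc[OF step.hyps(1)] by (simp only: comp_assoc)
qed simp

text \<open>The cycle belonging to the chain carries \<open>i\<close> and \<open>Suc i\<close> to
  \<open>Suc i\<close> and \<open>Suc (Suc i)\<close>. Inside the chain, the factors
  \<open>A i\<close> and \<open>A (Suc i)\<close> account for this through the braid relation; all
  other factors commute with the passing generator.\<close>

lemma chain_shift:
  assumes "1 \<le> k" "k \<le> i" "Suc i < m" "m \<le> n"
  shows "A (Suc i) \<circ> chain A k m = chain A k m \<circ> A i"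
proof -
  have "Suc (Suc i) \<le> m" using assms by simp
  then show ?thesis
    using assms(4)
  proof (induction m rule: dec_induct)
    case base
    have "A (Suc i) \<circ> chain A k (Suc (Suc i)) = A (Suc i) \<circ> chain A k i \<circ> A i \<circ> A (Suc i)"
      using assms by (simp add: chain_snoc comp_assoc)
    also have "\<dots> = chain A k i \<circ> (A (Suc i) \<circ> A i \<circ> A (Suc i))"
      using assms base by (subst chain_commute_greater) (simp_all add: comp_assoc)
    also have "\<dots> = chain A k i \<circ> (A i \<circ> A (Suc i) \<circ> A i)"
      using assms base by (subst braid) auto
    also have "\<dots> = chain A k (Suc (Suc i)) \<circ> A i"
      using assms by (simp add: chain_snoc comp_assoc)
    finally show ?case .
  next
    case (step m)
    have "A i \<circ> A m = A m \<circ> A i"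
      using assms step by (intro commute) auto
    have IH: "A (Suc i) \<circ> chain A k m = chain A k m \<circ> A i"
      by (rule step.IH) (use step.prems in linarith)
    have "A (Suc i) \<circ> chain A k (Suc m) = A (Suc i) \<circ> chain A k m \<circ> A m"
      using step assms by (simp add: chain_snoc comp_assoc)
    also have "\<dots> = chain A k m \<circ> (A i \<circ> A m)"
      by (subst IH) (simp add: comp_assoc)
    also have "A i \<circ> A m = A m \<circ> A i"
      by fact
    also have "chain A k m \<circ> (A m \<circ> A i) = chain A k (Suc m) \<circ> A i"
      using step assms by (simp add: chain_snoc comp_assoc)
    finally show ?case .
  qed
qed

end

section \<open>Normal forms of permutations\<close>

interpretation simple_transp: coxeter_relations simple_transp n for n
proof
  fix i j :: nat
  show "simple_transp i \<circ> simple_transp i = id"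
    by (auto simp: simple_transp_def fun_eq_iff)
  show "simple_transp i \<circ> simple_transp j = simple_transp j \<circ> simple_transp i" if "Suc i < j"
    using that by (auto simp: simple_transp_def fun_eq_iff transpose_def)
  show "simple_transp i \<circ> simple_transp (Suc i) \<circ> simple_transp i =
      simple_transp (Suc i) \<circ> simple_transp i \<circ> simple_transp (Suc i)"
    by (auto simp: simple_transp_def fun_eq_iff transpose_def)
qed

abbreviation perm_chain :: "nat \<Rightarrow> nat \<Rightarrow> nat \<Rightarrow> nat"
  where "perm_chain \<equiv> chain simple_transp"

lemma simple_transp_permutes: "1 \<le> i \<Longrightarrow> i < n \<Longrightarrow> simple_transp i permutes {1..n}"
  unfolding simple_transp_def by (intro permutes_swap_id) auto

lemma perm_chain_permutes:
  assumes "1 \<le> k" "k \<le> m"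
  shows "perm_chain k m permutes {1..m}"
  using assms(2)
proof (induction m rule: dec_induct)
  case base
  show ?case unfolding chain_same by (rule permutes_id)
next
  case (step m)
  have "perm_chain k m permutes {1..Suc m}"
    using step.IH by (rule permutes_subset) auto
  moreover have "simple_transp m permutes {1..Suc m}"
    using assms step by (intro simple_transp_permutes) auto
  ultimately show ?case
    using step by (simp only: chain_snoc permutes_compose)
qed

lemma perm_chain_last:
  assumes "1 \<le> k" "k \<le> m"
  shows "perm_chain k m m = k"
  using assms(2)
proof (induction m rule: dec_induct)
  case (step m)
  then show ?case by (simp add: chain_snoc simple_transp_def)
qed simp

lemma permutes_fixing_last:
  assumes "p permutes {1..Suc m}" "p (Suc m) = Suc m"
  shows "p permutes {1..m}"
  by (rule permutes_superset[OF assms(1)]) (use assms(2) in \<open>auto simp: le_Suc_eq\<close>)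

text \<open>Each permutation gets one fixed word: the chain carrying \<open>Suc m\<close> to its
  image, composed with the word of the remaining permutation of \<open>{1..m}\<close>. Reading
  \<open>A\<close> along that word is well defined at once; the relations enter in the proof that
  the result is multiplicative.\<close>

fun coxeter_rep :: "(nat \<Rightarrow> 'b \<Rightarrow> 'b) \<Rightarrow> nat \<Rightarrow> (nat \<Rightarrow> nat) \<Rightarrow> 'b \<Rightarrow> 'b"
  where
    "coxeter_rep A 0 \<sigma> = id"
  | "coxeter_rep A (Suc m) \<sigma> =
      chain A (\<sigma> (Suc m)) (Suc m) \<circ> coxeter_rep A m (inv_into UNIV (perm_chain (\<sigma> (Suc m)) (Suc m)) \<circ> \<sigma>)"

lemma perm_chain_factor:
  assumes "\<sigma> permutes {1..Suc m}"
  defines "\<sigma>' \<equiv> inv_into UNIV (perm_chain (\<sigma> (Suc m)) (Suc m)) \<circ> \<sigma>"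
  shows "\<sigma>' permutes {1..m}" "\<sigma> = perm_chain (\<sigma> (Suc m)) (Suc m) \<circ> \<sigma>'" "\<sigma> (Suc m) \<in> {1..Suc m}"
proof -
  show k: "\<sigma> (Suc m) \<in> {1..Suc m}"
    using permutes_in_image[OF assms(1)] by auto
  let ?c = "perm_chain (\<sigma> (Suc m)) (Suc m)"
  have c: "?c permutes {1..Suc m}" "?c (Suc m) = \<sigma> (Suc m)"
    using k perm_chain_permutes perm_chain_last by auto
  show "\<sigma>' permutes {1..m}"
  proof (rule permutes_fixing_last)
    show "\<sigma>' permutes {1..Suc m}"
      unfolding \<sigma>'_def by (intro permutes_compose permutes_inv assms(1) c(1))
    show "\<sigma>' (Suc m) = Suc m"
      unfolding \<sigma>'_def comp_def using c by (metis permutes_inverses(2))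
  qed
  show "\<sigma> = ?c \<circ> \<sigma>'"
    unfolding \<sigma>'_def using permutes_inv_o(1)[OF c(1)] by (simp flip: comp_assoc)
qed

lemma coxeter_rep_id [simp]: "coxeter_rep A m id = id"
  by (induction m) (simp_all add: chain_def)

context coxeter_relations
begin

text \<open>The effect on the leading chain depends on the position of \<open>i\<close> relative to
  \<open>k\<close>, the image of \<open>Suc m\<close>: for \<open>i = k\<close> the first factor
  cancels, for \<open>Suc i = k\<close> a factor is gained in front, for \<open>Suc i < k\<close>
  the generator commutes through, and for \<open>k < i\<close> it passes through with its index
  lowered by one.\<close>

lemma coxeter_rep_simple_transp:
  assumes "m \<le> n" "\<sigma> permutes {1..m}" "1 \<le> i" "i < m"
  shows "coxeter_rep A m (simple_transp i \<circ> \<sigma>) = A i \<circ> coxeter_rep A m \<sigma>"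
  using assms
proof (induction m arbitrary: \<sigma> i)
  case (Suc m)
  define k where "k = \<sigma> (Suc m)"
  define \<sigma>' where "\<sigma>' = inv_into UNIV (perm_chain k (Suc m)) \<circ> \<sigma>"
  note \<sigma>' = perm_chain_factor[OF Suc.prems(2), folded k_def, folded \<sigma>'_def]
  have rep: "coxeter_rep A (Suc m) \<sigma> = chain A k (Suc m) \<circ> coxeter_rep A m \<sigma>'"
    by (simp add: k_def \<sigma>'_def)
  have rep_i: "coxeter_rep A (Suc m) (simple_transp i \<circ> \<sigma>) = chain A l (Suc m) \<circ> coxeter_rep A m \<tau>"
    if "simple_transp i k = l" "simple_transp i \<circ> \<sigma> = perm_chain l (Suc m) \<circ> \<tau>" "1 \<le> l" "l \<le> Suc m" for l \<tau>
  proof -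
    have "inv_into UNIV (perm_chain l (Suc m)) \<circ> (simple_transp i \<circ> \<sigma>) = \<tau>"
      unfolding that(2) using permutes_inv_o(2)[OF perm_chain_permutes[OF that(3,4)]]
      by (simp flip: comp_assoc)
    then show ?thesis
      using that(1) by (simp add: k_def)
  qed
  consider "i = k" | "Suc i = k" | "Suc i < k" | "k < i" by linarith
  then show ?case
  proof cases
    case 1
    have "simple_transp i \<circ> \<sigma> = simple_transp i \<circ> simple_transp i \<circ> perm_chain (Suc k) (Suc m) \<circ> \<sigma>'"
      using \<sigma>'(2) Suc.prems 1 by (simp add: chain_Cons comp_assoc)
    also have "\<dots> = perm_chain (Suc k) (Suc m) \<circ> \<sigma>'"
      using simple_transp.involution[of i "Suc i"] Suc.prems by simp
    finally have "coxeter_rep A (Suc m) (simple_transp i \<circ> \<sigma>) = chain A (Suc k) (Suc m) \<circ> coxeter_rep A m \<sigma>'"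
      using Suc.prems 1 by (intro rep_i) (auto simp: simple_transp_def)
    also have "\<dots> = A i \<circ> A i \<circ> chain A (Suc k) (Suc m) \<circ> coxeter_rep A m \<sigma>'"
      using involution[of i] Suc.prems by simp
    also have "\<dots> = A i \<circ> coxeter_rep A (Suc m) \<sigma>"
      unfolding rep using Suc.prems 1 by (simp add: chain_Cons comp_assoc)
    finally show ?thesis .
  next
    case 2
    have c: "chain B i (Suc m) = B i \<circ> chain B k (Suc m)" for B :: "nat \<Rightarrow> 'c \<Rightarrow> 'c"
      using Suc.prems 2 by (simp add: chain_Cons)
    have "simple_transp i \<circ> \<sigma> = perm_chain i (Suc m) \<circ> \<sigma>'"
      unfolding c by (subst \<sigma>'(2)) (simp add: comp_assoc)
    then have "coxeter_rep A (Suc m) (simple_transp i \<circ> \<sigma>) = chain A i (Suc m) \<circ> coxeter_rep A m \<sigma>'"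
      using Suc.prems 2 by (intro rep_i) (auto simp: simple_transp_def)
    then show ?thesis
      unfolding rep c by (simp only: comp_assoc)
  next
    case 3
    have "simple_transp i \<circ> \<sigma> = simple_transp i \<circ> perm_chain k (Suc m) \<circ> \<sigma>'"
      by (subst \<sigma>'(2)) (simp add: comp_assoc)
    also have "\<dots> = perm_chain k (Suc m) \<circ> (simple_transp i \<circ> \<sigma>')"
      using Suc.prems 3 \<sigma>'(3) by (subst simple_transp.chain_commute_less[of _ _ _ "Suc m"]) (auto simp: comp_assoc)
    finally have "coxeter_rep A (Suc m) (simple_transp i \<circ> \<sigma>) =
        chain A k (Suc m) \<circ> coxeter_rep A m (simple_transp i \<circ> \<sigma>')"
      using \<sigma>'(3) 3 by (intro rep_i) (auto simp: simple_transp_def)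
    also have "\<dots> = chain A k (Suc m) \<circ> A i \<circ> coxeter_rep A m \<sigma>'"
      using Suc.prems 3 \<sigma>' by (subst Suc.IH) (auto simp: comp_assoc)
    also have "\<dots> = A i \<circ> chain A k (Suc m) \<circ> coxeter_rep A m \<sigma>'"
      using Suc.prems 3 \<sigma>'(3) by (subst chain_commute_less) auto
    finally show ?thesis
      unfolding rep by (simp only: comp_assoc)
  next
    case 4
    then obtain j where j: "i = Suc j" by (cases i) auto
    have "simple_transp i \<circ> \<sigma> = simple_transp i \<circ> perm_chain k (Suc m) \<circ> \<sigma>'"
      by (subst \<sigma>'(2)) (simp add: comp_assoc)
    also have "\<dots> = perm_chain k (Suc m) \<circ> (simple_transp j \<circ> \<sigma>')"
      unfolding j using Suc.prems 4 \<sigma>'(3) j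
      by (subst simple_transp.chain_shift[of _ _ _ "Suc m"]) (auto simp: comp_assoc)
    finally have "coxeter_rep A (Suc m) (simple_transp i \<circ> \<sigma>) =
        chain A k (Suc m) \<circ> coxeter_rep A m (simple_transp j \<circ> \<sigma>')"
      using \<sigma>'(3) 4 by (intro rep_i) (auto simp: simple_transp_def)
    also have "\<dots> = chain A k (Suc m) \<circ> A j \<circ> coxeter_rep A m \<sigma>'"
      using Suc.prems 4 \<sigma>' j by (subst Suc.IH) (auto simp: comp_assoc)
    also have "\<dots> = A i \<circ> chain A k (Suc m) \<circ> coxeter_rep A m \<sigma>'"
      unfolding j using Suc.prems 4 \<sigma>'(3) j by (subst chain_shift) auto
    finally show ?thesis
      unfolding rep by (simp only: comp_assoc)
  qed
qed simp

lemma coxeter_rep_chain: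
  assumes "\<tau> permutes {1..n}" "1 \<le> k" "k \<le> m" "m \<le> n"
  shows "coxeter_rep A n (perm_chain k m \<circ> \<tau>) = chain A k m \<circ> coxeter_rep A n \<tau>"
  using assms(3,2)
proof (induction k rule: inc_induct)
  case (step k)
  have "perm_chain (Suc k) m permutes {1..n}"
    using perm_chain_permutes[of "Suc k" m] step assms by (auto intro: permutes_subset)
  then have "perm_chain (Suc k) m \<circ> \<tau> permutes {1..n}"
    using assms(1) by (intro permutes_compose)
  then have "coxeter_rep A n (simple_transp k \<circ> (perm_chain (Suc k) m \<circ> \<tau>)) =
      A k \<circ> coxeter_rep A n (perm_chain (Suc k) m \<circ> \<tau>)"
    using step assms by (intro coxeter_rep_simple_transp) auto
  also have "coxeter_rep A n (perm_chain (Suc k) m \<circ> \<tau>) = chain A (Suc k) m \<circ> coxeter_rep A n \<tau>"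
    by (rule step.IH) simp
  finally show ?case
    unfolding chain_Cons[OF step.hyps(2)] by (simp only: comp_assoc)
qed simp

lemma coxeter_rep_mult:
  assumes "\<sigma> permutes {1..n}" "\<tau> permutes {1..n}"
  shows "coxeter_rep A n (\<sigma> \<circ> \<tau>) = coxeter_rep A n \<sigma> \<circ> coxeter_rep A n \<tau>"
proof -
  \<comment> \<open>The level \<open>m\<close> of the first factor is separated from
    \<open>n\<close>, so that its normal form can be peeled off one chain at a time.\<close>
  have "coxeter_rep A n (\<sigma> \<circ> \<tau>) = coxeter_rep A m \<sigma> \<circ> coxeter_rep A n \<tau>"
    if "m \<le> n" "\<sigma> permutes {1..m}" for m \<sigma>
    using that
  proof (induction m arbitrary: \<sigma>)
    case 0
    then have "\<sigma> = id" by simp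
    then show ?case by simp
  next
    case (Suc m)
    define k where "k = \<sigma> (Suc m)"
    define \<sigma>' where "\<sigma>' = inv_into UNIV (perm_chain k (Suc m)) \<circ> \<sigma>"
    note \<sigma>' = perm_chain_factor[OF Suc.prems(2), folded k_def, folded \<sigma>'_def]
    have "\<sigma>' permutes {1..n}"
      using \<sigma>'(1) by (rule permutes_subset) (use Suc.prems in auto)
    then have "\<sigma>' \<circ> \<tau> permutes {1..n}"
      using assms(2) by (intro permutes_compose)
    then have "coxeter_rep A n (perm_chain k (Suc m) \<circ> (\<sigma>' \<circ> \<tau>)) =
        chain A k (Suc m) \<circ> coxeter_rep A n (\<sigma>' \<circ> \<tau>)"
      using Suc.prems \<sigma>'(3) by (intro coxeter_rep_chain) auto
    also have "coxeter_rep A n (\<sigma>' \<circ> \<tau>) = coxeter_rep A m \<sigma>' \<circ> coxeter_rep A n \<tau>"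
      by (rule Suc.IH[OF _ \<sigma>'(1)]) (use Suc.prems in linarith)
    also have "perm_chain k (Suc m) \<circ> (\<sigma>' \<circ> \<tau>) = \<sigma> \<circ> \<tau>"
      by (simp only: comp_assoc[symmetric] \<sigma>'(2)[symmetric])
    finally show ?case
      by (simp only: coxeter_rep.simps k_def[symmetric] \<sigma>'_def[symmetric] comp_assoc)
  qed
  from this[OF order_refl assms(1)] show ?thesis .
qed

lemma coxeter_rep_generator:
  assumes "1 \<le> i" "i < n"
  shows "coxeter_rep A n (simple_transp i) = A i"
  using coxeter_rep_simple_transp[OF order_refl permutes_id assms] by simp

end

lemma coxeter_rep_induct:
  assumes "P id" "\<And>i f. 1 \<le> i \<Longrightarrow> i < m \<Longrightarrow> P f \<Longrightarrow> P (A i \<circ> f)" "\<sigma> permutes {1..m}"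
  shows "P (coxeter_rep A m \<sigma>)"
  using assms
proof (induction m arbitrary: \<sigma>)
  case (Suc m)
  define k where "k = \<sigma> (Suc m)"
  define \<sigma>' where "\<sigma>' = inv_into UNIV (perm_chain k (Suc m)) \<circ> \<sigma>"
  note \<sigma>' = perm_chain_factor[OF Suc.prems(3), folded k_def, folded \<sigma>'_def]
  have IH: "P (coxeter_rep A m \<sigma>')"
    using Suc \<sigma>'(1) by auto
  have chain_P: "P (chain A l (Suc m) \<circ> f)" if "P f" "l \<le> Suc m" "1 \<le> l" for f l
    using that(2,3)
  proof (induction l rule: inc_induct)
    case (step l)
    then show ?case
      using Suc.prems(2)[of l "chain A (Suc l) (Suc m) \<circ> f"] by (simp add: chain_Cons comp_assoc)
  qed (use that in simp)
  show ?case
    unfolding coxeter_rep.simps k_def[symmetric] \<sigma>'_def[symmetric]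
    by (rule chain_P) (use IH \<sigma>'(3) in auto)
qed simp


section \<open>Young's orthogonal form\<close>

lemma sum_fun_apply: "(\<Sum>i\<in>I. f i) x = (\<Sum>i\<in>I. f i x)"
  by (induction I rule: infinite_finite_induct) auto

lemma cfun_linearI:
  fixes f :: "('a \<Rightarrow> complex) \<Rightarrow> ('b \<Rightarrow> complex)"
  assumes "\<And>x y. f (x + y) = f x + f y" "\<And>k x. f (cscale k x) = cscale k (f x)"
  shows "Vector_Spaces.linear cscale cscale f"
  by unfold_locales (use assms in auto)

lemma cfun_linear_comp:
  assumes "Vector_Spaces.linear cscale cscale f" "Vector_Spaces.linear cscale cscale g"
  shows "Vector_Spaces.linear cscale cscale (f \<circ> g)"
  using assms by (rule Vector_Spaces.linear_compose[rotated])

lemma cfun_linear_add: "Vector_Spaces.linear cscale cscale f \<Longrightarrow> f (x + y) = f x + f y"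
  by (simp add: Vector_Spaces.linear_iff_module_hom module_hom.add)

lemma cfun_linear_scale: "Vector_Spaces.linear cscale cscale f \<Longrightarrow> f (cscale k x) = cscale k (f x)"
  by (simp add: Vector_Spaces.linear_iff_module_hom module_hom.scale)

lemma cfun_linear_0: "Vector_Spaces.linear cscale cscale f \<Longrightarrow> f 0 = 0"
  by (simp add: Vector_Spaces.linear_iff_module_hom module_hom.zero)

lemma cfun_linear_sum: "Vector_Spaces.linear cscale cscale f \<Longrightarrow> f (\<Sum>i\<in>I. g i) = (\<Sum>i\<in>I. f (g i))"
  by (simp add: Vector_Spaces.linear_iff_module_hom module_hom.sum)

lemma cfun_linear_diff: "Vector_Spaces.linear cscale cscale f \<Longrightarrow> f (x - y) = f x - f y"
  by (simp add: Vector_Spaces.linear_iff_module_hom module_hom.diff)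

lemma carrier_sym_group: "carrier (sym_group n) = {p. p permutes {1..n}}"
  by (simp add: sym_group_def)

lemma subspace_supported_on: "cfun.subspace (supported_on S)"
  by (auto simp: cfun.subspace_def supported_on_def cscale_def)

lemma delta_in_supported_on: "x \<in> S \<Longrightarrow> delta x \<in> supported_on S"
  by (auto simp: supported_on_def delta_def)

lemma supported_on_expand:
  assumes "finite S" "f \<in> supported_on S"
  shows "f = (\<Sum>x\<in>S. cscale (f x) (delta x))"
proof
  fix y
  have "(\<Sum>x\<in>S. cscale (f x) (delta x)) y = (\<Sum>x\<in>S. if y = x then f x else 0)"
    by (simp add: sum_fun_apply cscale_def delta_def if_distrib cong: if_cong)
  also have "\<dots> = f y"
    using assms by (auto simp: supported_on_def)
  finally show "f y = (\<Sum>x\<in>S. cscale (f x) (delta x)) y" ..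
qed

text \<open>The transpositions \<open>transpose j k\<close> are pairwise distinct, so every
  coefficient on the support is 1.\<close>

lemma jucys_murphy_act:
  "algebra_act \<rho> (jucys_murphy k) w = (\<Sum>j\<in>{1..<k}. \<rho> (transpose j k) w)"
proof -
  have inj: "inj_on (\<lambda>j. transpose j k) {1..<k}"
    by (rule inj_onI) (metis atLeastLessThan_iff less_irrefl transpose_apply_second)
  have eval: "jucys_murphy k \<sigma> = (if \<sigma> \<in> (\<lambda>j. transpose j k) ` {1..<k} then 1 else 0)" for \<sigma>
  proof -
    have "jucys_murphy k \<sigma> = (\<Sum>j\<in>{1..<k}. if \<sigma> = transpose j k then 1 else 0)"
      by (simp add: jucys_murphy_def sum_fun_apply delta_def)
    also have "\<dots> = (\<Sum>\<tau>\<in>(\<lambda>j. transpose j k) ` {1..<k}. if \<sigma> = \<tau> then 1 else 0)"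
      by (simp only: sum.reindex[OF inj] comp_def)
    also have "\<dots> = (if \<sigma> \<in> (\<lambda>j. transpose j k) ` {1..<k} then 1 else 0)"
      by (simp only: sum.delta' finite_imageI finite_atLeastLessThan)
    finally show ?thesis .
  qed
  then have "{\<sigma>. jucys_murphy k \<sigma> \<noteq> 0} = (\<lambda>j. transpose j k) ` {1..<k}"
    by (auto split: if_splits)
  then have "algebra_act \<rho> (jucys_murphy k) w =
      (\<Sum>\<tau>\<in>(\<lambda>j. transpose j k) ` {1..<k}. cscale (jucys_murphy k \<tau>) (\<rho> \<tau> w))"
    unfolding algebra_act_def by simp
  also have "\<dots> = (\<Sum>j\<in>{1..<k}. \<rho> (transpose j k) w)"
    unfolding sum.reindex[OF inj] by (intro sum.cong) (auto simp: eval)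
  finally show ?thesis .
qed

text \<open>What Young's construction needs from the tableaux of one shape, expressed through
  contents alone: the inequalities keep axial distances and their adjacent sums nonzero,
  \<open>content_inj\<close> lets tableaux be compared by contents, \<open>content_swap\<close>
  supplies the neighbours, and \<open>connected\<close> drives the proof of irreducibility.\<close>

locale content_system =
  fixes \<Omega> :: "'a set" and n :: nat and c :: "'a \<Rightarrow> nat \<Rightarrow> int"
  assumes finite: "finite \<Omega>" and nonempty: "\<Omega> \<noteq> {}"
    and content_1: "T \<in> \<Omega> \<Longrightarrow> c T 1 = 0"
    and content_Suc: "\<lbrakk>T \<in> \<Omega>; 1 \<le> i; i < n\<rbrakk> \<Longrightarrow> c T i \<noteq> c T (Suc i)"
    and content_Suc_Suc: "\<lbrakk>T \<in> \<Omega>; 1 \<le> i; Suc i < n\<rbrakk> \<Longrightarrow> c T i \<noteq> c T (Suc (Suc i))"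
    and content_inj: "\<lbrakk>T \<in> \<Omega>; T' \<in> \<Omega>; \<And>i. i \<in> {1..n} \<Longrightarrow> c T i = c T' i\<rbrakk> \<Longrightarrow> T = T'"
    and content_swap: "\<lbrakk>T \<in> \<Omega>; 1 \<le> i; i < n; \<bar>c T (Suc i) - c T i\<bar> \<noteq> 1\<rbrakk> \<Longrightarrow>
      \<exists>T'\<in>\<Omega>. \<forall>j\<in>{1..n}. c T' j = c T (simple_transp i j)"
    and connected: "\<lbrakk>T \<in> \<Omega>; T' \<in> \<Omega>; Q T; \<And>R R' i. \<lbrakk>R \<in> \<Omega>; R' \<in> \<Omega>; Q R; 1 \<le> i; i < n;
        \<bar>c R (Suc i) - c R i\<bar> \<noteq> 1; \<And>j. j \<in> {1..n} \<Longrightarrow> c R' j = c R (simple_transp i j)\<rbrakk> \<Longrightarrow> Q R'\<rbrakk> \<Longrightarrow> Q T'"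
begin

definition axial :: "nat \<Rightarrow> 'a \<Rightarrow> int"
  where "axial i T = c T (Suc i) - c T i"

definition admissible :: "nat \<Rightarrow> 'a \<Rightarrow> bool"
  where "admissible i T \<longleftrightarrow> \<bar>axial i T\<bar> \<noteq> 1"

text \<open>The value \<open>T\<close> in the inadmissible case is harmless, since there \<open>swap_coeff\<close> vanishes.\<close>

definition swap :: "nat \<Rightarrow> 'a \<Rightarrow> 'a"
  where "swap i T = (if admissible i T
    then SOME T'. T' \<in> \<Omega> \<and> (\<forall>j\<in>{1..n}. c T' j = c T (simple_transp i j)) else T)"

text \<open>For axial distance \<open>d\<close>, the orthogonal form acts on \<open>T\<close> and
  its neighbour by the symmetric matrix with diagonal \<open>1 / d\<close>, \<open>- 1 / d\<close>
  and off-diagonal entry \<open>sqrt (1 - 1 / d\<^sup>2)\<close>.\<close>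

definition diag_coeff :: "int \<Rightarrow> complex"
  where "diag_coeff d = 1 / of_int d"

definition swap_coeff :: "int \<Rightarrow> complex"
  where "swap_coeff d = of_real (sqrt (1 - 1 / (of_int d)\<^sup>2))"

text \<open>Off \<open>\<Omega>\<close> the operator is the identity, not zero, so that the Coxeter
  relations hold as equations of maps on the full function space, the form in which
  \<open>coxeter_relations\<close> states them.\<close>

definition orth :: "nat \<Rightarrow> ('a \<Rightarrow> complex) \<Rightarrow> 'a \<Rightarrow> complex"
  where "orth i F = (\<lambda>T. if T \<in> \<Omega>
    then diag_coeff (axial i T) * F T + swap_coeff (axial i T) * F (swap i T) else F T)"

lemma axial_nonzero: "T \<in> \<Omega> \<Longrightarrow> 1 \<le> i \<Longrightarrow> i < n \<Longrightarrow> axial i T \<noteq> 0"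
  using content_Suc[of T i] by (simp add: axial_def)

lemma
  assumes "T \<in> \<Omega>" "1 \<le> i" "i < n"
  shows swap_in: "swap i T \<in> \<Omega>"
    and content_swap_eq: "admissible i T \<Longrightarrow> j \<in> {1..n} \<Longrightarrow> c (swap i T) j = c T (simple_transp i j)"
proof -
  have "swap i T \<in> \<Omega> \<and> (\<forall>j\<in>{1..n}. c (swap i T) j = c T (simple_transp i j))" if "admissible i T"
  proof -
    have "\<exists>T'. T' \<in> \<Omega> \<and> (\<forall>j\<in>{1..n}. c T' j = c T (simple_transp i j))"
      using content_swap[OF assms] that by (auto simp: admissible_def axial_def)
    from someI_ex[OF this] show ?thesis
      using that by (simp add: swap_def)
  qed
  then show "swap i T \<in> \<Omega>" "admissible i T \<Longrightarrow> j \<in> {1..n} \<Longrightarrow> c (swap i T) j = c T (simple_transp i j)"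
    using assms by (auto simp: swap_def[of i T] split: if_splits)
qed

lemma axial_swap:
  assumes "T \<in> \<Omega>" "1 \<le> i" "i < n" "admissible i T"
  shows "axial i (swap i T) = - axial i T"
  using content_swap_eq[OF assms(1-4), of i] content_swap_eq[OF assms(1-4), of "Suc i"] assms
  by (simp add: axial_def simple_transp_def)

lemma admissible_swap: "T \<in> \<Omega> \<Longrightarrow> 1 \<le> i \<Longrightarrow> i < n \<Longrightarrow> admissible i T \<Longrightarrow> admissible i (swap i T)"
  using axial_swap[of T i] by (simp add: admissible_def)

lemma simple_transp_in: "1 \<le> i \<Longrightarrow> i < n \<Longrightarrow> j \<in> {1..n} \<Longrightarrow> simple_transp i j \<in> {1..n}"
  by (auto simp: simple_transp_def transpose_def)

lemma swap_swap:
  assumes "T \<in> \<Omega>" "1 \<le> i" "i < n"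
  shows "swap i (swap i T) = T"
proof (cases "admissible i T")
  case True
  have S: "swap i T \<in> \<Omega>" "admissible i (swap i T)"
    using assms True swap_in admissible_swap by auto
  show ?thesis
  proof (rule content_inj)
    fix j assume j: "j \<in> {1..n}"
    have "c (swap i (swap i T)) j = c T (simple_transp i (simple_transp i j))"
      using content_swap_eq[OF S(1) assms(2,3) S(2) j]
        content_swap_eq[OF assms True simple_transp_in[OF assms(2,3) j]] by simp
    then show "c (swap i (swap i T)) j = c T j"
      by (simp add: simple_transp_def)
  qed (use assms S swap_in in auto)
qed (simp add: swap_def)

text \<open>A nonzero integer has absolute value at least 1, so the radicand is nonnegative and the
  real square root squares back to it.\<close>

lemma swap_coeff_square: "d \<noteq> 0 \<Longrightarrow> swap_coeff d * swap_coeff d = 1 - diag_coeff d * diag_coeff d"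
proof -
  assume "d \<noteq> 0"
  then have "1 \<le> \<bar>d\<bar>" by simp
  then have "1 \<le> (real_of_int d)\<^sup>2"
    by (metis abs_ge_zero of_int_1_le_iff of_int_abs one_le_power power2_abs)
  then have "0 \<le> 1 - 1 / (real_of_int d)\<^sup>2"
    by (simp add: divide_le_eq)
  then have "sqrt (1 - 1 / (real_of_int d)\<^sup>2) * sqrt (1 - 1 / (real_of_int d)\<^sup>2) = 1 - 1 / (real_of_int d)\<^sup>2"
    by simp
  then show ?thesis
    unfolding swap_coeff_def diag_coeff_def of_real_mult[symmetric]
    by (simp add: power2_eq_square)
qed

lemma swap_coeff_minus [simp]: "swap_coeff (- d) = swap_coeff d"
  by (simp add: swap_coeff_def)

lemma diag_coeff_minus [simp]: "diag_coeff (- d) = - diag_coeff d"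
  by (simp add: diag_coeff_def)

lemma swap_coeff_inadmissible: "\<not> admissible i T \<Longrightarrow> swap_coeff (axial i T) = 0"
  by (auto simp: admissible_def swap_coeff_def power2_eq_square abs_if split: if_splits)

lemma swap_coeff_nonzero:
  assumes "T \<in> \<Omega>" "1 \<le> i" "i < n" "admissible i T"
  shows "swap_coeff (axial i T) \<noteq> 0"
proof
  assume "swap_coeff (axial i T) = 0"
  then have "(real_of_int (axial i T))\<^sup>2 = 1"
    using axial_nonzero[OF assms(1-3)] by (simp add: swap_coeff_def divide_simps)
  then have "\<bar>axial i T\<bar> = 1"
    by (auto simp: power2_eq_1_iff)
  with assms show False by (simp add: admissible_def)
qed

text \<open>Replaces case distinctions on admissibility: under a factor \<open>swap_coeff\<close>,
  the value at the swapped tableau may be rewritten as if the exchange were admissible, since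
  otherwise the factor is 0.\<close>

lemma swap_coeff_cong:
  "(admissible i T \<Longrightarrow> x = y) \<Longrightarrow> swap_coeff (axial i T) * x = swap_coeff (axial i T) * y"
  by (cases "admissible i T") (auto simp: swap_coeff_inadmissible)

lemma orth_in: "T \<in> \<Omega> \<Longrightarrow> orth i F T = diag_coeff (axial i T) * F T + swap_coeff (axial i T) * F (swap i T)"
  by (simp add: orth_def)

lemma orth_swap:
  assumes "T \<in> \<Omega>" "1 \<le> i" "i < n"
  shows "swap_coeff (axial i T) * orth i F (swap i T) = swap_coeff (axial i T) *
    (- diag_coeff (axial i T) * F (swap i T) + swap_coeff (axial i T) * F T)"
  by (rule swap_coeff_cong) (use assms in \<open>simp add: orth_in swap_in axial_swap swap_swap\<close>)

lemma orth_involution: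
  assumes "1 \<le> i" "i < n"
  shows "orth i \<circ> orth i = id"
proof (rule ext)+
  fix F T
  show "(orth i \<circ> orth i) F T = id F T"
  proof (cases "T \<in> \<Omega>")
    case True
    have "orth i (orth i F) T = diag_coeff (axial i T) * orth i F T + swap_coeff (axial i T) * orth i F (swap i T)"
      using True by (simp add: orth_in)
    also have "\<dots> = (diag_coeff (axial i T) * diag_coeff (axial i T) + swap_coeff (axial i T) * swap_coeff (axial i T)) * F T"
      unfolding orth_swap[OF True assms] using True by (simp add: orth_in algebra_simps)
    also have "\<dots> = F T"
      using swap_coeff_square[OF axial_nonzero[OF True assms]] by simp
    finally show ?thesis by simp
  qed (simp add: orth_def)
qed

lemma
  assumes "T \<in> \<Omega>" "1 \<le> i" "i < n" "1 \<le> j" "j < n" "Suc i < j \<or> Suc j < i"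
  shows axial_swap_far: "axial i (swap j T) = axial i T"
    and swap_swap_far: "swap i (swap j T) = swap j (swap i T)"
proof -
  have ax: "axial i (swap j T) = axial i T" if "T \<in> \<Omega>" "1 \<le> i" "i < n" "1 \<le> j" "j < n" "Suc i < j \<or> Suc j < i" for i j T
  proof (cases "admissible j T")
    case True
    then show ?thesis
      using content_swap_eq[OF that(1,4,5) True, of i] content_swap_eq[OF that(1,4,5) True, of "Suc i"] that
      by (auto simp: axial_def simple_transp_def transpose_def)
  qed (simp add: swap_def)
  show "axial i (swap j T) = axial i T"
    by (rule ax) fact+
  have adm: "admissible i (swap j T) = admissible i T" "admissible j (swap i T) = admissible j T"
    using ax[of T i j] ax[of T j i] assms by (auto simp: admissible_def)
  show "swap i (swap j T) = swap j (swap i T)"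
  proof (cases "admissible i T \<and> admissible j T")
    case True
    have comm: "simple_transp i (simple_transp j k) = simple_transp j (simple_transp i k)" for k
      using assms by (auto simp: simple_transp_def transpose_def)
    show ?thesis
    proof (rule content_inj)
      fix k assume k: "k \<in> {1..n}"
      have "c (swap i (swap j T)) k = c T (simple_transp j (simple_transp i k))"
        using True adm assms k simple_transp_in[OF assms(2,3) k]
        by (simp add: content_swap_eq swap_in)
      moreover have "c (swap j (swap i T)) k = c T (simple_transp i (simple_transp j k))"
        using True adm assms k simple_transp_in[OF assms(4,5) k]
        by (simp add: content_swap_eq swap_in)
      ultimately show "c (swap i (swap j T)) k = c (swap j (swap i T)) k"
        by (simp add: comm)
    qed (use assms swap_in in auto)
  next
    case False
    then show ?thesis
      using adm by (auto simp: swap_def)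
  qed
qed

lemma orth_commute:
  assumes "1 \<le> i" "Suc i < j" "j < n"
  shows "orth i \<circ> orth j = orth j \<circ> orth i"
proof (rule ext)+
  fix F T
  show "(orth i \<circ> orth j) F T = (orth j \<circ> orth i) F T"
  proof (cases "T \<in> \<Omega>")
    case True
    have "axial i (swap j T) = axial i T" "axial j (swap i T) = axial j T" "swap i (swap j T) = swap j (swap i T)"
      using assms True axial_swap_far[of T i j] axial_swap_far[of T j i] swap_swap_far[of T i j] by auto
    moreover have "swap i T \<in> \<Omega>" "swap j T \<in> \<Omega>"
      using assms True swap_in by auto
    ultimately show ?thesis
      using True by (simp add: orth_in algebra_simps)
  qed (simp add: orth_def)
qed

text \<open>Both sides at \<open>T\<close> expand into values of \<open>F\<close> at the at most six
  tableaux reached by the two exchanges, along which the axial distances are \<open>a\<close>,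
  \<open>b\<close> and \<open>a + b\<close> up to sign and order. Each value keeps the swap
  coefficients leading to its tableau as a factor, so \<open>swap_coeff_cong\<close>
  applies.\<close>

lemma orth_braid:
  assumes "1 \<le> i" "Suc i < n"
  shows "orth i \<circ> orth (Suc i) \<circ> orth i = orth (Suc i) \<circ> orth i \<circ> orth (Suc i)"
proof (rule ext)+
  fix F T
  let ?j = "Suc i"
  have ij: "1 \<le> i" "i < n" "1 \<le> ?j" "?j < n" using assms by auto
  show "(orth i \<circ> orth ?j \<circ> orth i) F T = (orth ?j \<circ> orth i \<circ> orth ?j) F T"
  proof (cases "T \<in> \<Omega>")
    case T: True
    define a b where "a = axial i T" and "b = axial ?j T"
    have iT: "swap i T \<in> \<Omega>" and jT: "swap ?j T \<in> \<Omega>"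
      using T ij swap_in by auto
    have jiT: "swap ?j (swap i T) \<in> \<Omega>" and ijT: "swap i (swap ?j T) \<in> \<Omega>"
      using iT jT ij swap_in by auto
    have ci: "c (swap i R) i = c R ?j" "c (swap i R) ?j = c R i" "c (swap i R) (Suc ?j) = c R (Suc ?j)"
      if "R \<in> \<Omega>" "admissible i R" for R
      using content_swap_eq[OF that(1) ij(1,2) that(2)] ij by (simp_all add: simple_transp_def)
    have cj: "c (swap ?j R) i = c R i" "c (swap ?j R) ?j = c R (Suc ?j)" "c (swap ?j R) (Suc ?j) = c R ?j"
      if "R \<in> \<Omega>" "admissible ?j R" for R
      using content_swap_eq[OF that(1) ij(3,4) that(2)] ij by (simp_all add: simple_transp_def)
    have ax_iT: "axial ?j (swap i T) = a + b" if "admissible i T"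
      using ci[OF T that] by (simp add: axial_def a_def b_def)
    have ax_jT: "axial i (swap ?j T) = a + b" if "admissible ?j T"
      using cj[OF T that] by (simp add: axial_def a_def b_def)
    have ax_jiT: "axial i (swap ?j (swap i T)) = b" if "admissible i T" "admissible ?j (swap i T)"
      using ci[OF T that(1)] cj[OF iT that(2)] by (simp add: axial_def b_def)
    have ax_ijT: "axial ?j (swap i (swap ?j T)) = a" if "admissible ?j T" "admissible i (swap ?j T)"
      using cj[OF T that(1)] ci[OF jT that(2)] by (simp add: axial_def a_def)
    have nz: "a \<noteq> 0" "b \<noteq> 0" "a + b \<noteq> 0"
      using content_Suc[OF T ij(1,2)] content_Suc[OF T ij(3,4)] content_Suc_Suc[OF T assms]
      by (auto simp: a_def b_def axial_def)
    let ?P = "diag_coeff a" and ?Q = "diag_coeff b" and ?S = "diag_coeff (a + b)"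
    let ?ra = "swap_coeff a" and ?rb = "swap_coeff b" and ?rs = "swap_coeff (a + b)"
    note coeff_a = swap_coeff_cong[of i T, folded a_def] and coeff_b = swap_coeff_cong[of ?j T, folded b_def]
    have Ei: "orth i G T = ?P * G T + ?ra * G (swap i T)" for G
      using T by (simp add: orth_in a_def)
    have Ej: "orth ?j G T = ?Q * G T + ?rb * G (swap ?j T)" for G
      using T by (simp add: orth_in b_def)
    have Eji: "?ra * orth ?j G (swap i T) = ?ra * (?S * G (swap i T) + ?rs * G (swap ?j (swap i T)))" for G
      by (rule coeff_a) (simp add: orth_in iT ax_iT)
    have Eij: "?rb * orth i G (swap ?j T) = ?rb * (?S * G (swap ?j T) + ?rs * G (swap i (swap ?j T)))" for G
      by (rule coeff_b) (simp add: orth_in jT ax_jT)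
    have Eii: "?ra * orth i G (swap i T) = ?ra * (- ?P * G (swap i T) + ?ra * G T)" for G
      using orth_swap[OF T ij(1,2), of G] by (simp add: a_def)
    have Ejj: "?rb * orth ?j G (swap ?j T) = ?rb * (- ?Q * G (swap ?j T) + ?rb * G T)" for G
      using orth_swap[OF T ij(3,4), of G] by (simp add: b_def)
    have Eiji: "?ra * (?rs * orth i G (swap ?j (swap i T))) =
        ?ra * (?rs * (?Q * G (swap ?j (swap i T)) + ?rb * G (swap i (swap ?j (swap i T)))))" for G
    proof (rule coeff_a)
      assume adm: "admissible i T"
      show "?rs * orth i G (swap ?j (swap i T)) =
          ?rs * (?Q * G (swap ?j (swap i T)) + ?rb * G (swap i (swap ?j (swap i T))))"
        unfolding ax_iT[OF adm, symmetric]
        by (rule swap_coeff_cong) (simp add: orth_in jiT ax_jiT adm)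
    qed
    have Ejij: "?rb * (?rs * orth ?j G (swap i (swap ?j T))) =
        ?rb * (?rs * (?P * G (swap i (swap ?j T)) + ?ra * G (swap ?j (swap i (swap ?j T)))))" for G
    proof (rule coeff_b)
      assume adm: "admissible ?j T"
      show "?rs * orth ?j G (swap i (swap ?j T)) =
          ?rs * (?P * G (swap i (swap ?j T)) + ?ra * G (swap ?j (swap i (swap ?j T))))"
        unfolding ax_jT[OF adm, symmetric]
        by (rule swap_coeff_cong) (simp add: orth_in ijT ax_ijT adm)
    qed
    \<comment> \<open>The two braid words end in the same tableau if all exchanges are admissible;
      otherwise one of the three coefficients is 0.\<close>
    have Elong: "?ra * (?rb * (?rs * F (swap i (swap ?j (swap i T))))) =
        ?ra * (?rb * (?rs * F (swap ?j (swap i (swap ?j T)))))"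
    proof (rule coeff_a, rule coeff_b)
      assume adm: "admissible i T" "admissible ?j T"
      show "?rs * F (swap i (swap ?j (swap i T))) = ?rs * F (swap ?j (swap i (swap ?j T)))"
        unfolding ax_iT[OF adm(1), symmetric]
      proof (rule swap_coeff_cong)
        assume adm_ji: "admissible ?j (swap i T)"
        then have adm_ij: "admissible i (swap ?j T)"
          using ax_iT[OF adm(1)] ax_jT[OF adm(2)] by (simp add: admissible_def)
        have adm3: "admissible i (swap ?j (swap i T))" "admissible ?j (swap i (swap ?j T))"
          using adm adm_ji adm_ij by (simp_all add: admissible_def ax_jiT ax_ijT a_def b_def)
        have "swap i (swap ?j (swap i T)) = swap ?j (swap i (swap ?j T))"
        proof (rule content_inj)
          fix k assume k: "k \<in> {1..n}"
          have "c (swap i (swap ?j (swap i T))) k = c T (simple_transp i (simple_transp ?j (simple_transp i k)))"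
            using k ij T iT jiT adm adm_ji adm3 simple_transp_in[OF ij(1,2) k]
              simple_transp_in[OF ij(3,4) simple_transp_in[OF ij(1,2) k]]
            by (simp add: content_swap_eq)
          also have "simple_transp i (simple_transp ?j (simple_transp i k)) =
              simple_transp ?j (simple_transp i (simple_transp ?j k))"
            by (auto simp: simple_transp_def transpose_def)
          also have "c T \<dots> = c (swap ?j (swap i (swap ?j T))) k"
            using k ij T jT ijT adm adm_ij adm3 simple_transp_in[OF ij(3,4) k]
              simple_transp_in[OF ij(1,2) simple_transp_in[OF ij(3,4) k]]
            by (simp add: content_swap_eq)
          finally show "c (swap i (swap ?j (swap i T))) k = c (swap ?j (swap i (swap ?j T))) k" .
        qed (use ij jiT ijT swap_in in auto)
        then show "F (swap i (swap ?j (swap i T))) = F (swap ?j (swap i (swap ?j T)))"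
          by simp
      qed
    qed
    have sq: "?ra * ?ra = 1 - ?P * ?P" "?rb * ?rb = 1 - ?Q * ?Q"
      using swap_coeff_square nz by auto
    \<comment> \<open>Partial fractions; that \<open>a + b\<close> is nonzero comes from
      \<open>content_Suc_Suc\<close>.\<close>
    have PQS: "?P * ?Q = ?S * (?P + ?Q)"
    proof -
      have "(of_int a :: complex) \<noteq> 0" "(of_int b :: complex) \<noteq> 0" "(of_int a + of_int b :: complex) \<noteq> 0"
        using nz by (simp_all flip: of_int_add)
      then show ?thesis
        by (simp add: diag_coeff_def divide_simps)
    qed
    have "orth i (orth ?j (orth i F)) T = ?P * (?Q * orth i F T + ?rb * orth i F (swap ?j T)) +
        (?S * (?ra * orth i F (swap i T)) + ?ra * (?rs * orth i F (swap ?j (swap i T))))"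
      unfolding Ei[of "orth ?j (orth i F)"] Eji Ej by (simp add: algebra_simps)
    also have "\<dots> = ?P * (?Q * (?P * F T + ?ra * F (swap i T)) +
          ?rb * (?S * F (swap ?j T) + ?rs * F (swap i (swap ?j T)))) +
        (?S * (?ra * (- ?P * F (swap i T) + ?ra * F T)) +
          ?ra * (?rs * (?Q * F (swap ?j (swap i T)) + ?rb * F (swap i (swap ?j (swap i T))))))"
      unfolding Ei Eij Eii Eiji ..
    \<comment> \<open>Here the two expansions meet: the equality is polynomial in the coefficients,
      modulo the squares \<open>sq\<close>, the relation \<open>PQS\<close> and the common endpoint
      \<open>Elong\<close>.\<close>
    also have "\<dots> = ?Q * (?P * (?Q * F T + ?rb * F (swap ?j T)) +
          ?ra * (?S * F (swap i T) + ?rs * F (swap ?j (swap i T)))) +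
        (?S * (?rb * (- ?Q * F (swap ?j T) + ?rb * F T)) +
          ?rb * (?rs * (?P * F (swap i (swap ?j T)) + ?ra * F (swap ?j (swap i (swap ?j T))))))"
      using sq PQS Elong by algebra
    also have "\<dots> = ?Q * (?P * orth ?j F T + ?ra * orth ?j F (swap i T)) +
        (?S * (?rb * orth ?j F (swap ?j T)) + ?rb * (?rs * orth ?j F (swap i (swap ?j T))))"
      unfolding Ej Eji Ejj Ejij ..
    also have "\<dots> = orth ?j (orth i (orth ?j F)) T"
      unfolding Ej[of "orth i (orth ?j F)"] Eij Ei by (simp add: algebra_simps)
    finally show ?thesis by simp
  qed (simp add: orth_def)
qed

sublocale coxeter_relations orth n
  by unfold_locales (use orth_involution orth_commute orth_braid in auto)

end

section \<open>Modules and the orthogonal representation\<close>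

lemma sn_moduleD:
  assumes "sn_module n W \<rho>"
  shows "cfun.subspace W" "\<sigma> permutes {1..n} \<Longrightarrow> Vector_Spaces.linear cscale cscale (\<rho> \<sigma>)"
    "\<sigma> permutes {1..n} \<Longrightarrow> w \<in> W \<Longrightarrow> \<rho> \<sigma> w \<in> W" "w \<in> W \<Longrightarrow> \<rho> id w = w"
    "\<sigma> permutes {1..n} \<Longrightarrow> \<tau> permutes {1..n} \<Longrightarrow> w \<in> W \<Longrightarrow> \<rho> (\<sigma> \<circ> \<tau>) w = \<rho> \<sigma> (\<rho> \<tau> w)"
  using assms by (auto simp: sn_module_def carrier_sym_group)

lemma sn_moduleI:
  assumes "cfun.subspace W" "\<And>\<sigma>. \<sigma> permutes {1..n} \<Longrightarrow> Vector_Spaces.linear cscale cscale (\<rho> \<sigma>)"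
    "\<And>\<sigma> w. \<sigma> permutes {1..n} \<Longrightarrow> w \<in> W \<Longrightarrow> \<rho> \<sigma> w \<in> W" "\<And>w. w \<in> W \<Longrightarrow> \<rho> id w = w"
    "\<And>\<sigma> \<tau> w. \<sigma> permutes {1..n} \<Longrightarrow> \<tau> permutes {1..n} \<Longrightarrow> w \<in> W \<Longrightarrow> \<rho> (\<sigma> \<circ> \<tau>) w = \<rho> \<sigma> (\<rho> \<tau> w)"
  shows "sn_module n W \<rho>"
  using assms by (auto simp: sn_module_def carrier_sym_group)

lemma jucys_murphy_act_closed:
  assumes "sn_module n W \<rho>" "w \<in> W" "k \<le> n"
  shows "algebra_act \<rho> (jucys_murphy k) w \<in> W"
  unfolding jucys_murphy_act
proof (rule cfun.subspace_sum[OF sn_moduleD(1)[OF assms(1)]])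
  fix j assume "j \<in> {1..<k}"
  then have "transpose j k permutes {1..n}"
    using assms(3) by (intro permutes_swap_id) auto
  then show "\<rho> (transpose j k) w \<in> W"
    using sn_moduleD(3)[OF assms(1)] assms(2) by blast
qed

context content_system
begin

abbreviation rep :: "(nat \<Rightarrow> nat) \<Rightarrow> ('a \<Rightarrow> complex) \<Rightarrow> 'a \<Rightarrow> complex"
  where "rep \<equiv> coxeter_rep orth n"

lemma linear_orth: "Vector_Spaces.linear cscale cscale (orth i)"
  by (rule cfun_linearI) (auto simp: orth_def cscale_def fun_eq_iff algebra_simps)

lemma linear_rep: "\<sigma> permutes {1..n} \<Longrightarrow> Vector_Spaces.linear cscale cscale (rep \<sigma>)"
proof (rule coxeter_rep_induct[where P = "Vector_Spaces.linear cscale cscale"])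
  show "Vector_Spaces.linear cscale cscale (id :: ('a \<Rightarrow> complex) \<Rightarrow> _)"
    by (rule cfun_linearI) auto
qed (auto intro: cfun_linear_comp linear_orth)

lemma rep_supported_on: "\<sigma> permutes {1..n} \<Longrightarrow> w \<in> supported_on \<Omega> \<Longrightarrow> rep \<sigma> w \<in> supported_on \<Omega>"
proof -
  assume "\<sigma> permutes {1..n}"
  then have "\<forall>w\<in>supported_on \<Omega>. rep \<sigma> w \<in> supported_on \<Omega>"
    by (rule coxeter_rep_induct[where P = "\<lambda>f. \<forall>w\<in>supported_on \<Omega>. f w \<in> supported_on \<Omega>", rotated 2])
      (auto simp: supported_on_def orth_def)
  then show "w \<in> supported_on \<Omega> \<Longrightarrow> rep \<sigma> w \<in> supported_on \<Omega>" ..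
qed

lemma sn_module_rep: "sn_module n (supported_on \<Omega>) rep"
  by (rule sn_moduleI) (use linear_rep rep_supported_on coxeter_rep_mult subspace_supported_on in auto)

lemma transpose_Suc:
  "1 \<le> j \<Longrightarrow> j < k \<Longrightarrow> transpose j (Suc k) = simple_transp k \<circ> (transpose j k \<circ> simple_transp k)"
  by (auto simp: simple_transp_def fun_eq_iff transpose_def)

text \<open>Induction along X_(k+1) = s_k X_k s_k + s_k, which \<open>transpose_Suc\<close> gives
  summand by summand. On \<open>T\<close> and its neighbour X_k is diagonal with entries
  \<open>c T k\<close> and \<open>c T (Suc k)\<close>; as their difference times
  \<open>diag_coeff\<close> of the axial distance is 1, the conjugate plus s_k is diagonal
  again.\<close>

lemma rep_jucys_murphy:
  assumes "T \<in> \<Omega>" "1 \<le> k" "k \<le> n"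
  shows "algebra_act rep (jucys_murphy k) F T = of_int (c T k) * F T"
  using assms(2,3,1) unfolding jucys_murphy_act
proof (induction k arbitrary: F T rule: dec_induct)
  case base
  then show ?case using content_1[of T] by simp
next
  case (step k)
  have k: "1 \<le> k" "k < n" using step by auto
  let ?G = "\<lambda>T. \<Sum>j\<in>{1..<k}. rep (transpose j k) (orth k F) T"
  have rep_j: "rep (transpose j (Suc k)) F = orth k (rep (transpose j k) (orth k F))" if "j \<in> {1..<k}" for j
  proof -
    have perm: "simple_transp k permutes {1..n}" "transpose j k permutes {1..n}"
      by (rule simple_transp_permutes[OF k], rule permutes_swap_id) (use that k in auto)
    have "transpose j (Suc k) = simple_transp k \<circ> (transpose j k \<circ> simple_transp k)"
      using that by (intro transpose_Suc) auto
    then have "rep (transpose j (Suc k)) = rep (simple_transp k) \<circ> (rep (transpose j k) \<circ> rep (simple_transp k))"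
      using perm by (simp only: coxeter_rep_mult permutes_compose)
    then show ?thesis
      using coxeter_rep_generator[OF k] by (simp only: comp_apply)
  qed
  have T: "T \<in> \<Omega>" and sT: "swap k T \<in> \<Omega>" using step k swap_in by auto
  have IH: "?G R = of_int (c R k) * orth k F R" if "R \<in> \<Omega>" for R
    using step.IH[of R "orth k F"] that k by (simp add: sum_fun_apply)
  let ?a = "axial k T"
  have "{1..<Suc k} = insert k {1..<k}" using k by auto
  then have "(\<Sum>j\<in>{1..<Suc k}. rep (transpose j (Suc k)) F) T =
      rep (transpose k (Suc k)) F T + (\<Sum>j\<in>{1..<k}. rep (transpose j (Suc k)) F T)"
    by (simp add: sum_fun_apply)
  also have "rep (transpose k (Suc k)) F = orth k F"
    using coxeter_rep_generator[OF k] by (simp add: simple_transp_def)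
  also have "(\<Sum>j\<in>{1..<k}. rep (transpose j (Suc k)) F T) =
      (\<Sum>j\<in>{1..<k}. orth k (rep (transpose j k) (orth k F)) T)"
    by (intro sum.cong) (auto simp: rep_j)
  also have "\<dots> = diag_coeff ?a * ?G T + swap_coeff ?a * ?G (swap k T)"
    using T by (simp add: orth_in sum.distrib sum_distrib_left)
  \<comment> \<open>If the exchange is admissible, the neighbour has content
    \<open>c T (Suc k)\<close> at \<open>k\<close>; otherwise the coefficient vanishes.\<close>
  also have "swap_coeff ?a * ?G (swap k T) = swap_coeff ?a * (of_int (c T (Suc k)) * orth k F (swap k T))"
    by (rule swap_coeff_cong)
      (use IH[OF sT] content_swap_eq[OF T k, of k] k in \<open>simp add: simple_transp_def\<close>)
  also have "\<dots> = of_int (c T (Suc k)) * (swap_coeff ?a * orth k F (swap k T))"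
    by simp
  also have "\<dots> = of_int (c T (Suc k)) * (swap_coeff ?a * (- diag_coeff ?a * F (swap k T) + swap_coeff ?a * F T))"
    using orth_swap[OF T k, of F] by simp
  also have "?G T = of_int (c T k) * orth k F T"
    by (rule IH[OF T])
  also have "orth k F T = diag_coeff ?a * F T + swap_coeff ?a * F (swap k T)"
    using T by (simp add: orth_in)
  finally have eq: "(\<Sum>j\<in>{1..<Suc k}. rep (transpose j (Suc k)) F) T =
      diag_coeff ?a * F T + swap_coeff ?a * F (swap k T) +
      (diag_coeff ?a * (of_int (c T k) * (diag_coeff ?a * F T + swap_coeff ?a * F (swap k T))) +
        of_int (c T (Suc k)) * (swap_coeff ?a * (- diag_coeff ?a * F (swap k T) + swap_coeff ?a * F T)))" .
  have sq: "swap_coeff ?a * swap_coeff ?a = 1 - diag_coeff ?a * diag_coeff ?a"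
    using swap_coeff_square[OF axial_nonzero[OF T k]] .
  have "of_int ?a * diag_coeff ?a = 1"
    using axial_nonzero[OF T k] by (simp add: diag_coeff_def)
  then have d: "(of_int (c T (Suc k)) - of_int (c T k)) * diag_coeff ?a = 1"
    by (simp add: axial_def)
  show ?case
    unfolding eq using sq d by algebra
qed

lemma rep_jucys_murphy_delta:
  assumes "T \<in> \<Omega>" "i \<in> {1..n}"
  shows "algebra_act rep (jucys_murphy i) (delta T) = cscale (of_int (c T i)) (delta T)"
proof
  fix R
  show "algebra_act rep (jucys_murphy i) (delta T) R = cscale (of_int (c T i)) (delta T) R"
  proof (cases "R \<in> \<Omega>")
    case True
    then show ?thesis
      using assms rep_jucys_murphy[of R i "delta T"] by (auto simp: cscale_def delta_def)
  next
    case False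
    have "algebra_act rep (jucys_murphy i) (delta T) \<in> supported_on \<Omega>"
      by (rule jucys_murphy_act_closed[OF sn_module_rep]) (use assms in \<open>auto intro: delta_in_supported_on\<close>)
    with False assms show ?thesis
      by (auto simp: supported_on_def cscale_def delta_def)
  qed
qed

text \<open>Take a nonzero vector of the submodule with smallest support. If two tableaux lay in its
  support, some Jucys-Murphy element would separate them, and subtracting a scalar from that element
  would kill one coordinate but not the other.\<close>

lemma submodule_contains_delta:
  assumes U: "sn_module n U rep" "U \<subseteq> supported_on \<Omega>" "U \<noteq> {0}"
  obtains T where "T \<in> \<Omega>" "delta T \<in> U"
proof -
  note sub = sn_moduleD(1)[OF U(1)]
  let ?supp = "\<lambda>u. {T. u T \<noteq> 0}"
  have supp: "?supp u \<subseteq> \<Omega>" if "u \<in> U" for u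
    using that U(2) by (auto simp: supported_on_def)
  have "0 \<in> U" using cfun.subspace_0[OF sub] .
  then obtain u0 where "u0 \<in> U" "u0 \<noteq> 0"
    using U(3) by auto
  then obtain u where u: "u \<in> U" "u \<noteq> 0"
    and min: "\<And>v. v \<in> U \<and> v \<noteq> 0 \<Longrightarrow> card (?supp u) \<le> card (?supp v)"
    using ex_has_least_nat[of "\<lambda>u. u \<in> U \<and> u \<noteq> 0" u0 "\<lambda>u. card (?supp u)"] by auto
  obtain T where T: "u T \<noteq> 0"
    using u(2) by (auto simp: fun_eq_iff)
  then have T\<Omega>: "T \<in> \<Omega>" using supp[OF u(1)] by auto
  have zero: "u R = 0" if "R \<noteq> T" for R
  proof (rule ccontr)
    assume R: "u R \<noteq> 0"
    then have R\<Omega>: "R \<in> \<Omega>" using supp[OF u(1)] by auto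
    then obtain i where i: "i \<in> {1..n}" "c T i \<noteq> c R i"
      using content_inj[OF T\<Omega> R\<Omega>] \<open>R \<noteq> T\<close> by blast
    define v where "v = algebra_act rep (jucys_murphy i) u - cscale (of_int (c R i)) u"
    have v: "v S = of_int (c S i - c R i) * u S" if "S \<in> \<Omega>" for S
      using rep_jucys_murphy[OF that, of i u] i by (simp add: v_def cscale_def algebra_simps)
    have vU: "v \<in> U"
      unfolding v_def
      by (intro cfun.subspace_diff[OF sub] cfun.subspace_scale[OF sub] jucys_murphy_act_closed[OF U(1)] u(1))
        (use i in auto)
    moreover have "v T \<noteq> 0"
      using v[OF T\<Omega>] T i by simp
    ultimately have "card (?supp u) \<le> card (?supp v)"
      by (intro min) auto
    moreover have "?supp v \<subset> ?supp u"
    proof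
      show "?supp v \<subseteq> ?supp u"
        using supp[OF vU] v by auto
      show "?supp v \<noteq> ?supp u"
        using v[OF R\<Omega>] R by auto
    qed
    ultimately show False
      using psubset_card_mono[of "?supp u" "?supp v"] finite_subset[OF supp[OF u(1)] finite] by simp
  qed
  have "cscale (1 / u T) u = delta T"
    using T zero by (auto simp: cscale_def delta_def fun_eq_iff)
  with cfun.subspace_scale[OF sub u(1), of "1 / u T"] T\<Omega> that show thesis
    by simp
qed

text \<open>A nonzero submodule contains one basis vector; an admissible exchange has a nonzero
  off-diagonal coefficient and hence yields the neighbouring one; \<open>connected\<close> then
  yields all.\<close>

lemma irreducible_rep: "irreducible_module n (supported_on \<Omega>) rep"
  unfolding irreducible_module_def
proof (intro conjI allI impI)
  show "sn_module n (supported_on \<Omega>) rep" by (rule sn_module_rep)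
  obtain T where "T \<in> \<Omega>" using nonempty by auto
  then have "delta T \<in> supported_on \<Omega>"
    by (rule delta_in_supported_on)
  moreover have "delta T \<noteq> 0"
    by (auto simp: delta_def fun_eq_iff)
  ultimately show "supported_on \<Omega> \<noteq> {0}" by (metis singletonD)
  fix U assume "U \<subseteq> supported_on \<Omega> \<and> sn_module n U rep"
  then have U: "sn_module n U rep" "U \<subseteq> supported_on \<Omega>" by auto
  note sub = sn_moduleD(1)[OF U(1)]
  show "U = {0} \<or> U = supported_on \<Omega>"
  proof (cases "U = {0}")
    case False
    obtain T where T: "T \<in> \<Omega>" "delta T \<in> U"
      using submodule_contains_delta[OF U False] .
    have all: "delta T' \<in> U" if "T' \<in> \<Omega>" for T'
    proof (rule connected[where Q = "\<lambda>T. delta T \<in> U", OF T(1) that T(2)])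
      fix R R' i
      assume R: "R \<in> \<Omega>" "R' \<in> \<Omega>" "delta R \<in> U" and i: "1 \<le> i" "i < n"
        and adm: "\<bar>c R (Suc i) - c R i\<bar> \<noteq> 1"
        and R': "\<And>j. j \<in> {1..n} \<Longrightarrow> c R' j = c R (simple_transp i j)"
      have adm: "admissible i R" using adm by (simp add: admissible_def axial_def)
      have sw: "swap i R = R'"
        by (rule content_inj) (use R' R i adm swap_in content_swap_eq in auto)
      define r where "r = swap_coeff (axial i R)"
      have r: "r \<noteq> 0"
        unfolding r_def by (rule swap_coeff_nonzero[OF R(1) i adm])
      have r': "swap_coeff (axial i R') = r"
        unfolding r_def sw[symmetric] axial_swap[OF R(1) i adm] by simp
      have iff: "swap i S = R \<longleftrightarrow> S = R'" if "S \<in> \<Omega>" for S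
        using swap_swap[OF that i] swap_swap[OF R(1) i] sw by metis
      have "R \<noteq> R'"
        using sw axial_swap[OF R(1) i adm] axial_nonzero[OF R(1) i] by auto
      \<comment> \<open>Coordinate \<open>R'\<close> of the image is computed with the coefficient
        at \<open>R'\<close>, whose axial distance is the negative of that at \<open>R\<close>; the
        coefficient is even, hence again \<open>r\<close>.\<close>
      have "orth i (delta R) = cscale (diag_coeff (axial i R)) (delta R) + cscale r (delta R')"
      proof
        fix S
        show "orth i (delta R) S = (cscale (diag_coeff (axial i R)) (delta R) + cscale r (delta R')) S"
        proof (cases "S \<in> \<Omega>")
          case True
          then show ?thesis
            using \<open>R \<noteq> R'\<close> r' by (auto simp: orth_in cscale_def delta_def iff)
        next
          case False
          with R show ?thesis
            by (auto simp: orth_def cscale_def delta_def)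
        qed
      qed
      then have eq: "delta R' = cscale (1 / r) (orth i (delta R) - cscale (diag_coeff (axial i R)) (delta R))"
        using r by (simp add: cscale_def fun_eq_iff)
      have "rep (simple_transp i) (delta R) \<in> U"
        by (rule sn_moduleD(3)[OF U(1) simple_transp_permutes[OF i] R(3)])
      then have "orth i (delta R) \<in> U"
        unfolding coxeter_rep_generator[OF i] .
      then show "delta R' \<in> U"
        unfolding eq by (intro cfun.subspace_scale[OF sub] cfun.subspace_diff[OF sub] R(3))
    qed
    have "f \<in> U" if "f \<in> supported_on \<Omega>" for f
      by (subst supported_on_expand[OF finite that])
        (intro cfun.subspace_sum[OF sub] cfun.subspace_scale[OF sub] all)
    with U(2) show ?thesis by auto
  qed simp
qed

end


section \<open>Tableaux and words\<close>

definition num_rows :: "nat \<Rightarrow> (nat \<Rightarrow> nat) \<Rightarrow> nat"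
  where "num_rows n w = (LEAST r. row_count w n r = 0)"

definition word_row :: "nat \<Rightarrow> (nat \<Rightarrow> nat) \<Rightarrow> nat \<Rightarrow> nat list"
  where "word_row n w r = filter (\<lambda>i. w i = r) [1..<Suc n]"

definition word_tableau :: "nat \<Rightarrow> (nat \<Rightarrow> nat) \<Rightarrow> tableau"
  where "word_tableau n w = map (word_row n w) [0..<num_rows n w]"

definition tableau_word :: "tableau \<Rightarrow> nat \<Rightarrow> nat"
  where "tableau_word T i = (THE r. r < length T \<and> i \<in> set (T ! r))"

lemma less_num_rows:
  assumes "lattice_word n w"
  shows "r < num_rows n w \<longleftrightarrow> row_count w n r \<noteq> 0"
proof
  show "r < num_rows n w \<Longrightarrow> row_count w n r \<noteq> 0"
    unfolding num_rows_def by (rule not_less_Least)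
  have "row_count w n (num_rows n w) = 0"
    unfolding num_rows_def by (rule LeastI[of _ n]) (rule row_count_bound[OF assms order_refl])
  then show "row_count w n r \<noteq> 0 \<Longrightarrow> r < num_rows n w"
    using lattice_word_antimono[OF assms order_refl, of "num_rows n w" r] by (cases "r < num_rows n w") auto
qed

lemma set_word_row: "set (word_row n w r) = {i \<in> {1..n}. w i = r}"
  by (auto simp: word_row_def)

lemma distinct_word_row: "distinct (word_row n w r)"
  by (simp add: word_row_def)

lemma length_word_row: "length (word_row n w r) = row_count w n r"
  using distinct_card[OF distinct_word_row, of n w r] by (simp add: set_word_row row_count_def)

lemma sorted_word_row: "sorted_wrt (<) (word_row n w r)"
  by (simp add: word_row_def sorted_wrt_filter del: upt_Suc)

lemma word_row_append: "k \<le> n \<Longrightarrow> word_row n w r = word_row k w r @ filter (\<lambda>i. w i = r) [Suc k..<Suc n]"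
  unfolding word_row_def filter_append[symmetric]
  using upt_add_eq_append[of 1 "Suc k" "n - k"] by simp

lemma word_row_cong: "(\<And>i. i \<in> {1..n} \<Longrightarrow> w i = w' i) \<Longrightarrow> word_row n w r = word_row n w' r"
  unfolding word_row_def by (rule filter_cong) auto

lemma word_tableau_cong:
  assumes "\<And>i. i \<in> {1..n} \<Longrightarrow> w i = w' i"
  shows "word_tableau n w = word_tableau n w'"
proof -
  have "word_row n w = word_row n w'" "row_count w n = row_count w' n"
    using word_row_cong[of n w w'] row_count_cong[of n w w'] assms by auto
  then show ?thesis by (simp add: word_tableau_def num_rows_def)
qed

lemma length_word_tableau: "length (word_tableau n w) = num_rows n w"
  by (simp add: word_tableau_def)

lemma nth_word_tableau: "r < num_rows n w \<Longrightarrow> word_tableau n w ! r = word_row n w r"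
  by (simp add: word_tableau_def)

text \<open>Rows of \<open>word_tableau\<close> are increasing, so the entries left of
  \<open>i\<close> are the earlier letters with value \<open>w i\<close>.\<close>

lemma nth_word_row:
  assumes "i \<in> {1..n}"
  shows "row_count w (i - 1) (w i) < row_count w n (w i)"
    and "word_row n w (w i) ! row_count w (i - 1) (w i) = i"
proof -
  obtain m where m: "i = Suc m" "m < n" using assms by (cases i) auto
  have "word_row n w (w i) = word_row m w (w i) @ i # filter (\<lambda>j. w j = w i) [Suc i..<Suc n]"
    using m by (simp add: word_row_append[of m n] upt_conv_Cons del: upt_Suc)
  then show "row_count w (i - 1) (w i) < row_count w n (w i)"
    "word_row n w (w i) ! row_count w (i - 1) (w i) = i"
    using length_word_row[of n w "w i"] length_word_row[of m w "w i"] m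
    by (simp_all add: nth_append)
qed

lemma word_row_index:
  assumes "c < row_count w n r" "word_row n w r ! c = i"
  shows "i \<in> {1..n}" "w i = r" "c = row_count w (i - 1) (w i)"
proof -
  have "i \<in> set (word_row n w r)"
    using assms by (metis length_word_row nth_mem)
  then show i: "i \<in> {1..n}" "w i = r" by (simp_all add: set_word_row)
  show "c = row_count w (i - 1) (w i)"
    using nth_word_row[OF i(1), of w] assms i
      nth_eq_iff_index_eq[OF distinct_word_row[of n w r], of c "row_count w (i - 1) (w i)"]
    by (simp add: length_word_row)
qed

lemma content_box_of_word_tableau:
  assumes w: "lattice_word n w" and i: "i \<in> {1..n}"
  shows "content (box_of (word_tableau n w) i) = word_content w i"
proof -
  note nth = nth_word_row[OF i, of w]
  have "w i < num_rows n w"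
    using nth(1) less_num_rows[OF w] by auto
  then have "box_of (word_tableau n w) i = (w i, row_count w (i - 1) (w i))"
    unfolding box_of_def length_word_tableau
  proof (intro the_equality)
    assume "w i < num_rows n w"
    then show "case (w i, row_count w (i - 1) (w i)) of (r, c) \<Rightarrow>
        r < num_rows n w \<and> c < length (word_tableau n w ! r) \<and> word_tableau n w ! r ! c = i"
      using nth by (simp add: nth_word_tableau length_word_row)
  next
    fix x
    assume "case x of (r, c) \<Rightarrow>
        r < num_rows n w \<and> c < length (word_tableau n w ! r) \<and> word_tableau n w ! r ! c = i"
    then obtain r c where "x = (r, c)" "c < row_count w n r" "word_row n w r ! c = i"
      by (cases x) (auto simp: nth_word_tableau length_word_row)
    then show "x = (w i, row_count w (i - 1) (w i))"
      using word_row_index[of c w n r i] by simp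
  qed
  then show ?thesis
    by (simp add: content_def word_content_def)
qed

lemma standard_word_tableau:
  assumes w: "lattice_word n w"
  shows "standard_tableau n (word_tableau n w)"
proof -
  let ?T = "word_tableau n w"
  note lt = less_num_rows[OF w]
  have shape: "tableau_shape ?T = map (row_count w n) [0..<num_rows n w]"
    by (simp add: tableau_shape_def word_tableau_def length_word_row)
  have "sorted_wrt (\<ge>) (tableau_shape ?T)"
    unfolding shape sorted_wrt_iff_nth_less
    using lattice_word_antimono[OF w order_refl] by auto
  moreover have "0 \<notin> set (tableau_shape ?T)"
    unfolding shape by (auto simp: lt)
  moreover have "distinct (concat ?T)"
  proof -
    have inj: "inj_on (word_row n w) {0..<num_rows n w}"
    proof (rule inj_onI)
      fix r s assume rs: "r \<in> {0..<num_rows n w}" "word_row n w r = word_row n w s"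
      then have "set (word_row n w r) \<noteq> {}"
        using lt[of r] length_word_row[of n w r] by (metis atLeastLessThan_iff list.size(3) set_empty)
      then obtain i where "i \<in> set (word_row n w r)"
        by (meson ex_in_conv)
      moreover from this have "i \<in> set (word_row n w s)"
        by (simp only: rs(2))
      ultimately show "r = s" by (simp add: set_word_row)
    qed
    have "distinct ?T"
      unfolding word_tableau_def distinct_map using inj by simp
    then show ?thesis
      by (intro distinct_concat) (auto simp: word_tableau_def distinct_word_row set_word_row)
  qed
  moreover have "set (concat ?T) = {1..n}"
  proof -
    have "w i < num_rows n w" if "i \<in> {1..n}" for i
      using nth_word_row(1)[OF that, of w] lt by auto
    then show ?thesis
      by (auto simp: word_tableau_def set_word_row)
  qed
  moreover have "\<forall>row\<in>set ?T. sorted_wrt (<) row"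
    by (auto simp: word_tableau_def sorted_word_row)
  moreover have "?T ! r ! c < ?T ! Suc r ! c" if "Suc r < length ?T" "c < length (?T ! Suc r)" for r c
  proof -
    define x where "x = word_row n w (Suc r) ! c"
    have r: "Suc r < num_rows n w" "c < row_count w n (Suc r)"
      using that by (simp_all add: length_word_tableau nth_word_tableau length_word_row)
    note x = word_row_index[OF r(2) x_def[symmetric]]
    obtain y where y: "x = Suc y" "y < n" using x(1) by (cases x) auto
    \<comment> \<open>When \<open>x\<close> is placed, row \<open>Suc r\<close> reaches length
      \<open>c + 1\<close>; row \<open>r\<close> is then at least as long, so its entry in column
      \<open>c\<close> is already present and smaller than \<open>x\<close>.\<close>
    have "row_count w x (Suc r) \<le> row_count w x r"
      by (rule lattice_wordD[OF w]) (use x in auto)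
    then have "c < row_count w y r"
      using x y by (simp add: row_count_Suc)
    then have "word_row n w r ! c = word_row y w r ! c" "word_row y w r ! c \<in> set (word_row y w r)"
      using y by (auto simp: word_row_append[of y n] nth_append length_word_row)
    then have "word_row n w r ! c < x"
      using y by (auto simp: set_word_row)
    then show ?thesis
      using r by (simp add: nth_word_tableau x_def)
  qed
  ultimately show ?thesis
    unfolding standard_tableau_def is_partition_def by blast
qed

lemma standard_tableau_word:
  assumes T: "standard_tableau n T"
  shows "lattice_word n (tableau_word T)" "word_tableau n (tableau_word T) = T"
proof -
  let ?w = "tableau_word T"
  have part: "sorted_wrt (\<ge>) (map length T)" "[] \<notin> set T"
    and dist: "distinct (concat T)" and set: "set (concat T) = {1..n}"
    and rows: "\<And>row. row \<in> set T \<Longrightarrow> sorted_wrt (<) row"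
    and cols: "\<And>r c. Suc r < length T \<Longrightarrow> c < length (T ! Suc r) \<Longrightarrow> T ! r ! c < T ! Suc r ! c"
    using T by (auto simp: standard_tableau_def is_partition_def tableau_shape_def)
  have uniq: "r = s" if "r < length T" "s < length T" "i \<in> set (T ! r)" "i \<in> set (T ! s)" for r s i
  proof -
    have "distinct T"
      using dist part(2) by (simp add: distinct_concat_iff)
    moreover have "T ! r = T ! s"
      using dist that unfolding distinct_concat_iff by (metis disjoint_iff nth_mem)
    ultimately show ?thesis
      using that by (simp add: nth_eq_iff_index_eq)
  qed
  have w: "?w i = r" if "r < length T" "i \<in> set (T ! r)" for i r
    unfolding tableau_word_def by (rule the_equality) (use that uniq in auto)
  have in_row: "?w i < length T \<and> i \<in> set (T ! ?w i)" if i: "i \<in> {1..n}" for i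
  proof -
    obtain r where "r < length T" "i \<in> set (T ! r)"
      using i set by (metis UN_E in_set_conv_nth set_concat)
    with w show ?thesis by auto
  qed
  have row: "T ! r = word_row n ?w r" if r: "r < length T" for r
  proof (rule strict_sorted_equal)
    show "sorted_wrt (<) (T ! r)" "sorted_wrt (<) (word_row n ?w r)"
      using rows r by (auto simp: sorted_word_row)
    show "set (T ! r) = set (word_row n ?w r)"
    proof -
      have "set (T ! r) \<subseteq> {1..n}" using r set by (auto simp: set_concat)
      then show ?thesis
        using w[OF r] in_row by (auto simp: set_word_row)
    qed
  qed
  have outside: "row_count ?w k r = 0" if "length T \<le> r" "k \<le> n" for r k
    using in_row that by (fastforce simp: row_count_eq_0)
  have inside: "row_count ?w n r \<noteq> 0" if "r < length T" for r
    using row[OF that] length_word_row[of n ?w r] part(2) that by (metis length_0_conv nth_mem)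
  show lattice: "lattice_word n ?w"
    unfolding lattice_word_def
  proof (intro allI impI)
    fix k r assume k: "k \<le> n"
    show "row_count ?w k (Suc r) \<le> row_count ?w k r"
    proof (rule ccontr)
      assume less: "\<not> row_count ?w k (Suc r) \<le> row_count ?w k r"
      then have r: "Suc r < length T"
        using outside[of "Suc r" k] k by (cases "Suc r < length T") auto
      \<comment> \<open>Column \<open>m\<close> gives the contradiction: its entry in row
        \<open>Suc r\<close> is at most \<open>k\<close>, while row \<open>r\<close> has at most
        \<open>m\<close> entries up to \<open>k\<close>, so its entry there exceeds
        \<open>k\<close>.\<close>
      obtain m where m: "row_count ?w k (Suc r) = Suc m" "row_count ?w k r \<le> m"
        using less by (cases "row_count ?w k (Suc r)") auto
      have rk: "word_row n ?w s = word_row k ?w s @ filter (\<lambda>i. ?w i = s) [Suc k..<Suc n]" for s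
        by (rule word_row_append[OF k])
      have "m < length (word_row k ?w (Suc r))"
        using m by (simp add: length_word_row)
      then have x: "T ! Suc r ! m \<in> set (word_row k ?w (Suc r))" and len: "m < length (T ! Suc r)"
        unfolding row[OF r] rk by (auto simp: nth_append)
      have "length (T ! Suc r) \<le> length (T ! r)"
        using part(1) r by (auto simp: sorted_wrt_iff_nth_less)
      with len have len': "m < length (word_row n ?w r)"
        using row[of r] r by simp
      have "word_row n ?w r ! m \<in> set (filter (\<lambda>i. ?w i = r) [Suc k..<Suc n])"
        using len' m(2) unfolding rk nth_append length_word_row
        by (auto simp: length_word_row simp del: upt_Suc set_filter intro!: nth_mem)
      moreover have "T ! r ! m < T ! Suc r ! m"
        using cols[OF r len] .
      ultimately show False
        using x row[of r] r by (auto simp: set_word_row)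
    qed
  qed
  have "num_rows n ?w = length T"
  proof (rule antisym)
    show "num_rows n ?w \<le> length T"
      using less_num_rows[OF lattice, of "length T"] outside[of "length T" n] by simp
    show "length T \<le> num_rows n ?w"
      using less_num_rows[OF lattice, of "num_rows n ?w"] inside[of "num_rows n ?w"] by fastforce
  qed
  then show "word_tableau n ?w = T"
    by (intro nth_equalityI) (simp_all add: length_word_tableau nth_word_tableau row)
qed

lemma word_tableau_inj:
  assumes "lattice_word n w" "lattice_word n w'" "word_tableau n w = word_tableau n w'"
  shows "\<forall>i\<in>{1..n}. w i = w' i"
proof
  fix i assume i: "i \<in> {1..n}"
  have "w i < num_rows n w"
    using nth_word_row(1)[OF i, of w] less_num_rows[OF assms(1)] by auto
  moreover have "num_rows n w = num_rows n w'"
    using arg_cong[OF assms(3), of length] by (simp add: length_word_tableau)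
  ultimately have "word_row n w (w i) = word_row n w' (w i)"
    using arg_cong[OF assms(3), of "\<lambda>T. T ! w i"] by (simp add: nth_word_tableau)
  then have "i \<in> set (word_row n w' (w i))"
    using i by (metis (mono_tags, lifting) mem_Collect_eq set_word_row)
  then show "w i = w' i"
    by (simp add: set_word_row)
qed

lemma subtableau_word_tableau:
  assumes "lattice_word n w" "k \<le> n"
  shows "subtableau (word_tableau n w) k = word_tableau k w"
proof -
  have k: "lattice_word k w" using assms by (rule lattice_word_mono)
  have "filter (\<lambda>i. i \<le> k) (word_row n w r) = word_row k w r" for r
    unfolding word_row_append[OF assms(2)]
    by (auto simp: filter_id_conv set_word_row filter_empty_conv simp del: upt_Suc)
  then have "subtableau (word_tableau n w) k = filter (\<lambda>row. row \<noteq> []) (map (word_row k w) [0..<num_rows n w])"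
    by (simp add: subtableau_def word_tableau_def comp_def)
  \<comment> \<open>The rows from \<open>num_rows k w\<close> on have no entry up to
    \<open>k\<close>; the filter in \<open>subtableau\<close> removes exactly these.\<close>
  also have "[0..<num_rows n w] = [0..<num_rows k w] @ [num_rows k w..<num_rows n w]"
  proof -
    have "num_rows k w \<le> num_rows n w"
    proof (rule ccontr)
      assume "\<not> num_rows k w \<le> num_rows n w"
      then have "num_rows n w < num_rows k w"
        by simp
      then have "row_count w k (num_rows n w) \<noteq> 0"
        unfolding less_num_rows[OF k] .
      then have "row_count w n (num_rows n w) \<noteq> 0"
        using assms(2) by (auto simp: row_count_eq_0)
      then show False
        using less_num_rows[OF assms(1), of "num_rows n w"] by simp
    qed
    then show ?thesis
      using upt_add_eq_append[of 0 "num_rows k w" "num_rows n w - num_rows k w"] by simp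
  qed
  also have "filter (\<lambda>row. row \<noteq> []) (map (word_row k w) \<dots>) = map (word_row k w) [0..<num_rows k w]"
  proof -
    have "word_row k w r \<noteq> [] \<longleftrightarrow> r < num_rows k w" for r
      unfolding less_num_rows[OF k] length_word_row[symmetric] by simp
    then show ?thesis
      by (simp add: filter_map comp_def filter_empty_conv)
  qed
  finally show ?thesis
    by (simp add: word_tableau_def)
qed

section \<open>Shapes and contents of standard tableaux\<close>

lemma tableau_shape_word_tableau_eq_iff:
  assumes "lattice_word n w" "lattice_word n w'"
  shows "tableau_shape (word_tableau n w) = tableau_shape (word_tableau n w') \<longleftrightarrow>
    row_count w n = row_count w' n"
proof
  have shape: "tableau_shape (word_tableau n w) = map (row_count w n) [0..<num_rows n w]" for w
    by (simp add: tableau_shape_def word_tableau_def length_word_row)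
  show "row_count w n = row_count w' n \<Longrightarrow> tableau_shape (word_tableau n w) = tableau_shape (word_tableau n w')"
    by (simp add: shape num_rows_def)
  assume eq: "tableau_shape (word_tableau n w) = tableau_shape (word_tableau n w')"
  have num: "num_rows n w = num_rows n w'"
    using arg_cong[OF eq, of length] by (simp add: shape)
  show "row_count w n = row_count w' n"
  proof
    fix r
    show "row_count w n r = row_count w' n r"
    proof (cases "r < num_rows n w")
      case True
      then show ?thesis
        using arg_cong[OF eq, of "\<lambda>xs. xs ! r"] num by (simp add: shape)
    next
      case False
      then show ?thesis
        using less_num_rows[OF assms(1), of r] less_num_rows[OF assms(2), of r] num by simp
    qed
  qed
qed

lemma length_concat_standard: "standard_tableau n T \<Longrightarrow> length (concat T) = n"
  using distinct_card[of "concat T"] by (simp add: standard_tableau_def del: set_concat)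

lemma sum_list_tableau_shape: "standard_tableau n T \<Longrightarrow> sum_list (tableau_shape T) = n"
  using length_concat_standard[of n T] by (simp add: length_concat tableau_shape_def)

lemma bij_word_tableau: "bij_betw (word_tableau n) (lattice_words n) (standard_tableaux n)"
proof (rule bij_betw_imageI)
  show "inj_on (word_tableau n) (lattice_words n)"
  proof (rule inj_onI)
    fix w w' assume "w \<in> lattice_words n" "w' \<in> lattice_words n" "word_tableau n w = word_tableau n w'"
    then show "w = w'"
      using word_tableau_inj[of n w w'] unfolding lattice_words_def by (blast intro: PiE_ext)
  qed
  show "word_tableau n ` lattice_words n = standard_tableaux n"
  proof
    show "word_tableau n ` lattice_words n \<subseteq> standard_tableaux n"
      by (auto simp: standard_tableaux_def lattice_words_def standard_word_tableau)
    show "standard_tableaux n \<subseteq> word_tableau n ` lattice_words n"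
    proof
      fix T assume "T \<in> standard_tableaux n"
      then have T: "standard_tableau n T" by (simp add: standard_tableaux_def)
      let ?v = "restrict (tableau_word T) {1..n}"
      have "lattice_word n ?v"
        using standard_tableau_word(1)[OF T] lattice_word_cong[of n ?v "tableau_word T"] by simp
      moreover have "word_tableau n ?v = T"
        using standard_tableau_word(2)[OF T] word_tableau_cong[of n ?v "tableau_word T"] by simp
      ultimately show "T \<in> word_tableau n ` lattice_words n"
        by (intro image_eqI[of _ _ ?v]) (auto simp: lattice_words_def)
    qed
  qed
qed

lemma finite_standard_tableaux: "finite (standard_tableaux n)"
  using bij_betw_finite[OF bij_word_tableau] finite_lattice_words by blast

lemma subtableau_standard:
  assumes "standard_tableau n T" "k \<le> n"
  shows "standard_tableau k (subtableau T k)"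
    and "i \<in> {1..k} \<Longrightarrow> content (box_of (subtableau T k) i) = content (box_of T i)"
proof -
  let ?w = "tableau_word T"
  note w = standard_tableau_word[OF assms(1)]
  have k: "lattice_word k ?w" using w(1) assms(2) by (rule lattice_word_mono)
  have sub: "subtableau T k = word_tableau k ?w"
    using subtableau_word_tableau[OF w(1) assms(2)] unfolding w(2) .
  show "standard_tableau k (subtableau T k)"
    unfolding sub by (rule standard_word_tableau[OF k])
  show "i \<in> {1..k} \<Longrightarrow> content (box_of (subtableau T k) i) = content (box_of T i)"
    using content_box_of_word_tableau[OF w(1), of i] content_box_of_word_tableau[OF k, of i] assms(2)
    unfolding sub w(2) by auto
qed

lemma content_inj_standard:
  assumes "standard_tableau n T" "standard_tableau n T'"
    and "\<And>i. i \<in> {1..n} \<Longrightarrow> content (box_of T i) = content (box_of T' i)"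
  shows "T = T'"
proof -
  note w = standard_tableau_word[OF assms(1)] and w' = standard_tableau_word[OF assms(2)]
  have "word_content (tableau_word T) i = word_content (tableau_word T') i" if "i \<in> {1..n}" for i
    using assms(3)[OF that] content_box_of_word_tableau[OF w(1) that] content_box_of_word_tableau[OF w'(1) that]
    unfolding w(2) w'(2) by metis
  then have "\<forall>i\<in>{1..n}. tableau_word T i = tableau_word T' i"
    by (rule word_content_inj[OF w(1) w'(1)])
  then have "word_tableau n (tableau_word T) = word_tableau n (tableau_word T')"
    by (intro word_tableau_cong) auto
  then show ?thesis
    unfolding w(2) w'(2) .
qed

lemma card_standard_pairs:
  "card {(S, T). S \<in> standard_tableaux n \<and> T \<in> standard_tableaux n \<and> tableau_shape S = tableau_shape T} = fact n"
proof -
  let ?A = "{(w, w'). w \<in> lattice_words n \<and> w' \<in> lattice_words n \<and> row_count w n = row_count w' n}"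
  let ?B = "{(S, T). S \<in> standard_tableaux n \<and> T \<in> standard_tableaux n \<and> tableau_shape S = tableau_shape T}"
  note inj = bij_betw_imp_inj_on[OF bij_word_tableau[of n]]
    and img = bij_betw_imp_surj_on[OF bij_word_tableau[of n], symmetric]
  have "bij_betw (map_prod (word_tableau n) (word_tableau n)) ?A ?B"
  proof (rule bij_betw_imageI)
    show "inj_on (map_prod (word_tableau n) (word_tableau n)) ?A"
      by (rule inj_on_subset[OF map_prod_inj_on[OF inj inj]]) auto
    show "map_prod (word_tableau n) (word_tableau n) ` ?A = ?B"
    proof
      show "map_prod (word_tableau n) (word_tableau n) ` ?A \<subseteq> ?B"
        unfolding img using tableau_shape_word_tableau_eq_iff[of n]
        by (auto simp: lattice_words_def)
      show "?B \<subseteq> map_prod (word_tableau n) (word_tableau n) ` ?A"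
      proof clarify
        fix S T assume ST: "S \<in> standard_tableaux n" "T \<in> standard_tableaux n"
          "tableau_shape S = tableau_shape T"
        then obtain v w where vw: "v \<in> lattice_words n" "w \<in> lattice_words n"
            "S = word_tableau n v" "T = word_tableau n w"
          unfolding img by auto
        then have "(v, w) \<in> ?A"
          using ST(3) tableau_shape_word_tableau_eq_iff[of n v w] by (simp add: lattice_words_def)
        then show "(S, T) \<in> map_prod (word_tableau n) (word_tableau n) ` ?A"
          unfolding vw by (rule rev_image_eqI) simp
      qed
    qed
  qed
  then show ?thesis
    unfolding card_lattice_word_pairs[of n, symmetric] by (rule bij_betw_same_card[symmetric])
qed

section \<open>Existence of Young's modules\<close>

lemma standard_tableaux_of_shape_eq:
  assumes "standard_tableau n T"
  shows "standard_tableaux_of_shape (tableau_shape T) =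
    {S. standard_tableau n S \<and> tableau_shape S = tableau_shape T}"
  using sum_list_tableau_shape[OF assms] by (simp add: standard_tableaux_of_shape_def standard_tableaux_def)

lemma same_shape_iff_word:
  assumes "standard_tableau n S" "standard_tableau n T"
  shows "tableau_shape S = tableau_shape T \<longleftrightarrow> row_count (tableau_word S) n = row_count (tableau_word T) n"
proof -
  note S = standard_tableau_word[OF assms(1)] and T = standard_tableau_word[OF assms(2)]
  show ?thesis
    using tableau_shape_word_tableau_eq_iff[OF S(1) T(1)] unfolding S(2) T(2) .
qed

lemma content_eq_word_content:
  assumes "standard_tableau n T" "i \<in> {1..n}"
  shows "content (box_of T i) = word_content (tableau_word T) i"
  using content_box_of_word_tableau[OF standard_tableau_word(1)[OF assms(1)] assms(2)]
  unfolding standard_tableau_word(2)[OF assms(1)] .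

lemma content_system_standard:
  assumes T0: "standard_tableau n T0" and n: "1 \<le> n"
  shows "content_system (standard_tableaux_of_shape (tableau_shape T0)) n (\<lambda>T i. content (box_of T i))"
proof
  let ?\<Omega> = "standard_tableaux_of_shape (tableau_shape T0)"
  note \<Omega> = standard_tableaux_of_shape_eq[OF T0]
  let ?c = "\<lambda>T i. content (box_of T i)"
  have std: "standard_tableau n T" if "T \<in> ?\<Omega>" for T
    using that by (simp add: \<Omega>)
  have lat: "lattice_word n (tableau_word T)" if "T \<in> ?\<Omega>" for T
    using standard_tableau_word(1)[OF std[OF that]] .
  have c: "?c T i = word_content (tableau_word T) i" if "T \<in> ?\<Omega>" "i \<in> {1..n}" for T i
    using content_eq_word_content[OF std[OF that(1)] that(2)] .
  show "finite ?\<Omega>"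
    by (rule finite_subset[OF _ finite_standard_tableaux[of n]]) (auto simp: \<Omega> standard_tableaux_def)
  show "?\<Omega> \<noteq> {}"
    using T0 by (auto simp: \<Omega>)
  show "?c T 1 = 0" if "T \<in> ?\<Omega>" for T
    using c[OF that, of 1] word_content_1[OF lat[OF that] n] n by simp
  show "?c T i \<noteq> ?c T (Suc i)" if "T \<in> ?\<Omega>" "1 \<le> i" "i < n" for T i
    using word_content_Suc_neq[OF lat[OF that(1)] that(2,3)] c[OF that(1)] that by simp
  show "?c T i \<noteq> ?c T (Suc (Suc i))" if "T \<in> ?\<Omega>" "1 \<le> i" "Suc i < n" for T i
    using word_content_Suc_Suc_neq[OF lat[OF that(1)] that(2,3)] c[OF that(1)] that by simp
  show "T = T'" if "T \<in> ?\<Omega>" "T' \<in> ?\<Omega>" "\<And>i. i \<in> {1..n} \<Longrightarrow> ?c T i = ?c T' i" for T T'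
    by (rule content_inj_standard[OF std[OF that(1)] std[OF that(2)] that(3)])
  have member: "word_tableau n v \<in> ?\<Omega>"
    if "lattice_word n v" "row_count v n = row_count (tableau_word T0) n" for v
    using that tableau_shape_word_tableau_eq_iff[OF that(1) standard_tableau_word(1)[OF T0]]
    unfolding standard_tableau_word(2)[OF T0] by (simp add: \<Omega> standard_word_tableau)
  have rc: "row_count (tableau_word T) n = row_count (tableau_word T0) n" if "T \<in> ?\<Omega>" for T
    using same_shape_iff_word[OF std[OF that] T0] that by (simp add: \<Omega>)
  have swap_rc: "row_count (v \<circ> transpose i (Suc i)) n = row_count v n" if "1 \<le> i" "i < n" for v i
    by (rule ext) (use row_count_swap[OF that(1)] that in auto)
  have swap_content: "word_content (v \<circ> transpose i (Suc i)) j = word_content v (simple_transp i j)"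
    if "1 \<le> i" "i < n" "\<bar>word_content v (Suc i) - word_content v i\<bar> \<noteq> 1" "j \<in> {1..n}" for v i j
    unfolding simple_transp_def
    by (rule word_content_swap[OF that(1) row_neq_of_content[OF that(1,3)]]) (use that in auto)
  have transp_in: "simple_transp i j \<in> {1..n}" if "1 \<le> i" "i < n" "j \<in> {1..n}" for i j
    using that by (auto simp: simple_transp_def transpose_def)
  show "\<exists>T'\<in>?\<Omega>. \<forall>j\<in>{1..n}. ?c T' j = ?c T (simple_transp i j)"
    if T: "T \<in> ?\<Omega>" and i: "1 \<le> i" "i < n" and adm: "\<bar>?c T (Suc i) - ?c T i\<bar> \<noteq> 1" for T i
  proof
    let ?w = "tableau_word T" and ?v = "tableau_word T \<circ> transpose i (Suc i)"
    have d: "\<bar>word_content ?w (Suc i) - word_content ?w i\<bar> \<noteq> 1"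
      using adm c[OF T] i by simp
    have v: "lattice_word n ?v"
      by (rule lattice_word_swap[OF lat[OF T] i d])
    show "word_tableau n ?v \<in> ?\<Omega>"
      by (rule member[OF v]) (use swap_rc[OF i] rc[OF T] in simp)
    show "\<forall>j\<in>{1..n}. ?c (word_tableau n ?v) j = ?c T (simple_transp i j)"
    proof
      fix j assume j: "j \<in> {1..n}"
      show "?c (word_tableau n ?v) j = ?c T (simple_transp i j)"
        unfolding content_box_of_word_tableau[OF v j] swap_content[OF i d j]
        using c[OF T transp_in[OF i j]] by simp
    qed
  qed
  show "Q T'" if T: "T \<in> ?\<Omega>" "T' \<in> ?\<Omega>" "Q T"
    and step: "\<And>R R' i. \<lbrakk>R \<in> ?\<Omega>; R' \<in> ?\<Omega>; Q R; 1 \<le> i; i < n; \<bar>?c R (Suc i) - ?c R i\<bar> \<noteq> 1;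
      \<And>j. j \<in> {1..n} \<Longrightarrow> ?c R' j = ?c R (simple_transp i j)\<rbrakk> \<Longrightarrow> Q R'" for T T' Q
  proof -
    \<comment> \<open>\<open>P\<close> records the shape as well, so that the words along the path
      give tableaux in \<open>?\<Omega>\<close>.\<close>
    define P where "P v \<longleftrightarrow> row_count v n = row_count (tableau_word T0) n \<and> Q (word_tableau n v)" for v
    have "P (tableau_word T')"
    proof (rule lattice_word_connected[where Q = P, OF lat[OF T(1)] lat[OF T(2)]])
      show "row_count (tableau_word T) n = row_count (tableau_word T') n"
        using rc[OF T(1)] rc[OF T(2)] by simp
      show "P (tableau_word T)"
        unfolding P_def standard_tableau_word(2)[OF std[OF T(1)]] using rc[OF T(1)] T(3) by simp
    next
      fix v i
      assume v: "lattice_word n v" "P v" and i: "1 \<le> i" "i < n"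
        and d: "\<bar>word_content v (Suc i) - word_content v i\<bar> \<noteq> 1"
      let ?v = "v \<circ> transpose i (Suc i)"
      have v': "lattice_word n ?v"
        by (rule lattice_word_swap[OF v(1) i d])
      have rv: "row_count v n = row_count (tableau_word T0) n" "Q (word_tableau n v)"
        using v(2) by (simp_all add: P_def)
      have rv': "row_count ?v n = row_count (tableau_word T0) n"
        unfolding swap_rc[OF i] by (rule rv)
      have "Q (word_tableau n ?v)"
      proof (rule step[OF member[OF v(1) rv(1)] member[OF v' rv'] rv(2) i])
        show "\<bar>?c (word_tableau n v) (Suc i) - ?c (word_tableau n v) i\<bar> \<noteq> 1"
          using content_box_of_word_tableau[OF v(1)] i d by simp
        show "?c (word_tableau n ?v) j = ?c (word_tableau n v) (simple_transp i j)" if j: "j \<in> {1..n}" for j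
          unfolding content_box_of_word_tableau[OF v' j] swap_content[OF i d j]
            content_box_of_word_tableau[OF v(1) transp_in[OF i j]] ..
      qed
      with rv' show "P ?v" by (simp add: P_def)
    next
      fix v v' assume "P v" and eq: "\<And>i. i \<in> {1..n} \<Longrightarrow> v i = v' i"
      moreover have "row_count v n = row_count v' n"
        by (rule ext, rule row_count_cong) (rule eq)
      moreover have "word_tableau n v = word_tableau n v'"
        by (rule word_tableau_cong) (rule eq)
      ultimately show "P v'" by (simp add: P_def)
    qed
    then show "Q T'"
      unfolding P_def standard_tableau_word(2)[OF std[OF T(2)]] by simp
  qed
qed

text \<open>\<open>specht_action\<close> is a Hilbert choice, and the orthogonal form is the witness
  that makes it meaningful. From here on the proof works from the specification
  \<open>is_specht_action\<close>, whatever action was chosen.\<close>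

lemma is_specht_action_specht_action:
  assumes "standard_tableau n T" "1 \<le> n"
  shows "is_specht_action (tableau_shape T) (specht_action (tableau_shape T))"
proof -
  interpret content_system "standard_tableaux_of_shape (tableau_shape T)" n "\<lambda>T i. content (box_of T i)"
    by (rule content_system_standard[OF assms])
  have "is_specht_action (tableau_shape T) rep"
    unfolding is_specht_action_def sum_list_tableau_shape[OF assms(1)] specht_space_def
    using irreducible_rep rep_jucys_murphy_delta by blast
  then show ?thesis
    unfolding specht_action_def by (rule someI[of "is_specht_action (tableau_shape T)"])
qed

lemma sum_word_content:
  assumes "\<And>i. i \<in> {1..n} \<Longrightarrow> w i < N"
  shows "(\<Sum>i\<in>{1..n}. word_content w i) = (\<Sum>r<N. \<Sum>c<row_count w n r. int c - int r)"
  using assms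
proof (induction n)
  case (Suc n)
  let ?g = "\<lambda>r. \<Sum>c<row_count w n r. int c - int r"
  let ?a = "w (Suc n)"
  have a: "?a < N" using Suc.prems by simp
  have "(\<Sum>r<N. \<Sum>c<row_count w (Suc n) r. int c - int r) =
      (\<Sum>r<N. ?g r + (if ?a = r then int (row_count w n ?a) - int ?a else 0))"
    by (rule sum.cong) (auto simp: row_count_Suc)
  also have "\<dots> = (\<Sum>r<N. ?g r) + (int (row_count w n ?a) - int ?a)"
    using a by (simp add: sum.distrib)
  finally show ?case
    using Suc by (simp add: word_content_def)
qed simp

text \<open>Grouped by boxes, the sum of contents refers only to the row lengths.\<close>

lemma sum_content_shape:
  assumes "standard_tableau n S" "standard_tableau n T" "tableau_shape S = tableau_shape T"
  shows "(\<Sum>i\<in>{1..n}. content (box_of S i)) = (\<Sum>i\<in>{1..n}. content (box_of T i))"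
proof -
  have *: "(\<Sum>i\<in>{1..n}. content (box_of S i)) =
      (\<Sum>r<n. \<Sum>c<row_count (tableau_word S) n r. int c - int r)" if "standard_tableau n S" for S
  proof -
    have "(\<Sum>i\<in>{1..n}. content (box_of S i)) = (\<Sum>i\<in>{1..n}. word_content (tableau_word S) i)"
      using content_eq_word_content[OF that] by (rule sum.cong[OF refl])
    also have "\<dots> = (\<Sum>r<n. \<Sum>c<row_count (tableau_word S) n r. int c - int r)"
      using lattice_word_less[OF standard_tableau_word(1)[OF that]] by (rule sum_word_content)
    finally show ?thesis .
  qed
  show ?thesis
    unfolding *[OF assms(1)] *[OF assms(2)] using same_shape_iff_word[OF assms(1,2)] assms(3) by simp
qed


section \<open>Joint eigenspaces of right multiplication\<close>

text \<open>Right multiplication of \<open>f\<close> by the Jucys-Murphy element: a transposition is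
  its own inverse, so the convolution evaluates \<open>f\<close> at
  \<open>\<pi> \<circ> transpose j i\<close>.\<close>

definition right_jm :: "nat \<Rightarrow> ((nat \<Rightarrow> nat) \<Rightarrow> complex) \<Rightarrow> (nat \<Rightarrow> nat) \<Rightarrow> complex"
  where "right_jm i f = (\<lambda>\<pi>. \<Sum>j\<in>{1..<i}. f (\<pi> \<circ> transpose j i))"

definition content_space :: "nat \<Rightarrow> (nat \<Rightarrow> int) \<Rightarrow> ((nat \<Rightarrow> nat) \<Rightarrow> complex) set"
  where "content_space n c =
    {f \<in> group_algebra n. \<forall>i\<in>{1..n}. \<forall>\<pi>. right_jm i f \<pi> = of_int (c i) * f \<pi>}"

lemma group_algebra_iff: "f \<in> group_algebra n \<longleftrightarrow> (\<forall>\<pi>. \<not> \<pi> permutes {1..n} \<longrightarrow> f \<pi> = 0)"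
  by (simp add: group_algebra_def supported_on_def carrier_sym_group)

lemma subspace_group_algebra: "cfun.subspace (group_algebra n)"
  by (simp add: group_algebra_def subspace_supported_on)

lemma right_jm_add: "right_jm i (f + g) \<pi> = right_jm i f \<pi> + right_jm i g \<pi>"
  by (simp add: right_jm_def sum.distrib)

lemma right_jm_cscale: "right_jm i (cscale k f) \<pi> = k * right_jm i f \<pi>"
  by (simp add: right_jm_def cscale_def sum_distrib_left)

lemma right_jm_translate: "right_jm i (translate \<sigma> f) = translate \<sigma> (right_jm i f)"
  by (simp add: right_jm_def translate_def comp_assoc)

lemma subspace_content_space: "cfun.subspace (content_space n c)"
proof (rule cfun.subspaceI)
  show "0 \<in> content_space n c"
    by (simp add: content_space_def group_algebra_iff right_jm_def)
  show "f + g \<in> content_space n c" if "f \<in> content_space n c" "g \<in> content_space n c" for f g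
    using that by (simp add: content_space_def group_algebra_iff right_jm_add distrib_left)
  show "cscale k f \<in> content_space n c" if "f \<in> content_space n c" for k f
    using that by (simp add: content_space_def group_algebra_iff right_jm_cscale)
      (simp add: cscale_def)
qed

lemma content_space_cong:
  "(\<And>i. i \<in> {1..n} \<Longrightarrow> c i = c' i) \<Longrightarrow> content_space n c = content_space n c'"
  by (auto simp: content_space_def)

lemma permutes_comp_transpose_iff:
  assumes "j \<in> {1..n}" "i \<in> {1..n}"
  shows "\<pi> \<circ> transpose j i permutes {1..n} \<longleftrightarrow> \<pi> permutes {1..n}"
proof
  have t: "transpose j i permutes {1..n}"
    by (rule permutes_swap_id[OF assms])
  show "\<pi> permutes {1..n} \<Longrightarrow> \<pi> \<circ> transpose j i permutes {1..n}"
    by (rule permutes_compose[OF t])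
  assume "\<pi> \<circ> transpose j i permutes {1..n}"
  then have "\<pi> \<circ> transpose j i \<circ> transpose j i permutes {1..n}"
    by (rule permutes_compose[OF t])
  then show "\<pi> permutes {1..n}"
    by (simp add: comp_assoc)
qed

lemma linear_translate: "Vector_Spaces.linear cscale cscale (translate \<sigma>)"
  by (rule cfun_linearI) (simp_all add: translate_def cscale_def fun_eq_iff)

lemma translate_comp:
  assumes "\<sigma> permutes A" "\<tau> permutes A"
  shows "translate (\<sigma> \<circ> \<tau>) f = translate \<sigma> (translate \<tau> f)"
  using o_inv_distrib[OF permutes_bij[OF assms(1)] permutes_bij[OF assms(2)]]
  by (simp add: translate_def comp_assoc)

lemma translate_group_algebra:
  assumes "\<sigma> permutes {1..n}" "f \<in> group_algebra n"
  shows "translate \<sigma> f \<in> group_algebra n"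
  unfolding group_algebra_iff
proof (intro allI impI)
  fix \<pi> assume \<pi>: "\<not> \<pi> permutes {1..n}"
  have "\<not> inv_into UNIV \<sigma> \<circ> \<pi> permutes {1..n}"
  proof
    assume "inv_into UNIV \<sigma> \<circ> \<pi> permutes {1..n}"
    then have "\<sigma> \<circ> (inv_into UNIV \<sigma> \<circ> \<pi>) permutes {1..n}"
      by (rule permutes_compose[OF _ assms(1)])
    then show False
      using \<pi> permutes_inv_o(1)[OF assms(1)] by (simp flip: comp_assoc)
  qed
  then show "translate \<sigma> f \<pi> = 0"
    using assms(2) by (simp add: group_algebra_iff translate_def)
qed

lemma sn_module_translateI:
  assumes "cfun.subspace U" "\<And>\<sigma> f. \<sigma> permutes {1..n} \<Longrightarrow> f \<in> U \<Longrightarrow> translate \<sigma> f \<in> U"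
  shows "sn_module n U translate"
  by (rule sn_moduleI) (use assms linear_translate translate_comp in \<open>auto simp: translate_def\<close>)

text \<open>Reindexing by \<open>\<pi> \<circ> transpose j i\<close> moves the transposition from
  \<open>f\<close> to \<open>g\<close>, because it is an involution.\<close>

lemma right_jm_selfadjoint:
  assumes "i \<in> {1..n}"
  shows "(\<Sum>\<pi> | \<pi> permutes {1..n}. right_jm i f \<pi> * cnj (g \<pi>)) =
    (\<Sum>\<pi> | \<pi> permutes {1..n}. f \<pi> * cnj (right_jm i g \<pi>))"
proof -
  have t: "transpose j i permutes {1..n}" if "j \<in> {1..<i}" for j
    using that assms by (intro permutes_swap_id) auto
  have "(\<Sum>\<pi> | \<pi> permutes {1..n}. right_jm i f \<pi> * cnj (g \<pi>)) =
      (\<Sum>j\<in>{1..<i}. \<Sum>\<pi> | \<pi> permutes {1..n}. f (\<pi> \<circ> transpose j i) * cnj (g \<pi>))"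
    unfolding right_jm_def sum_distrib_right by (rule sum.swap)
  also have "\<dots> = (\<Sum>j\<in>{1..<i}. \<Sum>\<pi> | \<pi> permutes {1..n}. f \<pi> * cnj (g (\<pi> \<circ> transpose j i)))"
  proof (rule sum.cong[OF refl])
    fix j assume "j \<in> {1..<i}"
    then have "transpose j i permutes {1..n}" by (rule t)
    from sum_permutations_compose_right[OF this, of "\<lambda>\<pi>. f \<pi> * cnj (g (\<pi> \<circ> transpose j i))"]
    show "(\<Sum>\<pi> | \<pi> permutes {1..n}. f (\<pi> \<circ> transpose j i) * cnj (g \<pi>)) =
        (\<Sum>\<pi> | \<pi> permutes {1..n}. f \<pi> * cnj (g (\<pi> \<circ> transpose j i)))"
      by (simp add: comp_assoc)
  qed
  also have "\<dots> = (\<Sum>\<pi> | \<pi> permutes {1..n}. f \<pi> * cnj (right_jm i g \<pi>))"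
    unfolding right_jm_def cnj_sum sum_distrib_left by (rule sum.swap)
  finally show ?thesis .
qed

text \<open>The eigenvalues are integers, so conjugation leaves them unchanged and selfadjointness
  forces orthogonality.\<close>

lemma content_spaces_orthogonal:
  assumes "f \<in> content_space n c" "g \<in> content_space n c'" "i \<in> {1..n}" "c i \<noteq> c' i"
  shows "(\<Sum>\<pi> | \<pi> permutes {1..n}. f \<pi> * cnj (g \<pi>)) = 0"
proof -
  have "right_jm i f \<pi> = of_int (c i) * f \<pi>" "right_jm i g \<pi> = of_int (c' i) * g \<pi>" for \<pi>
    using assms by (simp_all add: content_space_def)
  with right_jm_selfadjoint[OF assms(3), of f g]
  have "of_int (c i) * (\<Sum>\<pi> | \<pi> permutes {1..n}. f \<pi> * cnj (g \<pi>)) =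
      of_int (c' i) * (\<Sum>\<pi> | \<pi> permutes {1..n}. f \<pi> * cnj (g \<pi>))"
    by (simp add: sum_distrib_left mult_ac)
  with assms(4) show ?thesis by simp
qed

abbreviation box_content :: "tableau \<Rightarrow> nat \<Rightarrow> int"
  where "box_content T i \<equiv> content (box_of T i)"

text \<open>Pair the vanishing sum with \<open>x T\<close>: distinct standard tableaux have distinct
  content vectors, so only the squared norm of \<open>x T\<close> survives.\<close>

lemma content_spaces_independent:
  assumes x: "\<And>T. T \<in> standard_tableaux n \<Longrightarrow> x T \<in> content_space n (box_content T)"
    and sum: "(\<Sum>T\<in>standard_tableaux n. x T) = 0" and T: "T \<in> standard_tableaux n"
  shows "x T = 0"
proof -
  let ?ip = "\<lambda>f g. \<Sum>\<pi> | \<pi> permutes {1..n}. f \<pi> * cnj (g \<pi>)"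
  have "?ip (x S) (x T) = 0" if S: "S \<in> standard_tableaux n - {T}" for S
  proof -
    obtain i where "i \<in> {1..n}" "box_content S i \<noteq> box_content T i"
      using content_inj_standard[of n S T] S T by (auto simp: standard_tableaux_def)
    then show ?thesis
      using S by (intro content_spaces_orthogonal[OF x x[OF T]]) auto
  qed
  then have "(\<Sum>S\<in>standard_tableaux n - {T}. ?ip (x S) (x T)) = 0"
    by (intro sum.neutral) blast
  then have "?ip (x T) (x T) = (\<Sum>S\<in>standard_tableaux n. ?ip (x S) (x T))"
    using sum.remove[OF finite_standard_tableaux T, of "\<lambda>S. ?ip (x S) (x T)"] by simp
  also have "\<dots> = ?ip (\<Sum>S\<in>standard_tableaux n. x S) (x T)"
    unfolding sum_fun_apply sum_distrib_right by (rule sum.swap)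
  also have "\<dots> = 0"
    by (simp add: sum)
  finally have "(\<Sum>\<pi> | \<pi> permutes {1..n}. of_real ((cmod (x T \<pi>))\<^sup>2)) = (0::complex)"
    unfolding complex_norm_square .
  then have "(\<Sum>\<pi> | \<pi> permutes {1..n}. (cmod (x T \<pi>))\<^sup>2) = 0"
    by (simp only: of_real_sum[symmetric] of_real_eq_0_iff)
  then have "\<forall>\<pi>\<in>{\<pi>. \<pi> permutes {1..n}}. (cmod (x T \<pi>))\<^sup>2 = 0"
    by (subst (asm) sum_nonneg_eq_0_iff) (auto simp: finite_permutations)
  then show ?thesis
    using x[OF T] by (auto simp: content_space_def group_algebra_iff fun_eq_iff)
qed

section \<open>Dimension count for coordinate spaces\<close>

lemma delta_inj: "inj_on delta S"
proof (rule inj_onI)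
  fix x y :: 'a assume "delta x = delta y"
  then have "delta x x = delta y x" by simp
  then show "x = y" by (simp add: delta_def split: if_splits)
qed

lemma span_delta:
  assumes "finite S"
  shows "cfun.span (delta ` S) = supported_on S"
proof
  show "cfun.span (delta ` S) \<subseteq> supported_on S"
    by (rule cfun.span_minimal[OF _ subspace_supported_on]) (auto intro: delta_in_supported_on)
  show "supported_on S \<subseteq> cfun.span (delta ` S)"
  proof
    fix f assume f: "f \<in> supported_on S"
    have "(\<Sum>x\<in>S. cscale (f x) (delta x)) \<in> cfun.span (delta ` S)"
      by (intro cfun.span_sum cfun.span_scale cfun.span_base imageI)
    then show "f \<in> cfun.span (delta ` S)"
      unfolding supported_on_expand[OF assms f, symmetric] .
  qed
qed

lemma independent_delta:
  assumes "finite A"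
  shows "cfun.independent (delta ` A)"
proof (rule cfun.independent_if_scalars_zero)
  fix u v assume *: "(\<Sum>x\<in>delta ` A. cscale (u x) x) = 0" "v \<in> delta ` A"
  then obtain a where a: "a \<in> A" "v = delta a" by auto
  have "(\<Sum>x\<in>A. cscale (u (delta x)) (delta x)) = 0"
    using *(1) unfolding sum.reindex[OF delta_inj] comp_def .
  then have "(\<Sum>x\<in>A. cscale (u (delta x)) (delta x)) a = 0"
    by simp
  then have "(\<Sum>x\<in>A. if a = x then u (delta x) else 0) = 0"
    by (simp add: sum_fun_apply cscale_def delta_def if_distrib cong: if_cong)
  then show "u v = 0"
    using a assms by simp
qed (use assms in simp)

lemma linear_bij_supported_on:
  fixes L :: "('a \<Rightarrow> complex) \<Rightarrow> ('b \<Rightarrow> complex)"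
  assumes lin: "Vector_Spaces.linear cscale cscale L"
    and fin: "finite A" "finite B" and card: "card A = card B"
    and sub: "L ` supported_on A \<subseteq> supported_on B" and inj: "inj_on L (supported_on A)"
  shows "L ` supported_on A = supported_on B"
proof
  note hom = lin[unfolded Vector_Spaces.linear_iff_module_hom]
  let ?D = "L ` delta ` A"
  have D_indep: "cfun.independent ?D"
    by (rule module_hom.independent_injective_image[OF hom independent_delta[OF fin(1)]])
      (unfold span_delta[OF fin(1)], rule inj)
  have delta_A: "delta ` A \<subseteq> supported_on A"
    by (intro image_subsetI delta_in_supported_on)
  have D_card: "card ?D = card B"
    unfolding card_image[OF inj_on_subset[OF inj delta_A]] card_image[OF delta_inj] by (rule card)
  have D_sub: "?D \<subseteq> supported_on B"
    using sub delta_A by blast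
  have D_span: "cfun.span ?D = L ` supported_on A"
    unfolding module_hom.span_image[OF hom] span_delta[OF fin(1)] ..
  show "supported_on B \<subseteq> L ` supported_on A"
  \<comment> \<open>A missed \<open>f\<close> would enlarge the independent set \<open>?D\<close> to
    \<open>card B + 1\<close> vectors inside a span of \<open>card B\<close> vectors.\<close>
  proof (rule subsetI, rule ccontr)
    fix f assume f: "f \<in> supported_on B" and nf: "f \<notin> L ` supported_on A"
    have nD: "f \<notin> ?D"
      using nf delta_A by blast
    then have "cfun.independent (insert f ?D)"
      unfolding cfun.independent_insert D_span using D_indep nf by (simp only: if_False simp_thms)
    moreover have "insert f ?D \<subseteq> cfun.span (delta ` B)"
      unfolding span_delta[OF fin(2)] using f D_sub by blast
    ultimately have "card (insert f ?D) \<le> card (delta ` B)"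
      using cfun.independent_span_bound[OF finite_imageI[OF fin(2)]] by blast
    moreover have "card (insert f ?D) = Suc (card B)"
      unfolding D_card[symmetric] by (rule card_insert_disjoint[OF _ nD]) (intro finite_imageI fin)
    ultimately show False
      unfolding card_image[OF delta_inj] by linarith
  qed
qed (rule sub)


section \<open>Matrix coefficients\<close>

text \<open>The inverse makes \<open>w \<mapsto> matrix_coeff n \<rho> T w\<close> commute with left
  translation. Right multiplication then acts on the side where coordinate \<open>T\<close> is read
  off, which is how the contents of \<open>T\<close> become right eigenvalues.\<close>

definition matrix_coeff ::
    "nat \<Rightarrow> ((nat \<Rightarrow> nat) \<Rightarrow> ('a \<Rightarrow> complex) \<Rightarrow> ('a \<Rightarrow> complex)) \<Rightarrow> 'a \<Rightarrow> ('a \<Rightarrow> complex) \<Rightarrow> (nat \<Rightarrow> nat) \<Rightarrow> complex"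
  where "matrix_coeff n \<rho> T w = (\<lambda>\<pi>. if \<pi> permutes {1..n} then \<rho> (inv_into UNIV \<pi>) w T else 0)"

lemma linear_matrix_coeff:
  assumes "sn_module n W \<rho>"
  shows "Vector_Spaces.linear cscale cscale (matrix_coeff n \<rho> T)"
proof (rule cfun_linearI)
  have lin: "Vector_Spaces.linear cscale cscale (\<rho> (inv_into UNIV \<pi>))" if "\<pi> permutes {1..n}" for \<pi>
    by (rule sn_moduleD(2)[OF assms permutes_inv[OF that]])
  show "matrix_coeff n \<rho> T (x + y) = matrix_coeff n \<rho> T x + matrix_coeff n \<rho> T y" for x y
  proof
    show "matrix_coeff n \<rho> T (x + y) \<pi> = (matrix_coeff n \<rho> T x + matrix_coeff n \<rho> T y) \<pi>" for \<pi>
      using cfun_linear_add[OF lin, of \<pi> x y] by (simp add: matrix_coeff_def)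
  qed
  show "matrix_coeff n \<rho> T (cscale k x) = cscale k (matrix_coeff n \<rho> T x)" for k x
  proof
    show "matrix_coeff n \<rho> T (cscale k x) \<pi> = cscale k (matrix_coeff n \<rho> T x) \<pi>" for \<pi>
      using cfun_linear_scale[OF lin, of \<pi> k x] by (simp add: matrix_coeff_def cscale_def)
  qed
qed

lemma matrix_coeff_equivariant:
  assumes "sn_module n W \<rho>" "\<sigma> permutes {1..n}" "w \<in> W"
  shows "matrix_coeff n \<rho> T (\<rho> \<sigma> w) = translate \<sigma> (matrix_coeff n \<rho> T w)"
proof
  fix \<pi>
  show "matrix_coeff n \<rho> T (\<rho> \<sigma> w) \<pi> = translate \<sigma> (matrix_coeff n \<rho> T w) \<pi>"
  proof (cases "\<pi> permutes {1..n}")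
    case True
    have \<sigma>': "inv_into UNIV \<sigma> permutes {1..n}"
      by (rule permutes_inv[OF assms(2)])
    have "inv_into UNIV (inv_into UNIV \<sigma> \<circ> \<pi>) = inv_into UNIV \<pi> \<circ> \<sigma>"
      using o_inv_distrib[OF permutes_bij[OF \<sigma>'] permutes_bij[OF True]] permutes_inv_inv[OF assms(2)] by simp
    then have "translate \<sigma> (matrix_coeff n \<rho> T w) \<pi> = \<rho> (inv_into UNIV \<pi> \<circ> \<sigma>) w T"
      using permutes_compose[OF True \<sigma>'] by (simp add: translate_def matrix_coeff_def)
    also have "\<dots> = \<rho> (inv_into UNIV \<pi>) (\<rho> \<sigma> w) T"
      using sn_moduleD(5)[OF assms(1) permutes_inv[OF True] assms(2,3)] by simp
    finally show ?thesis
      using True by (simp add: matrix_coeff_def)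
  next
    case False
    have "matrix_coeff n \<rho> T w \<in> group_algebra n"
      by (simp add: group_algebra_iff matrix_coeff_def)
    from translate_group_algebra[OF assms(2) this] False show ?thesis
      by (simp add: group_algebra_iff matrix_coeff_def)
  qed
qed

lemma irreducible_moduleD:
  assumes "irreducible_module n W \<rho>"
  shows "sn_module n W \<rho>" "W \<noteq> {0}" "sn_module n U \<rho> \<Longrightarrow> U \<subseteq> W \<Longrightarrow> U = {0} \<or> U = W"
  using assms by (simp_all add: irreducible_module_def)

text \<open>The kernel is a submodule, and \<open>delta T\<close> is not in it, since its
  coefficient at the identity is 1.\<close>

lemma matrix_coeff_inj:
  assumes irr: "irreducible_module n W \<rho>" and T: "delta T \<in> W"
  shows "inj_on (matrix_coeff n \<rho> T) W"
proof -
  note mod = irreducible_moduleD(1)[OF irr]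
  note sub = sn_moduleD(1)[OF mod] and lin = linear_matrix_coeff[OF mod, of T]
  let ?K = "{w \<in> W. matrix_coeff n \<rho> T w = 0}"
  have "sn_module n ?K \<rho>"
  proof (rule sn_moduleI)
    show "cfun.subspace ?K"
      using sub by (auto simp: cfun.subspace_def cfun_linear_add[OF lin] cfun_linear_scale[OF lin] cfun_linear_0[OF lin])
    show "\<rho> \<sigma> w \<in> ?K" if "\<sigma> permutes {1..n}" "w \<in> ?K" for \<sigma> w
      using that sn_moduleD(3)[OF mod] matrix_coeff_equivariant[OF mod, of \<sigma> w T]
      by (auto simp: cfun_linear_0[OF linear_translate])
  qed (use sn_moduleD[OF mod] in auto)
  moreover have "?K \<noteq> W"
  proof
    assume "?K = W"
    then have "delta T \<in> ?K"
      using T by (rule ssubst)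
    then have "matrix_coeff n \<rho> T (delta T) id = 0"
      by simp
    then show False
      using sn_moduleD(4)[OF mod T] by (simp add: matrix_coeff_def permutes_id delta_def inv_id)
  qed
  ultimately have "?K = {0}"
    using irreducible_moduleD(3)[OF irr, of ?K] by simp
  show ?thesis
  proof (rule inj_onI)
    fix v w assume vw: "v \<in> W" "w \<in> W" "matrix_coeff n \<rho> T v = matrix_coeff n \<rho> T w"
    then have "v - w \<in> ?K"
      by (simp add: cfun_linear_diff[OF lin] cfun.subspace_diff[OF sub])
    with \<open>?K = {0}\<close> show "v = w" by simp
  qed
qed

lemma irreducible_module_image:
  assumes irr: "irreducible_module n W \<rho>" and lin: "Vector_Spaces.linear cscale cscale \<phi>"
    and inj: "inj_on \<phi> W"
    and equiv: "\<And>\<sigma> w. \<sigma> permutes {1..n} \<Longrightarrow> w \<in> W \<Longrightarrow> \<phi> (\<rho> \<sigma> w) = translate \<sigma> (\<phi> w)"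
  shows "irreducible_module n (\<phi> ` W) translate"
proof -
  note mod = irreducible_moduleD(1)[OF irr]
  note sub = sn_moduleD(1)[OF mod]
  have mod': "sn_module n (\<phi> ` W) translate"
  proof (rule sn_module_translateI)
    show "cfun.subspace (\<phi> ` W)"
      by (rule module_hom.subspace_image[OF lin[unfolded Vector_Spaces.linear_iff_module_hom] sub])
    show "translate \<sigma> f \<in> \<phi> ` W" if "\<sigma> permutes {1..n}" "f \<in> \<phi> ` W" for \<sigma> f
      using that sn_moduleD(3)[OF mod that(1)] by (auto simp: equiv[OF that(1), symmetric])
  qed
  have "\<phi> ` W \<noteq> {0}"
  proof
    assume "\<phi> ` W = {0}"
    then have "w = 0" if "w \<in> W" for w
      using inj_onD[OF inj _ that cfun.subspace_0[OF sub]] that cfun_linear_0[OF lin] by auto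
    then have "W = {0}"
      using cfun.subspace_0[OF sub] by blast
    then show False
      using irreducible_moduleD(2)[OF irr] by contradiction
  qed
  moreover have "U = {0} \<or> U = \<phi> ` W" if U: "U \<subseteq> \<phi> ` W" "sn_module n U translate" for U
  proof -
    let ?P = "{w \<in> W. \<phi> w \<in> U}"
    have "sn_module n ?P \<rho>"
    proof (rule sn_moduleI)
      show "cfun.subspace ?P"
        using sub sn_moduleD(1)[OF U(2)]
        by (auto simp: cfun.subspace_def cfun_linear_add[OF lin] cfun_linear_scale[OF lin] cfun_linear_0[OF lin])
      show "\<rho> \<sigma> w \<in> ?P" if "\<sigma> permutes {1..n}" "w \<in> ?P" for \<sigma> w
        using that sn_moduleD(3)[OF mod that(1)] sn_moduleD(3)[OF U(2) that(1)]
        by (simp add: equiv)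
    qed (use sn_moduleD[OF mod] in auto)
    then have "?P = {0} \<or> ?P = W"
      by (rule irreducible_moduleD(3)[OF irr]) simp
    moreover have "U = \<phi> ` ?P"
      using U(1) by blast
    moreover have "\<phi> ` {0} = {0}"
      using cfun_linear_0[OF lin] by simp
    ultimately show ?thesis
      by (elim disjE) (simp_all only: simp_thms)
  qed
  ultimately show ?thesis
    unfolding irreducible_module_def using mod' by (intro conjI allI impI) simp_all
qed

lemma module_iso_image:
  assumes mod: "sn_module n W \<rho>" and lin: "Vector_Spaces.linear cscale cscale \<phi>"
    and inj: "inj_on \<phi> W"
    and equiv: "\<And>\<sigma> w. \<sigma> permutes {1..n} \<Longrightarrow> w \<in> W \<Longrightarrow> \<phi> (\<rho> \<sigma> w) = translate \<sigma> (\<phi> w)"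
  shows "module_iso n (\<phi> ` W) translate W \<rho>"
proof -
  interpret vector_space_pair "cscale :: complex \<Rightarrow> ('a \<Rightarrow> complex) \<Rightarrow> 'a \<Rightarrow> complex"
      "cscale :: complex \<Rightarrow> ((nat \<Rightarrow> nat) \<Rightarrow> complex) \<Rightarrow> (nat \<Rightarrow> nat) \<Rightarrow> complex" ..
  have span: "cfun.span W = W"
    using sn_moduleD(1)[OF mod] by (simp add: cfun.span_eq_iff)
  have "inj_on \<phi> (cfun.span W)"
    unfolding span by (rule inj)
  \<comment> \<open>\<open>module_iso\<close> asks for a map from the image back to \<open>W\<close>
    that is linear on the whole ambient space; a left inverse of \<open>\<phi>\<close> provides
    it.\<close>
  from linear_inj_on_left_inverse[OF lin this]
  obtain \<psi> where \<psi>: "Vector_Spaces.linear cscale cscale \<psi>" "\<And>w. w \<in> W \<Longrightarrow> \<psi> (\<phi> w) = w"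
    unfolding span by blast
  have "bij_betw \<psi> (\<phi> ` W) W"
    by (rule bij_betw_byWitness[where f' = \<phi>]) (use \<psi>(2) in auto)
  moreover have "\<psi> (translate \<sigma> f) = \<rho> \<sigma> (\<psi> f)" if "\<sigma> permutes {1..n}" "f \<in> \<phi> ` W" for \<sigma> f
    using that sn_moduleD(3)[OF mod that(1)] by (auto simp: equiv[OF that(1), symmetric] \<psi>(2))
  ultimately show ?thesis
    unfolding module_iso_def carrier_sym_group using \<psi>(1) by blast
qed

text \<open>The specification speaks of basis vectors; expanding \<open>w\<close> in the finite
  basis extends it to all vectors, coordinate by coordinate.\<close>

lemma specht_action_diagonal:
  assumes T: "standard_tableau n T" and n: "1 \<le> n"
    and w: "w \<in> specht_space (tableau_shape T)" and i: "i \<in> {1..n}"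
  defines "\<rho> \<equiv> specht_action (tableau_shape T)"
  assumes S: "S \<in> standard_tableaux_of_shape (tableau_shape T)"
  shows "algebra_act \<rho> (jucys_murphy i) w S = of_int (box_content S i) * w S"
proof -
  let ?\<Omega> = "standard_tableaux_of_shape (tableau_shape T)"
  have spec: "is_specht_action (tableau_shape T) \<rho>"
    unfolding \<rho>_def by (rule is_specht_action_specht_action[OF T n])
  have size: "sum_list (tableau_shape T) = n" by (rule sum_list_tableau_shape[OF T])
  have mod: "sn_module n (specht_space (tableau_shape T)) \<rho>"
    using spec by (simp add: is_specht_action_def irreducible_module_def size)
  have fin: "finite ?\<Omega>"
    by (rule finite_subset[OF _ finite_standard_tableaux[of n]])
      (auto simp: standard_tableaux_of_shape_def size)
  have lin: "Vector_Spaces.linear cscale cscale (\<rho> (transpose j i))" if "j \<in> {1..<i}" for j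
    by (rule sn_moduleD(2)[OF mod permutes_swap_id]) (use that i in auto)
  have act: "algebra_act \<rho> (jucys_murphy i) (delta R) = cscale (of_int (box_content R i)) (delta R)" if "R \<in> ?\<Omega>" for R
    using spec that i by (simp add: is_specht_action_def size)
  have w_eq: "w = (\<Sum>R\<in>?\<Omega>. cscale (w R) (delta R))"
    using w by (intro supported_on_expand[OF fin]) (simp add: specht_space_def)
  have "algebra_act \<rho> (jucys_murphy i) w = (\<Sum>j\<in>{1..<i}. \<Sum>R\<in>?\<Omega>. cscale (w R) (\<rho> (transpose j i) (delta R)))"
    unfolding jucys_murphy_act
  proof (rule sum.cong[OF refl])
    fix j assume j: "j \<in> {1..<i}"
    have "\<rho> (transpose j i) w = \<rho> (transpose j i) (\<Sum>R\<in>?\<Omega>. cscale (w R) (delta R))"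
      using w_eq by simp
    then show "\<rho> (transpose j i) w = (\<Sum>R\<in>?\<Omega>. cscale (w R) (\<rho> (transpose j i) (delta R)))"
      by (simp add: cfun_linear_sum[OF lin[OF j]] cfun_linear_scale[OF lin[OF j]])
  qed
  also have "\<dots> = (\<Sum>R\<in>?\<Omega>. \<Sum>j\<in>{1..<i}. cscale (w R) (\<rho> (transpose j i) (delta R)))"
    by (rule sum.swap)
  also have "\<dots> = (\<Sum>R\<in>?\<Omega>. cscale (w R) (algebra_act \<rho> (jucys_murphy i) (delta R)))"
    unfolding jucys_murphy_act cfun.scale_sum_right ..
  also have "\<dots> = (\<Sum>R\<in>?\<Omega>. cscale (w R) (cscale (of_int (box_content R i)) (delta R)))"
    by (rule sum.cong[OF refl]) (simp only: act)
  finally have "algebra_act \<rho> (jucys_murphy i) w S = (\<Sum>R\<in>?\<Omega>. w R * (of_int (box_content R i) * delta R S))"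
    by (simp add: sum_fun_apply cscale_def)
  also have "\<dots> = (\<Sum>R\<in>?\<Omega>. if S = R then w R * of_int (box_content R i) else 0)"
    by (rule sum.cong) (auto simp: delta_def)
  also have "\<dots> = of_int (box_content S i) * w S"
    using S fin by simp
  finally show ?thesis .
qed

section \<open>The eigenspaces as images of coefficient maps\<close>

abbreviation tableau_coeff :: "nat \<Rightarrow> tableau \<Rightarrow> (tableau \<Rightarrow> complex) \<Rightarrow> (nat \<Rightarrow> nat) \<Rightarrow> complex"
  where "tableau_coeff n T \<equiv> matrix_coeff n (specht_action (tableau_shape T)) T"

lemma irreducible_specht:
  assumes "standard_tableau n T" "1 \<le> n"
  shows "irreducible_module n (specht_space (tableau_shape T)) (specht_action (tableau_shape T))"
  using is_specht_action_specht_action[OF assms] sum_list_tableau_shape[OF assms(1)]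
  by (simp add: is_specht_action_def)

lemma sn_module_specht:
  assumes "standard_tableau n T" "1 \<le> n"
  shows "sn_module n (specht_space (tableau_shape T)) (specht_action (tableau_shape T))"
  using irreducible_specht[OF assms] by (simp add: irreducible_module_def)

text \<open>Right multiplication of \<open>\<pi>\<close> by a transposition applies the same
  transposition to the vector \<open>u\<close>, so the right Jucys-Murphy element becomes the one
  acting on the module, read at coordinate \<open>T\<close>, where it is diagonal.\<close>

lemma tableau_coeff_in_content_space:
  assumes T: "standard_tableau n T" and n: "1 \<le> n" and w: "w \<in> specht_space (tableau_shape T)"
  shows "tableau_coeff n T w \<in> content_space n (box_content T)"
proof -
  let ?\<rho> = "specht_action (tableau_shape T)"
  note mod = sn_module_specht[OF T n]
  have "right_jm i (tableau_coeff n T w) \<pi> = of_int (box_content T i) * tableau_coeff n T w \<pi>"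
    if i: "i \<in> {1..n}" for i \<pi>
  proof (cases "\<pi> permutes {1..n}")
    case True
    note \<pi>' = permutes_inv[OF True]
    define u where "u = ?\<rho> (inv_into UNIV \<pi>) w"
    have u: "u \<in> specht_space (tableau_shape T)"
      unfolding u_def by (rule sn_moduleD(3)[OF mod \<pi>' w])
    have "tableau_coeff n T w (\<pi> \<circ> transpose j i) = ?\<rho> (transpose j i) u T" if j: "j \<in> {1..<i}" for j
    proof -
      have t: "transpose j i permutes {1..n}"
        by (rule permutes_swap_id) (use i j in auto)
      have "inv_into UNIV (\<pi> \<circ> transpose j i) = transpose j i \<circ> inv_into UNIV \<pi>"
        using o_inv_distrib[OF permutes_bij[OF True] permutes_bij[OF t]] by simp
      then show ?thesis
        using permutes_compose[OF t True] sn_moduleD(5)[OF mod t \<pi>' w]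
        by (simp add: matrix_coeff_def u_def)
    qed
    then have "right_jm i (tableau_coeff n T w) \<pi> = algebra_act ?\<rho> (jucys_murphy i) u T"
      by (simp add: right_jm_def jucys_murphy_act sum_fun_apply)
    also have "\<dots> = of_int (box_content T i) * u T"
      by (rule specht_action_diagonal[OF T n u i]) (use T in \<open>simp add: standard_tableaux_of_shape_eq[OF T]\<close>)
    finally show ?thesis
      using True by (simp add: matrix_coeff_def u_def)
  next
    case False
    have "\<not> \<pi> \<circ> transpose j i permutes {1..n}" if "j \<in> {1..<i}" for j
      using permutes_comp_transpose_iff[of j n i \<pi>] that i False by auto
    with False show ?thesis
      by (simp add: right_jm_def matrix_coeff_def)
  qed
  then show ?thesis
    by (simp add: content_space_def group_algebra_iff matrix_coeff_def)
qed

lemma delta_in_specht_space: "standard_tableau n T \<Longrightarrow> delta T \<in> specht_space (tableau_shape T)"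
  unfolding specht_space_def
  by (rule delta_in_supported_on) (simp add: standard_tableaux_of_shape_eq)

lemma tableau_coeff_inj:
  assumes "standard_tableau n T" "1 \<le> n"
  shows "inj_on (tableau_coeff n T) (specht_space (tableau_shape T))"
  by (rule matrix_coeff_inj[OF irreducible_specht[OF assms] delta_in_specht_space[OF assms(1)]])

text \<open>All coefficient maps are bundled into one linear map \<open>L\<close> on functions of
  pairs of tableaux of equal shape. There are n! such pairs, so injectivity of \<open>L\<close>
  gives surjectivity; it follows from independence of the eigenspaces and injectivity of each single
  coefficient map.\<close>

lemma group_algebra_decomposition:
  assumes n: "1 \<le> n" and f: "f \<in> group_algebra n"
  shows "\<exists>w. (\<forall>T\<in>standard_tableaux n. w T \<in> specht_space (tableau_shape T)) \<and>
    f = (\<Sum>T\<in>standard_tableaux n. tableau_coeff n T (w T))"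
proof -
  let ?P = "{(S, T). S \<in> standard_tableaux n \<and> T \<in> standard_tableaux n \<and> tableau_shape S = tableau_shape T}"
  \<comment> \<open>\<open>slice T F\<close> is the vector with coordinates \<open>F (S, T)\<close>
    in the module of the shape of \<open>T\<close>.\<close>
  define slice where "slice T F = (\<lambda>S. if (S, T) \<in> ?P then F (S, T) else 0)"
    for T :: tableau and F :: "tableau \<times> tableau \<Rightarrow> complex"
  define L where "L F = (\<Sum>T\<in>standard_tableaux n. tableau_coeff n T (slice T F))" for F
  have std: "standard_tableau n T" if "T \<in> standard_tableaux n" for T
    using that by (simp add: standard_tableaux_def)
  have lin_T: "Vector_Spaces.linear cscale cscale (tableau_coeff n T)" if "T \<in> standard_tableaux n" for T
    by (rule linear_matrix_coeff[OF sn_module_specht[OF std[OF that] n]])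
  have slice_in: "slice T F \<in> specht_space (tableau_shape T)" if T: "T \<in> standard_tableaux n" for T F
    using T by (simp add: specht_space_def standard_tableaux_of_shape_eq[OF std[OF T]] supported_on_def
      slice_def standard_tableaux_def)
  have coeff_in: "tableau_coeff n T (slice T F) \<in> content_space n (box_content T)"
    if "T \<in> standard_tableaux n" for T F
    by (rule tableau_coeff_in_content_space[OF std[OF that] n slice_in[OF that]])
  have lin: "Vector_Spaces.linear cscale cscale L"
  proof (rule cfun_linearI)
    have add: "slice T (F + G) = slice T F + slice T G" for T F G
      by (simp add: slice_def fun_eq_iff)
    have scale: "slice T (cscale k F) = cscale k (slice T F)" for T k F
      by (simp add: slice_def cscale_def fun_eq_iff)
    show "L (F + G) = L F + L G" for F G
      unfolding L_def add sum.distrib[symmetric]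
      by (rule sum.cong[OF refl]) (rule cfun_linear_add[OF lin_T])
    show "L (cscale k F) = cscale k (L F)" for k F
      unfolding L_def scale cfun.scale_sum_right
      by (rule sum.cong[OF refl]) (rule cfun_linear_scale[OF lin_T])
  qed
  have "L ` supported_on ?P = supported_on {\<pi>. \<pi> permutes {1..n}}"
  proof (rule linear_bij_supported_on[OF lin])
    show "finite ?P"
      by (rule finite_subset[of _ "standard_tableaux n \<times> standard_tableaux n"])
        (auto simp: finite_standard_tableaux)
    show "finite {\<pi>. \<pi> permutes {1..n}}"
      by (rule finite_permutations) simp
    show "card ?P = card {\<pi>. \<pi> permutes {1..n}}"
      unfolding card_standard_pairs by (rule card_permutations[symmetric]) simp_all
    have "L F \<in> group_algebra n" for F
      unfolding L_def using coeff_in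
      by (intro cfun.subspace_sum[OF subspace_group_algebra]) (simp add: content_space_def)
    then show "L ` supported_on ?P \<subseteq> supported_on {\<pi>. \<pi> permutes {1..n}}"
      unfolding group_algebra_def carrier_sym_group by blast
    show "inj_on L (supported_on ?P)"
    proof (rule inj_onI)
      fix F G assume F: "F \<in> supported_on ?P" and G: "G \<in> supported_on ?P" and eq: "L F = L G"
      define H where "H = F - G"
      have "L H = 0"
        unfolding H_def cfun_linear_diff[OF lin] eq by simp
      then have zero: "tableau_coeff n T (slice T H) = 0" if "T \<in> standard_tableaux n" for T
        by (intro content_spaces_independent[where x = "\<lambda>T. tableau_coeff n T (slice T H)", OF coeff_in _ that])
          (simp_all add: L_def)
      have sl: "slice T H = 0" if T: "T \<in> standard_tableaux n" for T
      proof (rule inj_onD[OF tableau_coeff_inj[OF std[OF T] n] _ slice_in[OF T]])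
        show "tableau_coeff n T (slice T H) = tableau_coeff n T 0"
          unfolding zero[OF T] cfun_linear_0[OF lin_T[OF T]] ..
        show "0 \<in> specht_space (tableau_shape T)"
          by (simp add: specht_space_def supported_on_def)
      qed
      have "F x = G x" for x
      proof (cases "x \<in> ?P")
        case True
        then obtain S T where x: "x = (S, T)" "(S, T) \<in> ?P" "T \<in> standard_tableaux n" by auto
        have "H (S, T) = slice T H S"
          unfolding slice_def if_P[OF x(2)] ..
        also have "\<dots> = 0"
          unfolding sl[OF x(3)] by simp
        finally show ?thesis
          by (simp add: H_def x(1))
      next
        case False
        have "F x = 0" "G x = 0"
          using F G False unfolding supported_on_def by blast+
        then show ?thesis by simp
      qed
      then show "F = G" by blast
    qed
  qed
  then obtain F where "f = L F"
    using f unfolding group_algebra_def carrier_sym_group by blast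
  then show ?thesis
    using slice_in unfolding L_def by (intro exI[of _ "\<lambda>T. slice T F"]) simp
qed

lemma content_space_eq_image:
  assumes T: "standard_tableau n T" and n: "1 \<le> n"
  shows "content_space n (box_content T) = tableau_coeff n T ` specht_space (tableau_shape T)"
proof
  show "tableau_coeff n T ` specht_space (tableau_shape T) \<subseteq> content_space n (box_content T)"
    using tableau_coeff_in_content_space[OF T n] by (rule image_subsetI)
  show "content_space n (box_content T) \<subseteq> tableau_coeff n T ` specht_space (tableau_shape T)"
  proof
    fix f assume f: "f \<in> content_space n (box_content T)"
    then have "f \<in> group_algebra n" by (simp add: content_space_def)
    from group_algebra_decomposition[OF n this] obtain w where
      w: "\<And>S. S \<in> standard_tableaux n \<Longrightarrow> w S \<in> specht_space (tableau_shape S)" and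
      f_eq: "f = (\<Sum>S\<in>standard_tableaux n. tableau_coeff n S (w S))" by blast
    \<comment> \<open>Subtracting \<open>f\<close> from the summand of \<open>T\<close> gives a
      vanishing sum of eigenvectors, so each term is 0.\<close>
    define x where "x S = tableau_coeff n S (w S) - (if S = T then f else 0)" for S
    have TI: "T \<in> standard_tableaux n" using T by (simp add: standard_tableaux_def)
    have "x T = 0"
    proof (rule content_spaces_independent[OF _ _ TI])
      fix S assume S: "S \<in> standard_tableaux n"
      then have "tableau_coeff n S (w S) \<in> content_space n (box_content S)"
        by (intro tableau_coeff_in_content_space n w) (simp_all add: standard_tableaux_def)
      then show "x S \<in> content_space n (box_content S)"
        unfolding x_def using f
        by (intro cfun.subspace_diff[OF subspace_content_space])
          (auto intro: cfun.subspace_0[OF subspace_content_space])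
    next
      show "(\<Sum>S\<in>standard_tableaux n. x S) = 0"
        unfolding x_def sum_subtractf using f_eq TI finite_standard_tableaux by simp
    qed
    then have "f = tableau_coeff n T (w T)"
      by (simp add: x_def)
    then show "f \<in> tableau_coeff n T ` specht_space (tableau_shape T)"
      using w[OF TI] by blast
  qed
qed

lemma irreducible_content_space:
  assumes "standard_tableau n T" "1 \<le> n"
  shows "irreducible_module n (content_space n (box_content T)) translate"
  unfolding content_space_eq_image[OF assms]
  by (rule irreducible_module_image[OF irreducible_specht[OF assms] linear_matrix_coeff[OF sn_module_specht[OF assms]]
      tableau_coeff_inj[OF assms] matrix_coeff_equivariant[OF sn_module_specht[OF assms]]])

lemma module_iso_content_space:
  assumes "standard_tableau n T" "1 \<le> n"
  shows "module_iso n (content_space n (box_content T)) translate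
    (specht_space (tableau_shape T)) (specht_action (tableau_shape T))"
  unfolding content_space_eq_image[OF assms]
  by (rule module_iso_image[OF sn_module_specht[OF assms] linear_matrix_coeff[OF sn_module_specht[OF assms]]
      tableau_coeff_inj[OF assms] matrix_coeff_equivariant[OF sn_module_specht[OF assms]]])

lemma direct_sum_content_spaces:
  assumes n: "1 \<le> n"
  shows "is_direct_sum (group_algebra n) (standard_tableaux n) (\<lambda>T. content_space n (box_content T))"
  unfolding is_direct_sum_def
proof (intro conjI ballI)
  let ?I = "standard_tableaux n" and ?V = "\<lambda>T. content_space n (box_content T)"
  show "finite ?I" by (rule finite_standard_tableaux)
  show "cfun.subspace (?V T)" for T by (rule subspace_content_space)
  show "bij_betw (\<lambda>x. \<Sum>T\<in>?I. x T) (\<Pi>\<^sub>E T\<in>?I. ?V T) (group_algebra n)"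
  proof (rule bij_betw_imageI)
    show "inj_on (\<lambda>x. \<Sum>T\<in>?I. x T) (\<Pi>\<^sub>E T\<in>?I. ?V T)"
    proof (rule inj_onI)
      fix x y assume x: "x \<in> (\<Pi>\<^sub>E T\<in>?I. ?V T)" and y: "y \<in> (\<Pi>\<^sub>E T\<in>?I. ?V T)"
        and eq: "(\<Sum>T\<in>?I. x T) = (\<Sum>T\<in>?I. y T)"
      have "x T - y T = 0" if "T \<in> ?I" for T
      proof (rule content_spaces_independent[where x = "\<lambda>T. x T - y T", OF _ _ that])
        show "x S - y S \<in> ?V S" if "S \<in> ?I" for S
          by (rule cfun.subspace_diff[OF subspace_content_space PiE_mem[OF x that] PiE_mem[OF y that]])
        show "(\<Sum>S\<in>?I. x S - y S) = 0"
          unfolding sum_subtractf eq by simp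
      qed
      then show "x = y"
        by (intro PiE_ext[OF x y]) simp
    qed
    show "(\<lambda>x. \<Sum>T\<in>?I. x T) ` (\<Pi>\<^sub>E T\<in>?I. ?V T) = group_algebra n"
    proof
      show "(\<lambda>x. \<Sum>T\<in>?I. x T) ` (\<Pi>\<^sub>E T\<in>?I. ?V T) \<subseteq> group_algebra n"
      proof (rule image_subsetI)
        fix x assume x: "x \<in> (\<Pi>\<^sub>E T\<in>?I. ?V T)"
        show "(\<Sum>T\<in>?I. x T) \<in> group_algebra n"
          by (rule cfun.subspace_sum[OF subspace_group_algebra])
            (use PiE_mem[OF x] in \<open>simp add: content_space_def\<close>)
      qed
      show "group_algebra n \<subseteq> (\<lambda>x. \<Sum>T\<in>?I. x T) ` (\<Pi>\<^sub>E T\<in>?I. ?V T)"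
      proof
        fix f assume "f \<in> group_algebra n"
        from group_algebra_decomposition[OF n this] obtain w where
          w: "\<And>S. S \<in> ?I \<Longrightarrow> w S \<in> specht_space (tableau_shape S)" and
          f_eq: "f = (\<Sum>S\<in>?I. tableau_coeff n S (w S))" by blast
        let ?x = "restrict (\<lambda>S. tableau_coeff n S (w S)) ?I"
        have "?x \<in> (\<Pi>\<^sub>E T\<in>?I. ?V T)"
          by (rule restrict_PiE_iff[THEN iffD2])
            (auto intro!: tableau_coeff_in_content_space n w simp: standard_tableaux_def)
        moreover have "f = (\<Sum>S\<in>?I. ?x S)"
          unfolding f_eq by (rule sum.cong) simp_all
        ultimately show "f \<in> (\<lambda>x. \<Sum>T\<in>?I. x T) ` (\<Pi>\<^sub>E T\<in>?I. ?V T)"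
          unfolding image_def by (intro CollectI bexI[of _ ?x])
      qed
    qed
  qed
qed


section \<open>The induction path\<close>

text \<open>Left translations commute with right multiplication, so the first \<open>k\<close> right
  eigenvalues survive induction and only the last one remains open.\<close>

lemma induced_in_right_eigenspace:
  assumes V: "V \<subseteq> content_space k c" and h: "h \<in> induced (Suc k) V"
  shows "h \<in> group_algebra (Suc k)" "i \<in> {1..k} \<Longrightarrow> right_jm i h \<pi> = of_int (c i) * h \<pi>"
proof -
  let ?K = "{h \<in> group_algebra (Suc k). \<forall>i\<in>{1..k}. \<forall>\<pi>. right_jm i h \<pi> = of_int (c i) * h \<pi>}"
  have sub: "cfun.subspace ?K"
  proof (rule cfun.subspaceI)
    show "0 \<in> ?K"
      by (simp add: group_algebra_iff right_jm_def)
    show "f + g \<in> ?K" if "f \<in> ?K" "g \<in> ?K" for f g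
      using that by (simp add: group_algebra_iff right_jm_add distrib_left)
    show "cscale a f \<in> ?K" if "f \<in> ?K" for a f
      using that by (simp add: group_algebra_iff right_jm_cscale) (simp add: cscale_def)
  qed
  have "gmult f v \<in> ?K" if f: "f \<in> group_algebra (Suc k)" and v: "v \<in> V" for f v
    unfolding gmult_def algebra_act_def
  proof (intro cfun.subspace_sum[OF sub] cfun.subspace_scale[OF sub])
    fix \<sigma> assume "\<sigma> \<in> {\<sigma>. f \<sigma> \<noteq> 0}"
    then have \<sigma>: "\<sigma> permutes {1..Suc k}"
      using f by (auto simp: group_algebra_iff)
    have v_eq: "right_jm i v \<pi> = of_int (c i) * v \<pi>" if "i \<in> {1..k}" for i \<pi>
      using v V that unfolding content_space_def by blast
    have "v \<in> group_algebra k"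
      using v V unfolding content_space_def by blast
    then have "v \<in> group_algebra (Suc k)"
      by (auto simp: group_algebra_iff intro: permutes_subset)
    then have "translate \<sigma> v \<in> group_algebra (Suc k)"
      by (rule translate_group_algebra[OF \<sigma>])
    moreover have "right_jm i (translate \<sigma> v) \<pi> = of_int (c i) * translate \<sigma> v \<pi>" if "i \<in> {1..k}" for i \<pi>
      unfolding right_jm_translate unfolding translate_def by (rule v_eq[OF that])
    ultimately show "translate \<sigma> v \<in> ?K" by blast
  qed
  then have "induced (Suc k) V \<subseteq> ?K"
    unfolding induced_def by (intro cfun.span_minimal sub) blast
  with h show "h \<in> group_algebra (Suc k)" "i \<in> {1..k} \<Longrightarrow> right_jm i h \<pi> = of_int (c i) * h \<pi>"
    by blast+
qed

lemma gmult_delta: "gmult (delta \<sigma>) v = translate \<sigma> v"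
proof -
  have "{\<tau>. delta \<sigma> \<tau> \<noteq> 0} = {\<sigma>}"
    by (auto simp: delta_def)
  then show ?thesis
    by (simp add: gmult_def algebra_act_def delta_def cscale_def)
qed

text \<open>
  Splitting \<open>f\<close> along the left cosets of \<open>S\<^sub>k\<close> in \<open>S\<^bsub>k+1\<^esub>\<close>, with representatives
  \<open>(m k+1)\<close>, writes it as a combination of left translates of elements of the smaller group algebra.
\<close>

lemma content_space_subset_induced:
  "content_space (Suc k) c \<subseteq> induced (Suc k) (content_space k c)"
proof
  fix f assume f: "f \<in> content_space (Suc k) c"
  let ?t = "\<lambda>m. transpose m (Suc k)"
  \<comment> \<open>The restriction of \<open>f\<close> to the coset of \<open>?t m\<close>, moved
    back to S_k.\<close>
  define part where "part m = (\<lambda>\<pi>. if \<pi> permutes {1..k} then f (?t m \<circ> \<pi>) else 0)" for m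
  have part_in: "part m \<in> content_space k c" for m
  proof -
    have "right_jm i (part m) \<pi> = of_int (c i) * part m \<pi>" if i: "i \<in> {1..k}" for i \<pi>
    proof -
      have iff: "\<pi> \<circ> transpose j i permutes {1..k} \<longleftrightarrow> \<pi> permutes {1..k}" if "j \<in> {1..<i}" for j
        by (rule permutes_comp_transpose_iff) (use that i in auto)
      have "right_jm i (part m) \<pi> =
          (\<Sum>j\<in>{1..<i}. if \<pi> permutes {1..k} then f (?t m \<circ> \<pi> \<circ> transpose j i) else 0)"
        unfolding right_jm_def by (rule sum.cong[OF refl]) (simp only: part_def iff comp_assoc)
      also have "\<dots> = (if \<pi> permutes {1..k} then right_jm i f (?t m \<circ> \<pi>) else 0)"
        by (simp add: right_jm_def)
      also have "right_jm i f (?t m \<circ> \<pi>) = of_int (c i) * f (?t m \<circ> \<pi>)"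
        using f i by (simp add: content_space_def)
      finally show ?thesis by (simp add: part_def)
    qed
    moreover have "part m \<in> group_algebra k"
      by (simp add: group_algebra_iff part_def)
    ultimately show ?thesis by (simp add: content_space_def)
  qed
  have perm: "?t m permutes {1..Suc k}" if "m \<in> {1..Suc k}" for m
    using that by (intro permutes_swap_id) auto
  have "f = (\<Sum>m\<in>{1..Suc k}. gmult (delta (?t m)) (part m))"
  proof
    fix \<pi>
    \<comment> \<open>The coset of \<open>?t m\<close> consists of the permutations sending
      \<open>Suc k\<close> to \<open>m\<close>, so at each \<open>\<pi>\<close> at most one summand
      is nonzero.\<close>
    have summand: "gmult (delta (?t m)) (part m) \<pi> = (if \<pi> (Suc k) = m then f \<pi> else 0)" if m: "m \<in> {1..Suc k}" for m
    proof -
      have "?t m \<circ> \<pi> permutes {1..k} \<longleftrightarrow> \<pi> permutes {1..Suc k} \<and> \<pi> (Suc k) = m"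
      proof
        assume p: "?t m \<circ> \<pi> permutes {1..k}"
        then have "?t m \<circ> \<pi> permutes {1..Suc k}"
          by (rule permutes_subset) auto
        then have "?t m \<circ> (?t m \<circ> \<pi>) permutes {1..Suc k}"
          by (rule permutes_compose[OF _ perm[OF m]])
        moreover have "?t m \<circ> (?t m \<circ> \<pi>) = \<pi>"
          by (simp add: fun_eq_iff)
        moreover have "(?t m \<circ> \<pi>) (Suc k) = Suc k"
          by (rule permutes_not_in[OF p]) simp
        then have "?t m (?t m (\<pi> (Suc k))) = ?t m (Suc k)"
          by simp
        then have "\<pi> (Suc k) = m"
          by simp
        ultimately show "\<pi> permutes {1..Suc k} \<and> \<pi> (Suc k) = m"
          by simp
      next
        assume p: "\<pi> permutes {1..Suc k} \<and> \<pi> (Suc k) = m"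
        show "?t m \<circ> \<pi> permutes {1..k}"
        proof (rule permutes_fixing_last)
          show "?t m \<circ> \<pi> permutes {1..Suc k}"
            using p by (intro permutes_compose[OF _ perm[OF m]]) simp
          show "(?t m \<circ> \<pi>) (Suc k) = Suc k"
            using p by simp
        qed
      qed
      moreover have "?t m \<circ> (?t m \<circ> \<pi>) = \<pi>"
        by (simp add: fun_eq_iff)
      moreover have "f \<pi> = 0" if "\<not> \<pi> permutes {1..Suc k}"
        using f that by (simp add: content_space_def group_algebra_iff)
      ultimately show ?thesis
        by (auto simp: gmult_delta translate_def part_def)
    qed
    have "(\<Sum>m\<in>{1..Suc k}. gmult (delta (?t m)) (part m)) \<pi> =
        (\<Sum>m\<in>{1..Suc k}. if \<pi> (Suc k) = m then f \<pi> else 0)"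
      unfolding sum_fun_apply by (rule sum.cong[OF refl]) (rule summand)
    also have "\<dots> = f \<pi>"
    proof (cases "\<pi> permutes {1..Suc k}")
      case True
      then have "\<pi> (Suc k) \<in> {1..Suc k}"
        using permutes_in_image[OF True, of "Suc k"] by simp
      then show ?thesis
        by (simp only: sum.delta' finite_atLeastAtMost if_True)
    next
      case False
      then show ?thesis
        using f by (simp add: content_space_def group_algebra_iff)
    qed
    finally show "f \<pi> = (\<Sum>m\<in>{1..Suc k}. gmult (delta (?t m)) (part m)) \<pi>" ..
  qed
  also have "\<dots> \<in> induced (Suc k) (content_space k c)"
    unfolding induced_def
  proof (intro cfun.span_sum cfun.span_base CollectI exI conjI)
    fix m assume "m \<in> {1..Suc k}"
    then show "delta (?t m) \<in> group_algebra (Suc k)"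
      unfolding group_algebra_def carrier_sym_group
      by (intro delta_in_supported_on CollectI perm)
  qed (rule refl part_in)+
  finally show "f \<in> induced (Suc k) (content_space k c)" .
qed

section \<open>The sum of all transpositions\<close>

lemma transpose_conj:
  assumes "inj \<pi>"
  shows "transpose (\<pi> a) (\<pi> b) \<circ> \<pi> = \<pi> \<circ> transpose a b"
  using assms by (auto simp: fun_eq_iff transpose_def inj_eq)

text \<open>Conjugation by \<open>\<pi>\<close> permutes the transpositions.\<close>

lemma transposition_sum_central:
  fixes n :: nat
  assumes \<pi>: "\<pi> permutes {1..n}"
  shows "(\<Sum>i\<in>{1..n}. \<Sum>j\<in>{1..<i}. u (transpose j i \<circ> \<pi>)) = (\<Sum>i\<in>{1..n}. \<Sum>j\<in>{1..<i}. u (\<pi> \<circ> transpose j i))"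
proof -
  let ?S = "SIGMA i:{1..n}. {1..<i}"
  \<comment> \<open>Transpositions are indexed by pairs with the larger point first;
    \<open>max\<close> and \<open>min\<close> restore this order after applying
    \<open>p\<close>.\<close>
  define h where "h p = (\<lambda>(i, j). (max (p i) (p j), min (p i) (p j)))" for p :: "nat \<Rightarrow> nat"
  have h_in: "h p x \<in> ?S" if p: "p permutes {1..n}" and xS: "x \<in> ?S" for p x
  proof -
    obtain i j where x: "x = (i, j)" "i \<in> {1..n}" "j \<in> {1..<i}" using xS by blast
    have "p i \<noteq> p j"
      using permutes_inj[OF p] x by (auto dest: injD)
    moreover have "p i \<in> {1..n}" "p j \<in> {1..n}"
      using permutes_in_image[OF p] x by auto
    ultimately show ?thesis
      by (auto simp: h_def x(1) max_def min_def)
  qed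
  have h_inv: "h q (h p x) = x" if qp: "\<And>i. q (p i) = i" and xS: "x \<in> ?S" for p q x
  proof -
    obtain i j where "x = (i, j)" "j < i" using xS by auto
    then show ?thesis
      by (cases "p i \<le> p j") (simp_all add: h_def qp max_def min_def)
  qed
  have "(\<Sum>i\<in>{1..n}. \<Sum>j\<in>{1..<i}. u (\<pi> \<circ> transpose j i)) = (\<Sum>(i, j)\<in>?S. u (\<pi> \<circ> transpose j i))"
    by (rule sum.Sigma) auto
  also have "\<dots> = (\<Sum>(i, j)\<in>?S. u (transpose j i \<circ> \<pi>))"
  proof (rule sum.reindex_bij_witness[where i = "h (inv_into UNIV \<pi>)" and j = "h \<pi>"])
    show "h (inv_into UNIV \<pi>) (h \<pi> x) = x" if "x \<in> ?S" for x
      by (rule h_inv[OF _ that]) (rule permutes_inverses(2)[OF \<pi>])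
    show "h \<pi> (h (inv_into UNIV \<pi>) x) = x" if "x \<in> ?S" for x
      by (rule h_inv[OF _ that]) (rule permutes_inverses(1)[OF \<pi>])
    show "h \<pi> x \<in> ?S" if "x \<in> ?S" for x
      by (rule h_in[OF \<pi> that])
    show "h (inv_into UNIV \<pi>) x \<in> ?S" if "x \<in> ?S" for x
      by (rule h_in[OF permutes_inv[OF \<pi>] that])
    show "(case h \<pi> x of (i, j) \<Rightarrow> u (transpose j i \<circ> \<pi>)) = (case x of (i, j) \<Rightarrow> u (\<pi> \<circ> transpose j i))" for x
    proof (cases x)
      case (Pair i j)
      have "transpose (min (\<pi> i) (\<pi> j)) (max (\<pi> i) (\<pi> j)) = transpose (\<pi> j) (\<pi> i)"
        by (auto simp: min_def max_def transpose_commute)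
      then show ?thesis
        using transpose_conj[OF permutes_inj[OF \<pi>], of j i] by (simp add: Pair h_def)
    qed
  qed
  also have "\<dots> = (\<Sum>i\<in>{1..n}. \<Sum>j\<in>{1..<i}. u (transpose j i \<circ> \<pi>))"
    by (rule sum.Sigma[symmetric]) auto
  finally show ?thesis ..
qed

text \<open>
  The sum of all transpositions is central and acts on the module of a shape by the sum of its
  contents. So the right eigenvalue of the last Jucys-Murphy element on a submodule isomorphic to
  the module of the shape of \<open>T\<close> is the content of the last box of \<open>T\<close>.
\<close>

lemma isomorphic_submodule_subset_content_space:
  assumes T: "standard_tableau (Suc k) T"
    and U: "U \<subseteq> induced (Suc k) (content_space k (box_content T))" and mod: "sn_module (Suc k) U translate"
    and iso: "module_iso (Suc k) U translate (specht_space (tableau_shape T)) (specht_action (tableau_shape T))"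
  shows "U \<subseteq> content_space (Suc k) (box_content T)"
proof
  fix u assume u: "u \<in> U"
  let ?n = "Suc k" and ?\<rho> = "specht_action (tableau_shape T)" and ?c = "box_content T"
  have n: "1 \<le> ?n" by simp
  obtain \<phi> where lin: "Vector_Spaces.linear cscale cscale \<phi>"
    and bij: "bij_betw \<phi> U (specht_space (tableau_shape T))"
    and equiv: "\<And>\<sigma> w. \<sigma> permutes {1..?n} \<Longrightarrow> w \<in> U \<Longrightarrow> \<phi> (translate \<sigma> w) = ?\<rho> \<sigma> (\<phi> w)"
    using iso unfolding module_iso_def carrier_sym_group by blast
  note sub = sn_moduleD(1)[OF mod]
  define z where "z = (\<Sum>i\<in>{1..?n}. ?c i)"
  define Zu where "Zu = (\<Sum>i\<in>{1..?n}. algebra_act translate (jucys_murphy i) u)"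
  have \<phi>u: "\<phi> u \<in> specht_space (tableau_shape T)"
    using bij u by (rule bij_betwE[THEN bspec])
  have mod_V: "sn_module ?n (specht_space (tableau_shape T)) ?\<rho>"
    by (rule sn_module_specht[OF T n])
  have ZuU: "Zu \<in> U"
    unfolding Zu_def
    by (intro cfun.subspace_sum[OF sub] jucys_murphy_act_closed[OF mod u]) simp
  have act: "\<phi> (algebra_act translate (jucys_murphy i) u) = algebra_act ?\<rho> (jucys_murphy i) (\<phi> u)"
    if i: "i \<in> {1..?n}" for i
    unfolding jucys_murphy_act cfun_linear_sum[OF lin]
  proof (rule sum.cong[OF refl])
    fix j assume "j \<in> {1..<i}"
    then have "transpose j i permutes {1..?n}"
      using i by (intro permutes_swap_id) auto
    then show "\<phi> (translate (transpose j i) u) = ?\<rho> (transpose j i) (\<phi> u)"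
      using u by (rule equiv)
  qed
  have "\<phi> Zu = cscale (of_int z) (\<phi> u)"
  proof
    fix S
    have eq: "\<phi> Zu S = (\<Sum>i\<in>{1..?n}. algebra_act ?\<rho> (jucys_murphy i) (\<phi> u) S)"
      unfolding Zu_def cfun_linear_sum[OF lin] sum_fun_apply
      by (rule sum.cong[OF refl]) (simp only: act)
    show "\<phi> Zu S = cscale (of_int z) (\<phi> u) S"
    proof (cases "S \<in> standard_tableaux_of_shape (tableau_shape T)")
      case True
      then have S: "standard_tableau ?n S" "tableau_shape S = tableau_shape T"
        by (simp_all add: standard_tableaux_of_shape_eq[OF T])
      have "\<phi> Zu S = (\<Sum>i\<in>{1..?n}. of_int (box_content S i) * \<phi> u S)"
        unfolding eq by (rule sum.cong[OF refl]) (rule specht_action_diagonal[OF T n \<phi>u _ True])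
      also have "\<dots> = of_int (\<Sum>i\<in>{1..?n}. box_content S i) * \<phi> u S"
        by (simp only: of_int_sum sum_distrib_right)
      also have "(\<Sum>i\<in>{1..?n}. box_content S i) = z"
        unfolding z_def by (rule sum_content_shape[OF S(1) T S(2)])
      finally show ?thesis by (simp add: cscale_def)
    next
      case False
      have "\<phi> Zu \<in> specht_space (tableau_shape T)"
        using bij ZuU by (rule bij_betwE[THEN bspec])
      with False \<phi>u show ?thesis
        by (simp add: specht_space_def supported_on_def cscale_def)
    qed
  qed
  also have "\<dots> = \<phi> (cscale (of_int z) u)"
    by (rule cfun_linear_scale[OF lin, symmetric])
  finally have "Zu = cscale (of_int z) u"
    by (rule inj_onD[OF bij_betw_imp_inj_on[OF bij] _ ZuU cfun.subspace_scale[OF sub u]])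
  then have Z: "Zu \<pi> = of_int z * u \<pi>" for \<pi>
    by (simp add: cscale_def)
  note ind = induced_in_right_eigenspace[OF order_refl subsetD[OF U u]]
  have last: "right_jm ?n u \<pi> = of_int (?c ?n) * u \<pi>" for \<pi>
  proof (cases "\<pi> permutes {1..?n}")
    case True
    \<comment> \<open>\<open>translate\<close> puts the inverse of a transposition in front of
      \<open>\<pi>\<close>, which is the transposition itself; centrality then moves it to the other
      side.\<close>
    have "Zu \<pi> = (\<Sum>i\<in>{1..?n}. \<Sum>j\<in>{1..<i}. u (transpose j i \<circ> \<pi>))"
      unfolding Zu_def jucys_murphy_act sum_fun_apply by (simp add: translate_def)
    also have "\<dots> = (\<Sum>i\<in>{1..?n}. right_jm i u \<pi>)"
      unfolding transposition_sum_central[OF True] right_jm_def ..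
    also have "\<dots> = (\<Sum>i\<in>{1..k}. of_int (?c i) * u \<pi>) + right_jm ?n u \<pi>"
      using ind(2) by simp
    also have "(\<Sum>i\<in>{1..k}. of_int (?c i) * u \<pi>) = of_int (\<Sum>i\<in>{1..k}. ?c i) * u \<pi>"
      by (simp only: of_int_sum sum_distrib_right)
    finally have "of_int z * u \<pi> = of_int (\<Sum>i\<in>{1..k}. ?c i) * u \<pi> + right_jm ?n u \<pi>"
      unfolding Z .
    moreover have "z = (\<Sum>i\<in>{1..k}. ?c i) + ?c ?n"
      by (simp add: z_def)
    ultimately show ?thesis
      by (simp add: distrib_right)
  next
    case False
    have "\<not> \<pi> \<circ> transpose j ?n permutes {1..?n}" if "j \<in> {1..<?n}" for j
      using permutes_comp_transpose_iff[of j ?n ?n \<pi>] that False by simp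
    with False ind(1) show ?thesis
      by (simp add: right_jm_def group_algebra_iff)
  qed
  have "right_jm i u \<pi> = of_int (?c i) * u \<pi>" if "i \<in> {1..?n}" for i \<pi>
    using last ind(2)[of i \<pi>] that by (cases "i = ?n") auto
  with ind(1) show "u \<in> content_space ?n ?c"
    by (simp add: content_space_def)
qed

text \<open>In the recursion step the eigenspace satisfies the description, and any other candidate
  is squeezed into it by \<open>isomorphic_submodule_subset_content_space\<close>; being a nonzero
  submodule of an irreducible module, it is everything. The start holds because X_1 = 0 and the only
  content is 0.\<close>

lemma path_module_eq_content_space:
  assumes T: "standard_tableau n T" and k: "1 \<le> k" "k \<le> n"
  shows "path_module T k = content_space k (box_content T)"
  using k
proof (induction k rule: dec_induct)
  case base
  have "box_content T 1 = 0"
    using content_eq_word_content[OF T, of 1] word_content_1[OF standard_tableau_word(1)[OF T]] base by simp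
  then have "content_space 1 (box_content T) = group_algebra 1"
    by (auto simp: content_space_def right_jm_def)
  then show ?case by simp
next
  case (step k)
  obtain m where m: "k = Suc m" using step.hyps by (cases k) auto
  \<comment> \<open>The definition refers to the subtableau, whose contents on
    \<open>{1..Suc k}\<close> are those of \<open>T\<close>, so the eigenspaces can be written with
    either.\<close>
  define S where "S = subtableau T (Suc k)"
  have S: "standard_tableau (Suc k) S" and
    c: "\<And>i. i \<in> {1..Suc k} \<Longrightarrow> box_content S i = box_content T i"
    using subtableau_standard[OF T step.prems] by (simp_all add: S_def)
  let ?E = "content_space (Suc k) (box_content S)"
  let ?iso = "\<lambda>U. module_iso (Suc k) U translate (specht_space (tableau_shape S)) (specht_action (tableau_shape S))"
  have "path_module T k = content_space k (box_content T)"
    using step by simp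
  also have "\<dots> = content_space k (box_content S)"
    by (rule content_space_cong) (simp add: c)
  finally have IH: "path_module T k = content_space k (box_content S)" .
  have "path_module T (Suc k) = (THE U. U \<subseteq> induced (Suc k) (path_module T k) \<and>
      irreducible_module (Suc k) U translate \<and> ?iso U)"
    by (simp add: m S_def)
  also have "\<dots> = ?E"
  proof (rule the_equality)
    note irr = irreducible_content_space[OF S]
    show "?E \<subseteq> induced (Suc k) (path_module T k) \<and> irreducible_module (Suc k) ?E translate \<and> ?iso ?E"
      unfolding IH
      by (intro conjI content_space_subset_induced irreducible_content_space[OF S] module_iso_content_space[OF S]) simp_all
    fix U assume U: "U \<subseteq> induced (Suc k) (path_module T k) \<and> irreducible_module (Suc k) U translate \<and> ?iso U"
    then have mod: "sn_module (Suc k) U translate" and nz: "U \<noteq> {0}"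
      using irreducible_moduleD(1,2)[of "Suc k" U translate] by simp_all
    have "U \<subseteq> ?E"
      by (rule isomorphic_submodule_subset_content_space[OF S _ mod]) (use U IH in simp_all)
    then show "U = ?E"
      using irreducible_moduleD(3)[OF irr mod] nz by simp
  qed
  also have "?E = content_space (Suc k) (box_content T)"
    by (rule content_space_cong) (rule c)
  finally show ?case .
qed

lemma tableau_module_eq_content_space:
  assumes "standard_tableau n T" "1 \<le> n"
  shows "tableau_module T = content_space n (box_content T)"
  unfolding tableau_module_def length_concat_standard[OF assms(1)]
  by (rule path_module_eq_content_space[OF assms(1,2) order_refl])

theorem proposition2p4:
  fixes n :: nat
  assumes "n \<ge> 1"
  shows "(\<forall>T\<in>standard_tableaux n.
            tableau_module T \<subseteq> group_algebra n \<and>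
            irreducible_module n (tableau_module T) translate) \<and>
         is_direct_sum (group_algebra n) (standard_tableaux n) tableau_module"
proof -
  have eq: "tableau_module T = content_space n (box_content T)" if "T \<in> standard_tableaux n" for T
    using that assms by (intro tableau_module_eq_content_space) (simp_all add: standard_tableaux_def)
  have "(\<Pi>\<^sub>E T\<in>standard_tableaux n. tableau_module T) =
      (\<Pi>\<^sub>E T\<in>standard_tableaux n. content_space n (box_content T))"
    using eq by (rule PiE_cong)
  then have "is_direct_sum (group_algebra n) (standard_tableaux n) tableau_module"
    using direct_sum_content_spaces[OF assms] by (simp add: is_direct_sum_def eq)
  moreover have "tableau_module T \<subseteq> group_algebra n \<and> irreducible_module n (tableau_module T) translate"
    if T: "T \<in> standard_tableaux n" for T
    unfolding eq[OF T] using irreducible_content_space[of n T] T assms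
    by (auto simp: standard_tableaux_def content_space_def)
  ultimately show ?thesis by blast
qed

end
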